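(* Let $\underline{h}\in\mathcal{M}_{(n,\mathbf{Q})}$. The formulas $$\pi_\Lambda^m(T_0)x^\lambda=-k_0h_{\mathbf{B}(\lambda,\vartheta^\vee)}(\vartheta)q_\vartheta^{m(\vartheta)\vartheta(\lambda)}x^{s_\vartheta\lambda}+(k_0-k_0^{-1})\left(\frac{1-(q_\vartheta^{m(\vartheta)}x^{-\vartheta^\vee})^{r_{m(\vartheta)}(-\vartheta(\lambda))+\vartheta(\lambda)}}{1-(q_\vartheta^{m(\vartheta)}x^{-\vartheta^\vee})^{m(\vartheta)}}\right)x^\lambda,$$ $$\pi_\Lambda^m(T_i)x^\lambda=-k_ih_{-\mathbf{B}(\lambda,\alpha_i^\vee)}(\alpha_i)x^{s_i\lambda}+(k_i-k_i^{-1})\left(\frac{1-x^{(r_{m(\alpha_i)}(\alpha_i(\lambda))-\alpha_i(\lambda))\alpha_i^\vee}}{1-x^{m(\alpha_i)\alpha_i^\vee}}\right)x^\lambda,$$ $$\pi_\Lambda^m(x^\mu)x^\lambda=x^{\lambda+\mu}$$ for $1\le i\le r$, $\mu\in Q^{m\vee}$ and $\lambda\in\Lambda$ define a representation $\pi_\Lambda^m:\mathbb{H}^m\to\mathrm{End}(\mathcal{P}_\Lambda)$ of the metaplectic double affine Hecke algebra $\mathbb{H}^m$.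
   Context: Root data. Let $E$ be a Euclidean space with scalar product $\langle\cdot,\cdot\rangle$; its dual $E^*$ carries the transported scalar product and norm. $\Phi_0\subset E^*$ is a reduced irreducible root system (in its real span) whose long roots have squared norm $2/M^2$ for some $M\in\mathbb{Z}_{>0}$. For $\alpha\in\Phi_0$, $\alpha^\vee\in E$ is determined by $\langle y,\alpha^\vee\rangle=2\alpha(y)/\|\alpha\|^2$, $s_\alpha(y)=y-\alpha(y)\alpha^\vee$; $W_0$ is the Weyl group, $Q^\vee$ the coroot lattice, $\alpha_1,\ldots,\alpha_r$ simple roots, $s_i=s_{\alpha_i}$. $\mathbf{F}$ is a field of characteristic zero, $q\in\mathbf{F}^\times$ is not a root of unity, $q_\alpha=q^{2/\|\alpha\|^2}$ (with $2/\|\alpha\|^2\in\mathbb{Z}$). $\Lambda\subset E$ is a finitely generated abelian subgroup with $Q^\vee\subseteq\Lambda$ and $\alpha(\Lambda)\subseteq\mathbb{Z}$ for all $\alpha\in\Phi_0$; $\mathcal{P}_\Lambda=\bigoplus_{\lambda\in\Lambda}\mathbf{F}x^\lambda$ is its group algebra. Metaplectic datum. $(n,\mathbf{Q})$ consists of $n\in\mathbb{Z}_{>0}$ and a $W_0$-invariant quadratic form $\mathbf{Q}:\Lambda\to\mathbb{Q}$, integer-valued on $Q^\vee$ and positive on coroots; $\mathbf{B}(\lambda,\mu)=\mathbf{Q}(\lambda+\mu)-\mathbf{Q}(\lambda)-\mathbf{Q}(\mu)$ (so $\mathbf{B}(\lambda,\alpha^\vee)=\mathbf{Q}(\alpha^\vee)\alpha(\lambda)$).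 Put $m(\alpha)=n/\gcd(n,\mathbf{Q}(\alpha^\vee))$, $\alpha^m=m(\alpha)^{-1}\alpha$. $\Phi_0^m=\{\alpha^m\}_{\alpha\in\Phi_0}$ is the metaplectic root system, with basis $\alpha_1^m,\ldots,\alpha_r^m$, Weyl group $W_0$, coroots $\alpha^{m\vee}=m(\alpha)\alpha^\vee$ and coroot lattice $Q^{m\vee}\subseteq Q^\vee$. $\vartheta\in\Phi_0^+$ is the root such that $\vartheta^m$ is the highest root of $\Phi_0^m$. Fix $k_{\alpha^m}\in\mathbf{F}^\times$ depending only on $\|\alpha^m\|$; $k_i=k_{\alpha_i^m}$ ($1\le i\le r$), $k_0=k_{\vartheta^m}$. Metaplectic double affine Hecke algebra. $W^m=W_0\ltimes Q^{m\vee}$ acts on $\mathcal{P}_\Lambda$ by $v(x^\lambda)=x^{v\lambda}$ ($v\in W_0$), $\tau(\mu)(x^\lambda)=q^{-\langle\mu,\lambda\rangle}x^\lambda$ ($\mu\in Q^{m\vee}$). Its Coxeter generators are $s_i^m=s_i$ ($1\le i\le r$) and $s_0^m=\tau(\vartheta^{m\vee})s_\vartheta$, so $s_0^m(x^\lambda)=q_\vartheta^{m(\vartheta)\vartheta(\lambda)}x^{s_\vartheta\lambda}$. Put $x^{\alpha_0^{m\vee}}=(q_\vartheta^{m(\vartheta)}x^{-\vartheta^\vee})^{m(\vartheta)}$. $\mathbb{H}^m$ is the unital $\mathbf{F}$-algebra generated by $T_0,\ldots,T_r$ and $x^\mu$ ($\mu\in Q^{m\vee}$) with relations: braid relations of $(W^m,\{s_0^m,\ldots,s_r^m\})$;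 $(T_j-k_j)(T_j+k_j^{-1})=0$; $x^\mu x^\nu=x^{\mu+\nu}$, $x^0=1$; and $T_jx^\mu-s_j^m(x^\mu)T_j=(k_j-k_j^{-1})\frac{x^\mu-s_j^m(x^\mu)}{1-x^{\alpha_j^{m\vee}}}$ ($0\le j\le r$). Metaplectic parameters. $\mathcal{M}_{(n,\mathbf{Q})}$ is the set of tuples $\underline{h}=(h_s(\alpha))_{s\in\mathbf{Q}(\alpha^\vee)\mathbb{Z},\,\alpha\in\Phi_0}$ in $\mathbf{F}^\times$ such that $h_{s+\mathrm{lcm}(n,\mathbf{Q}(\alpha^\vee))}(v\alpha)=h_s(\alpha)$ for $v\in W_0$, $h_0(\alpha)=-1$, and $h_s(\alpha)h_{-s}(\alpha)=k_{\alpha^m}^{-2}$ for $s\in\mathbf{Q}(\alpha^\vee)\mathbb{Z}\setminus\mathrm{lcm}(n,\mathbf{Q}(\alpha^\vee))\mathbb{Z}$. For $s\in\mathbb{Z}$, $\ell\in\mathbb{Z}_{>0}$, $r_\ell(s)\in\{0,\ldots,\ell-1\}$ is the remainder of $s$ modulo $\ell$. *)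

theory Defs
  imports
    "HOL-Analysis.Analysis"
    "HOL-Library.Poly_Mapping"
    "HOL-Algebra.QuotRing"
    "HOL-Algebra.Module"
    "HOL-Algebra.Multiplicative_Group"
begin

section \<open>Root data\<close>

text \<open>
  The dual of the Euclidean space \<^typ>\<open>'e::euclidean_space\<close> is the library type of bounded
  (here: all) linear functionals.  The vector \<open>riesz \<alpha>\<close> represents \<open>\<alpha>\<close>; transporting the scalar
  product along \<open>riesz\<close> gives the scalar product on the dual, and the transported norm is the
  operator norm of the library (lemma \<open>norm_riesz\<close>).
\<close>

type_synonym 'e dual = "('e, real) blinfun"

definition riesz :: "'e::euclidean_space dual \<Rightarrow> 'e" where
  "riesz \<alpha> = (\<Sum>b\<in>Basis. blinfun_apply \<alpha> b *\<^sub>R b)"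

definition coroot :: "'e::euclidean_space dual \<Rightarrow> 'e" where
  "coroot \<alpha> = (2 / (norm \<alpha>)\<^sup>2) *\<^sub>R riesz \<alpha>"

lemma inner_riesz: "y \<bullet> riesz \<alpha> = blinfun_apply \<alpha> y"
proof -
  have "y \<bullet> riesz \<alpha> = (\<Sum>b\<in>Basis. (y \<bullet> b) * blinfun_apply \<alpha> b)"
    by (simp add: riesz_def inner_sum_right mult.commute)
  also have "\<dots> = blinfun_apply \<alpha> (\<Sum>b\<in>Basis. (y \<bullet> b) *\<^sub>R b)"
    by (simp add: blinfun.sum_right blinfun.scaleR_right)
  finally show ?thesis by (simp add: euclidean_representation)
qed

lemma norm_riesz: "norm (riesz \<alpha>) = norm \<alpha>"
proof (rule antisym)
  show "norm \<alpha> \<le> norm (riesz \<alpha>)"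
    by (rule norm_blinfun_bound)
      (auto simp: inner_riesz[symmetric] mult.commute intro: Cauchy_Schwarz_ineq2[THEN order_trans])
  have "norm (riesz \<alpha>) * norm (riesz \<alpha>) = blinfun_apply \<alpha> (riesz \<alpha>)"
    by (simp add: inner_riesz[symmetric] dot_square_norm power2_eq_square)
  also have "\<dots> \<le> norm \<alpha> * norm (riesz \<alpha>)"
    using norm_blinfun[of \<alpha> "riesz \<alpha>"] by simp
  finally show "norm (riesz \<alpha>) \<le> norm \<alpha>"
    by (cases "riesz \<alpha> = 0") (auto simp: mult_le_cancel_right)
qed

lemma inner_coroot: "y \<bullet> coroot \<alpha> = 2 * blinfun_apply \<alpha> y / (norm \<alpha>)\<^sup>2"
  by (simp add: coroot_def inner_riesz)

definition reflection :: "'e::euclidean_space dual \<Rightarrow> 'e \<Rightarrow> 'e" where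
  "reflection \<alpha> y = y - blinfun_apply \<alpha> y *\<^sub>R coroot \<alpha>"

definition dual_act :: "('e::euclidean_space \<Rightarrow> 'e) \<Rightarrow> 'e dual \<Rightarrow> 'e dual" where
  "dual_act v \<alpha> = Blinfun (\<lambda>y. blinfun_apply \<alpha> (inv_into UNIV v y))"

text \<open>On reflections the action on the dual is the usual formula.\<close>

lemma dual_act_reflection:
  assumes "\<alpha> \<noteq> 0"
  shows "dual_act (reflection \<alpha>) \<beta> = \<beta> - blinfun_apply \<beta> (coroot \<alpha>) *\<^sub>R \<alpha>"
proof -
  have c: "blinfun_apply \<alpha> (coroot \<alpha>) = 2"
    using assms by (simp add: coroot_def blinfun.scaleR_right inner_riesz[symmetric] dot_square_norm norm_riesz)
  have i: "reflection \<alpha> (reflection \<alpha> y) = y" for y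
    by (simp add: reflection_def blinfun.diff_right blinfun.scaleR_right c algebra_simps)
  have "inv_into UNIV (reflection \<alpha>) = reflection \<alpha>"
    by (rule inv_equality) (auto simp: i)
  then have "(\<lambda>y. blinfun_apply \<beta> (inv_into UNIV (reflection \<alpha>) y)) = blinfun_apply (\<beta> - blinfun_apply \<beta> (coroot \<alpha>) *\<^sub>R \<alpha>)"
    by (auto simp: reflection_def blinfun.diff_right blinfun.diff_left blinfun.scaleR_right blinfun.scaleR_left fun_eq_iff)
  then show ?thesis by (simp add: dual_act_def blinfun_apply_inverse)
qed

definition reduced_root_system :: "'e::euclidean_space dual set \<Rightarrow> bool" where
  "reduced_root_system \<Phi> \<longleftrightarrow>
     finite \<Phi> \<and> 0 \<notin> \<Phi> \<and>
     (\<forall>\<alpha>\<in>\<Phi>. \<forall>\<beta>\<in>\<Phi>. \<beta> - blinfun_apply \<beta> (coroot \<alpha>) *\<^sub>R \<alpha> \<in> \<Phi>) \<and>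
     (\<forall>\<alpha>\<in>\<Phi>. \<forall>\<beta>\<in>\<Phi>. blinfun_apply \<beta> (coroot \<alpha>) \<in> \<int>) \<and>
     (\<forall>\<alpha>\<in>\<Phi>. \<forall>c. c *\<^sub>R \<alpha> \<in> \<Phi> \<longrightarrow> c = 1 \<or> c = -1)"

definition irreducible_root_system :: "'e::euclidean_space dual set \<Rightarrow> bool" where
  "irreducible_root_system \<Phi> \<longleftrightarrow>
     \<Phi> \<noteq> {} \<and>
     \<not> (\<exists>\<Phi>1 \<Phi>2. \<Phi>1 \<noteq> {} \<and> \<Phi>2 \<noteq> {} \<and> \<Phi>1 \<inter> \<Phi>2 = {} \<and> \<Phi> = \<Phi>1 \<union> \<Phi>2 \<and>
           (\<forall>\<alpha>\<in>\<Phi>1. \<forall>\<beta>\<in>\<Phi>2. riesz \<alpha> \<bullet> riesz \<beta> = 0))"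

text \<open>The family \<open>a\<close> is only used on the indices \<open>1, \<dots>, r\<close>.\<close>

definition nonneg_comb :: "nat \<Rightarrow> (nat \<Rightarrow> 'e::euclidean_space dual) \<Rightarrow> 'e dual set" where
  "nonneg_comb r a = {\<beta>. \<exists>c :: nat \<Rightarrow> nat. \<beta> = (\<Sum>i=1..r. real (c i) *\<^sub>R a i)}"

definition simple_roots :: "'e::euclidean_space dual set \<Rightarrow> nat \<Rightarrow> (nat \<Rightarrow> 'e dual) \<Rightarrow> bool" where
  "simple_roots \<Phi> r a \<longleftrightarrow>
     inj_on a {1..r} \<and> a ` {1..r} \<subseteq> \<Phi> \<and> independent (a ` {1..r}) \<and>
     (\<forall>\<beta>\<in>\<Phi>. \<beta> \<in> nonneg_comb r a \<or> - \<beta> \<in> nonneg_comb r a)"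

definition positive_roots :: "'e::euclidean_space dual set \<Rightarrow> nat \<Rightarrow> (nat \<Rightarrow> 'e dual) \<Rightarrow> 'e dual set" where
  "positive_roots \<Phi> r a = \<Phi> \<inter> nonneg_comb r a"

definition highest_root ::
    "'e::euclidean_space dual set \<Rightarrow> nat \<Rightarrow> (nat \<Rightarrow> 'e dual) \<Rightarrow> 'e dual \<Rightarrow> bool" where
  "highest_root \<Phi> r a \<theta> \<longleftrightarrow> \<theta> \<in> \<Phi> \<and> (\<forall>\<beta>\<in>\<Phi>. \<theta> - \<beta> \<in> nonneg_comb r a)"

text \<open>The reflections are involutions, so the monoid they generate is the Weyl group.\<close>

inductive_set weyl_group :: "'e::euclidean_space dual set \<Rightarrow> ('e \<Rightarrow> 'e) set"
  for \<Phi> where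
  weyl_id: "id \<in> weyl_group \<Phi>"
| weyl_step: "v \<in> weyl_group \<Phi> \<Longrightarrow> \<alpha> \<in> \<Phi> \<Longrightarrow> reflection \<alpha> \<circ> v \<in> weyl_group \<Phi>"

definition int_span :: "'e::real_vector set \<Rightarrow> 'e set" where
  "int_span S = Modules.module.span (\<lambda>(k::int) x. of_int k *\<^sub>R x) S"

definition coroot_lattice :: "'e::euclidean_space dual set \<Rightarrow> 'e set" where
  "coroot_lattice \<Phi> = int_span (coroot ` \<Phi>)"

definition q_root :: "'f::field \<Rightarrow> 'e::euclidean_space dual \<Rightarrow> 'f" where
  "q_root q \<alpha> = q powi \<lfloor>2 / (norm \<alpha>)\<^sup>2\<rfloor>"


section \<open>Metaplectic data\<close>

definition polar_form :: "('e::euclidean_space \<Rightarrow> rat) \<Rightarrow> 'e \<Rightarrow> 'e \<Rightarrow> rat" where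
  "polar_form Q \<omega> \<mu> = Q (\<omega> + \<mu>) - Q \<omega> - Q \<mu>"

definition quadratic_form_on :: "'e::euclidean_space set \<Rightarrow> ('e \<Rightarrow> rat) \<Rightarrow> bool" where
  "quadratic_form_on \<Lambda> Q \<longleftrightarrow>
     (\<forall>\<omega>\<in>\<Lambda>. \<forall>k::int. Q (of_int k *\<^sub>R \<omega>) = of_int (k\<^sup>2) * Q \<omega>) \<and>
     (\<forall>\<omega>\<in>\<Lambda>. \<forall>\<mu>\<in>\<Lambda>. \<forall>\<nu>\<in>\<Lambda>.
        polar_form Q (\<omega> + \<mu>) \<nu> = polar_form Q \<omega> \<nu> + polar_form Q \<mu> \<nu> \<and>
        polar_form Q \<nu> (\<omega> + \<mu>) = polar_form Q \<nu> \<omega> + polar_form Q \<nu> \<mu>)"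

definition metaplectic_datum ::
    "'e::euclidean_space dual set \<Rightarrow> 'e set \<Rightarrow> nat \<Rightarrow> ('e \<Rightarrow> rat) \<Rightarrow> bool" where
  "metaplectic_datum \<Phi> \<Lambda> n Q \<longleftrightarrow>
     n > 0 \<and> quadratic_form_on \<Lambda> Q \<and>
     (\<forall>v\<in>weyl_group \<Phi>. \<forall>\<omega>\<in>\<Lambda>. Q (v \<omega>) = Q \<omega>) \<and>
     (\<forall>\<omega>\<in>coroot_lattice \<Phi>. Q \<omega> \<in> \<int>) \<and>
     (\<forall>\<alpha>\<in>\<Phi>. Q (coroot \<alpha>) > 0)"

text \<open>The integer \<open>Q(\<alpha>\<^sup>\<or>)\<close>; for a metaplectic datum the floor only changes the type.\<close>

definition Q_coroot :: "('e::euclidean_space \<Rightarrow> rat) \<Rightarrow> 'e dual \<Rightarrow> int" where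
  "Q_coroot Q \<alpha> = \<lfloor>Q (coroot \<alpha>)\<rfloor>"

definition m_root :: "nat \<Rightarrow> ('e::euclidean_space \<Rightarrow> rat) \<Rightarrow> 'e dual \<Rightarrow> int" where
  "m_root n Q \<alpha> = int n div gcd (int n) (Q_coroot Q \<alpha>)"

definition mroot :: "nat \<Rightarrow> ('e::euclidean_space \<Rightarrow> rat) \<Rightarrow> 'e dual \<Rightarrow> 'e dual" where
  "mroot n Q \<alpha> = (1 / of_int (m_root n Q \<alpha>)) *\<^sub>R \<alpha>"

definition metaplectic_parameters ::
    "'e::euclidean_space dual set \<Rightarrow> nat \<Rightarrow> ('e \<Rightarrow> rat) \<Rightarrow> ('e dual \<Rightarrow> 'f::field)
       \<Rightarrow> (int \<Rightarrow> 'e dual \<Rightarrow> 'f) set" where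
  "metaplectic_parameters \<Phi> n Q k =
     {h. \<forall>\<alpha>\<in>\<Phi>. h 0 \<alpha> = -1 \<and>
         (\<forall>s. Q_coroot Q \<alpha> dvd s \<longrightarrow>
            h s \<alpha> \<noteq> 0 \<and>
            (\<forall>v\<in>weyl_group \<Phi>. h (s + lcm (int n) (Q_coroot Q \<alpha>)) (dual_act v \<alpha>) = h s \<alpha>) \<and>
            (\<not> lcm (int n) (Q_coroot Q \<alpha>) dvd s \<longrightarrow>
               h s \<alpha> * h (- s) \<alpha> = inverse ((k (mroot n Q \<alpha>))\<^sup>2)))}"


section \<open>Group algebras of lattices\<close>

text \<open>
  \<open>Poly_Mapping.single \<omega> c\<close> is the monomial \<open>c x\<^sup>\<omega>\<close>; the group algebra of a lattice \<open>\<Lambda>\<close> consists of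
  the elements of the group algebra of the additive group of the whole space supported on \<open>\<Lambda>\<close>.
\<close>

definition group_algebra :: "'e::euclidean_space set \<Rightarrow> ('e \<Rightarrow>\<^sub>0 'f::field) set" where
  "group_algebra \<Lambda> = {p. Poly_Mapping.keys p \<subseteq> \<Lambda>}"

abbreviation xpow :: "'e::euclidean_space \<Rightarrow> 'e \<Rightarrow>\<^sub>0 'f::field" where
  "xpow \<omega> \<equiv> Poly_Mapping.single \<omega> 1"

abbreviation scale :: "'f::field \<Rightarrow> ('a \<Rightarrow>\<^sub>0 'f) \<Rightarrow> 'a \<Rightarrow>\<^sub>0 'f" where
  "scale c p \<equiv> Poly_Mapping.map ((*) c) p"

text \<open>\<open>(c x\<^sup>v)\<^sup>k\<close> for an integer exponent \<open>k\<close>, possibly negative.\<close>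

definition mono_power :: "'f::field \<Rightarrow> 'e::euclidean_space \<Rightarrow> int \<Rightarrow> 'e \<Rightarrow>\<^sub>0 'f" where
  "mono_power c v k = Poly_Mapping.single (of_int k *\<^sub>R v) (c powi k)"

text \<open>
  The exact quotient \<open>p / d\<close>: the group algebra has no zero divisors, so a quotient is unique if it
  exists.  The fractions below all have a quotient: they are of the form
  \<open>u (1 - y\<^sup>k) / (1 - y)\<close> with monomials \<open>u\<close>, \<open>y \<noteq> 1\<close> and an integer \<open>k\<close>.
\<close>

definition exact_quotient ::
    "('e::euclidean_space \<Rightarrow>\<^sub>0 'f::field) \<Rightarrow> ('e \<Rightarrow>\<^sub>0 'f) \<Rightarrow> 'e \<Rightarrow>\<^sub>0 'f" where
  "exact_quotient p d = (THE g. g * d = p)"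

section \<open>Algebras given by generators and relations\<close>

text \<open>Free monoids, so that \<^typ>\<open>'g list \<Rightarrow>\<^sub>0 'f::field\<close> is the free unital algebra on \<^typ>\<open>'g\<close>.\<close>

instantiation list :: (type) monoid_add
begin

definition zero_list_def: "0 = ([] :: 'a list)"
definition plus_list_def: "xs + ys = (xs @ ys :: 'a list)"

instance by standard (simp_all add: zero_list_def plus_list_def)

end

definition free_algebra :: "'g set \<Rightarrow> ('f::field, 'g list \<Rightarrow>\<^sub>0 'f) module" where
  "free_algebra G =
     \<lparr>carrier = {p. \<forall>w\<in>Poly_Mapping.keys p. set w \<subseteq> G}, mult = (*), one = 1, zero = 0, add = (+), smult = scale\<rparr>"

definition presented_algebra ::
    "'g set \<Rightarrow> ('g list \<Rightarrow>\<^sub>0 'f::field) set \<Rightarrow> ('f, ('g list \<Rightarrow>\<^sub>0 'f) set) module" where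
  "presented_algebra G R =
     (let A = free_algebra G; I = genideal A R; B = A Quot I in
      \<lparr>carrier = carrier B, mult = mult B, one = one B, zero = zero B, add = add B,
       smult = (\<lambda>c X. (I +>\<^bsub>A\<^esub> (c \<odot>\<^bsub>A\<^esub> \<one>\<^bsub>A\<^esub>)) \<otimes>\<^bsub>B\<^esub> X)\<rparr>)"

definition presented_gen ::
    "'g set \<Rightarrow> ('g list \<Rightarrow>\<^sub>0 'f::field) set \<Rightarrow> 'g \<Rightarrow> ('g list \<Rightarrow>\<^sub>0 'f) set" where
  "presented_gen G R g =
     genideal (free_algebra G) R +>\<^bsub>free_algebra G\<^esub> Poly_Mapping.single [g] 1"

definition algebra_hom :: "('f, 'a, 'x) module_scheme \<Rightarrow> ('f, 'b, 'y) module_scheme \<Rightarrow> ('a \<Rightarrow> 'b) set" where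
  "algebra_hom A B =
     {\<phi> \<in> ring_hom A B. \<forall>c. \<forall>a\<in>carrier A. \<phi> (c \<odot>\<^bsub>A\<^esub> a) = c \<odot>\<^bsub>B\<^esub> \<phi> a}"

definition linear_on :: "('a \<Rightarrow>\<^sub>0 'f::field) set \<Rightarrow> (('a \<Rightarrow>\<^sub>0 'f) \<Rightarrow> ('a \<Rightarrow>\<^sub>0 'f)) \<Rightarrow> bool" where
  "linear_on V f \<longleftrightarrow>
     (\<forall>p\<in>V. \<forall>p'\<in>V. f (p + p') = f p + f p') \<and> (\<forall>c. \<forall>p\<in>V. f (scale c p) = scale c (f p))"

definition End_algebra ::
    "('a \<Rightarrow>\<^sub>0 'f::field) set \<Rightarrow> ('f, ('a \<Rightarrow>\<^sub>0 'f) \<Rightarrow> ('a \<Rightarrow>\<^sub>0 'f)) module" where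
  "End_algebra V =
     \<lparr>carrier = {f \<in> V \<rightarrow>\<^sub>E V. linear_on V f},
      mult = (\<lambda>f g. \<lambda>p\<in>V. f (g p)), one = (\<lambda>p\<in>V. p), zero = (\<lambda>p\<in>V. 0),
      add = (\<lambda>f g. \<lambda>p\<in>V. f p + g p), smult = (\<lambda>c f. \<lambda>p\<in>V. scale c (f p))\<rparr>"


section \<open>The metaplectic double affine Hecke algebra\<close>

text \<open>\<open>W\<^sub>0 \<ltimes> L\<close>, where the pair \<open>(v, \<mu>)\<close> stands for \<open>\<tau>(\<mu>) v\<close>.\<close>

definition affine_weyl_group ::
    "'e::euclidean_space dual set \<Rightarrow> 'e set \<Rightarrow> (('e \<Rightarrow> 'e) \<times> 'e) monoid" where
  "affine_weyl_group \<Phi> L =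
     \<lparr>carrier = weyl_group \<Phi> \<times> L,
      mult = (\<lambda>(v, \<mu>) (v', \<mu>'). (v \<circ> v', \<mu> + v \<mu>')), one = (id, 0)\<rparr>"

text \<open>
  The image of \<open>x\<^sup>\<omega>\<close> under \<open>\<tau>(\<mu>) v\<close>.  The scalar product \<open>\<langle>\<mu>, v \<omega>\<rangle>\<close> is an integer in all uses below.
\<close>

definition affine_act_mono ::
    "'f::field \<Rightarrow> ('e::euclidean_space \<Rightarrow> 'e) \<times> 'e \<Rightarrow> 'e \<Rightarrow> 'e \<Rightarrow>\<^sub>0 'f" where
  "affine_act_mono q w \<omega> =
     Poly_Mapping.single (fst w \<omega>) (q powi (- \<lfloor>snd w \<bullet> fst w \<omega>\<rfloor>))"

datatype 'e daha_letter = HT nat | HX 'e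

abbreviation free_T :: "nat \<Rightarrow> 'e daha_letter list \<Rightarrow>\<^sub>0 'f::field" where
  "free_T j \<equiv> Poly_Mapping.single [HT j] 1"

definition free_X :: "('e \<Rightarrow>\<^sub>0 'f::field) \<Rightarrow> 'e daha_letter list \<Rightarrow>\<^sub>0 'f" where
  "free_X p = (\<Sum>\<nu>\<in>Poly_Mapping.keys p. Poly_Mapping.single [HX \<nu>] (Poly_Mapping.lookup p \<nu>))"

abbreviation free_scalar :: "'f::field \<Rightarrow> 'g list \<Rightarrow>\<^sub>0 'f" where
  "free_scalar c \<equiv> Poly_Mapping.single [] c"

text \<open>The word \<open>T\<^sub>i T\<^sub>j T\<^sub>i \<cdots>\<close> with \<open>l\<close> letters.\<close>

definition braid_word :: "nat \<Rightarrow> nat \<Rightarrow> nat \<Rightarrow> 'e daha_letter list \<Rightarrow>\<^sub>0 'f::field" where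
  "braid_word l i j =
     Poly_Mapping.single (map (\<lambda>t. HT (if even t then i else j)) [0..<l]) 1"

definition metaplectic_roots ::
    "'e::euclidean_space dual set \<Rightarrow> nat \<Rightarrow> ('e \<Rightarrow> rat) \<Rightarrow> 'e dual set" where
  "metaplectic_roots \<Phi> n Q = mroot n Q ` \<Phi>"

text \<open>\<open>s\<^sub>j\<^sup>m\<close> for \<open>0 \<le> j \<le> r\<close>.\<close>

definition affine_gen ::
    "nat \<Rightarrow> ('e::euclidean_space \<Rightarrow> rat) \<Rightarrow> (nat \<Rightarrow> 'e dual) \<Rightarrow> 'e dual \<Rightarrow> nat \<Rightarrow> ('e \<Rightarrow> 'e) \<times> 'e" where
  "affine_gen n Q a \<theta> j =
     (if j = 0 then (reflection \<theta>, coroot (mroot n Q \<theta>)) else (reflection (a j), 0))"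

text \<open>\<open>x\<close> to the power \<open>\<alpha>\<^sub>j\<^sup>m\<^sup>\<or>\<close> for \<open>0 \<le> j \<le> r\<close>.\<close>

definition affine_coroot_mono ::
    "'f::field \<Rightarrow> nat \<Rightarrow> ('e::euclidean_space \<Rightarrow> rat) \<Rightarrow> (nat \<Rightarrow> 'e dual) \<Rightarrow> 'e dual \<Rightarrow> nat \<Rightarrow> 'e \<Rightarrow>\<^sub>0 'f" where
  "affine_coroot_mono q n Q a \<theta> j =
     (if j = 0 then mono_power (q_root q \<theta> powi m_root n Q \<theta>) (- coroot \<theta>) (m_root n Q \<theta>)
      else xpow (coroot (mroot n Q (a j))))"

definition daha_param ::
    "nat \<Rightarrow> ('e::euclidean_space \<Rightarrow> rat) \<Rightarrow> ('e dual \<Rightarrow> 'f::field) \<Rightarrow> (nat \<Rightarrow> 'e dual) \<Rightarrow> 'e dual \<Rightarrow> nat \<Rightarrow> 'f" where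
  "daha_param n Q k a \<theta> j = k (mroot n Q (if j = 0 then \<theta> else a j))"

definition daha_letters ::
    "'e::euclidean_space dual set \<Rightarrow> nat \<Rightarrow> nat \<Rightarrow> ('e \<Rightarrow> rat) \<Rightarrow> 'e daha_letter set" where
  "daha_letters \<Phi> r n Q = HT ` {0..r} \<union> HX ` coroot_lattice (metaplectic_roots \<Phi> n Q)"

text \<open>
  A relation \<open>u = v\<close> is recorded as the element \<open>u - v\<close> of the free algebra.  \<open>group.ord\<close> is \<open>0\<close> on
  elements of infinite order, for which there is no braid relation.
\<close>

definition daha_relations ::
    "'e::euclidean_space dual set \<Rightarrow> nat \<Rightarrow> (nat \<Rightarrow> 'e dual) \<Rightarrow> 'e dual \<Rightarrow> nat \<Rightarrow> ('e \<Rightarrow> rat)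
       \<Rightarrow> 'f::field \<Rightarrow> ('e dual \<Rightarrow> 'f) \<Rightarrow> ('e daha_letter list \<Rightarrow>\<^sub>0 'f) set" where
  "daha_relations \<Phi> r a \<theta> n Q q k =
    (let L = coroot_lattice (metaplectic_roots \<Phi> n Q);
         W = affine_weyl_group \<Phi> L;
         s = affine_gen n Q a \<theta>;
         \<kappa> = daha_param n Q k a \<theta>
     in {braid_word l i j - braid_word l j i | l i j.
           i \<le> r \<and> j \<le> r \<and> i \<noteq> j \<and> l = group.ord W (s i \<otimes>\<^bsub>W\<^esub> s j) \<and> l > 0}
      \<union> {(free_T j - free_scalar (\<kappa> j)) * (free_T j + free_scalar (inverse (\<kappa> j))) | j. j \<le> r}
      \<union> {free_X (xpow \<mu>) * free_X (xpow \<nu>) - free_X (xpow (\<mu> + \<nu>)) | \<mu> \<nu>. \<mu> \<in> L \<and> \<nu> \<in> L}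
      \<union> {free_X (xpow 0) - 1}
      \<union> {free_T j * free_X (xpow \<mu>) - free_X (affine_act_mono q (s j) \<mu>) * free_T j
           - free_scalar (\<kappa> j - inverse (\<kappa> j)) *
             free_X (exact_quotient (xpow \<mu> - affine_act_mono q (s j) \<mu>)
                                    (1 - affine_coroot_mono q n Q a \<theta> j)) | j \<mu>.
           j \<le> r \<and> \<mu> \<in> L})"

end

theory Submission
  imports Defs
begin

text \<open>
  The operators of the generators are first defined on the group algebra of the whole space.  For a
  root \<open>\<alpha>\<close> with \<open>m = m(\<alpha>)\<close>, a weight \<open>c\<close> and \<open>z = c x\<^bsup>\<alpha>\<^sup>\<or>\<^esup>\<close> (\<open>c = 1\<close> for the simple roots, a power of \<open>q\<close>
  for the affine root, whose gradient is \<open>- \<theta>\<close>), the operator of the theorem maps \<open>x\<^sup>\<omega>\<close> to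
  \<open>\<tau>(j) x\<^sup>\<omega>\<close>, where \<open>j = \<alpha>(\<omega>)\<close> and \<open>\<tau>(j)\<close> is a combination of powers of \<open>z\<close>.  Taking
  \<open>j = \<lfloor>\<alpha>(\<omega>)\<rfloor>\<close> in general extends it to all exponents, and all the relations remain true there.
  The cross relation is then the functional equation \<open>tau_shift\<close> of \<open>\<tau>\<close>.  The quadratic
  relation is immediate on the monomials with \<open>- m \<le> j < m\<close>, where the fraction is \<open>0\<close> or \<open>1\<close>, and the
  cross relation propagates it to the others.

  The heart of the matter is the braid relation of two operators \<open>T\<^sub>1\<close>, \<open>T\<^sub>2\<close> in a finite rank two
  system, with \<open>l = 2, 3, 4\<close> or \<open>6\<close> letters.  Let \<open>K\<close> be the space on which it holds.
  The quadratic relations imply that \<open>K\<close> is stable under \<open>T\<^sub>1\<close> and \<open>T\<^sub>2\<close>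
  (\<open>braid_kernel_stable\<close>).  Let \<open>\<omega>\<close> be the fundamental coweight of the metaplectic root system dual
  to the second root; here it matters that exponents outside the given lattice are
  allowed.  When a monomial \<open>x\<^sup>\<mu>\<close> takes the value \<open>m\<close> on a root, the cross relation reads
  \<open>T x\<^sup>\<mu> = x\<^bsup>s\<mu>\<^esup> T\<^sup>-\<^sup>1\<close>.  As \<open>\<omega>\<close> is minuscule, or quasi-minuscule in type \<open>G\<^sub>2\<close>, moving \<open>x\<^sup>\<omega>\<close> through the
  two braid words shows that \<open>K\<close> is stable under multiplication by \<open>x\<^sup>\<omega>\<close>
  (\<open>translation_3\<close>, \<open>translation_4\<close>, \<open>translation_6\<close>), hence under the translations by the lattice
  spanned by the orbit of \<open>\<omega>\<close>, which takes all pairs of integers as values on the two metaplectic roots.  If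
  \<open>0 \<le> \<alpha>(\<omega>) \<le> m\<close>, then the operator of \<open>\<alpha>\<close> maps \<open>x\<^sup>\<omega>\<close> to a multiple of the reflected monomial.  So on
  the closed fundamental alcove both braid words lead to the same monomial, with the same scalar
  factors in opposite orders, and the monomials of the alcove lie in \<open>K\<close> (\<open>alcove_3\<close>, \<open>alcove_4\<close>, \<open>alcove_6\<close>).
  Similarly the set of exponents of monomials in \<open>K\<close> is stable under the simple reflections.
  Since every point is moved to the alcove by translations and reflections (\<open>reduce_A2\<close>,
  \<open>reduce_B2\<close>, \<open>reduce_G2\<close>), \<open>K\<close> is everything.  When the two roots are orthogonal the operators commute
  directly (\<open>braid_2\<close>).

  For the simple affine roots, the Cartan integers are nonpositive off the diagonal, and their
  product \<open>p\<close> is at most \<open>4\<close>.  If \<open>p = 4\<close>, the product of the two affine reflections has infinite order.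
  If \<open>p \<le> 3\<close>, its order is a multiple of \<open>2, 3, 4\<close> or \<open>6\<close>, which is all that
  is needed as a braid relation implies those whose length is a multiple (\<open>altw_dvd\<close>).  The
  metaplectic roots of the pair form a system of the same type or of the dual type
  (\<open>metaplectic_ratio\<close>).  Finally, the operators define a representation of the free algebra
  that kills the relations, and a representation is determined by the operators of the generators.
\<close>

section \<open>Monomials, linear operators and geometric sums in the group algebra\<close>

text \<open>The value of a linear functional at a vector.\<close>

notation (input) blinfun_apply (infixl "\<cdot>" 90)

abbreviation "single \<equiv> Poly_Mapping.single"
abbreviation "keys \<equiv> Poly_Mapping.keys"
abbreviation "lookup \<equiv> Poly_Mapping.lookup"

lemmas blinfun_right = blinfun.add_right blinfun.diff_right blinfun.minus_right blinfun.scaleR_right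

text \<open>The constants of the group algebra of a monoid.\<close>

abbreviation cst :: "'f::field \<Rightarrow> ('a::monoid_add \<Rightarrow>\<^sub>0 'f)" where
  "cst c \<equiv> single 0 c"

lemma sum_single_lookup:
  fixes p :: "'a \<Rightarrow>\<^sub>0 'b::comm_monoid_add"
  shows "(\<Sum>x\<in>keys p. single x (lookup p x)) = p"
proof (rule poly_mapping_eqI)
  fix y
  have "lookup (\<Sum>x\<in>keys p. single x (lookup p x)) y
      = (\<Sum>x\<in>keys p. if x = y then lookup p x else 0)"
    unfolding lookup_sum by (rule sum.cong) (auto simp: lookup_single when_def)
  also have "\<dots> = lookup p y"
    by (simp add: in_keys_iff)
  finally show "lookup (\<Sum>x\<in>keys p. single x (lookup p x)) y
    = lookup p y" .
qed

lemma poly_mapping_monomial_induct [case_names zero single add]: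
  fixes p :: "'a \<Rightarrow>\<^sub>0 'b::comm_monoid_add"
  assumes "P 0" "\<And>x c. x \<in> keys p \<Longrightarrow> P (single x c)"
    and "\<And>u v. P u \<Longrightarrow> P v \<Longrightarrow> P (u + v)"
  shows "P p"
proof -
  have "P (\<Sum>x\<in>S. single x (lookup p x))"
    if "S \<subseteq> keys p" "finite S" for S
    using that(2,1) by (induction S rule: finite_induct) (auto intro: assms)
  from this[of "keys p"] show ?thesis by (simp add: sum_single_lookup)
qed

lemma scale_eq_cst_mult: "scale c p = cst c * (p :: 'a::monoid_add \<Rightarrow>\<^sub>0 'f::field)"
  by (rule mult_map_scale_conv_mult)

lemma cst_mult: "cst (x * y) = cst x * (cst y :: 'a::monoid_add \<Rightarrow>\<^sub>0 'f::field)"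
  by (simp add: mult_single)

text \<open>Linear operators on a group algebra; the scalar \<open>c\<close> acts as multiplication by the constant \<open>c\<close>.\<close>

definition linop :: "(('a::monoid_add \<Rightarrow>\<^sub>0 'f::field) \<Rightarrow> ('a \<Rightarrow>\<^sub>0 'f)) \<Rightarrow> bool" where
  "linop T \<longleftrightarrow> (\<forall>p q. T (p + q) = T p + T q) \<and> (\<forall>c p. T (cst c * p) = cst c * T p)"

lemma linopD: assumes "linop T"
  shows linop_add: "T (p + q) = T p + T q" and linop_cst: "T (cst c * p) = cst c * T p"
  using assms by (auto simp: linop_def)

lemma linop_0: "linop T \<Longrightarrow> T 0 = 0"
  using linop_cst[of T 0 0] by simp

lemma linop_minus: "linop T \<Longrightarrow> T (- p) = - T p"
  using linop_cst[of T "-1" p] by (simp add: single_uminus)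

lemma linop_diff: "linop T \<Longrightarrow> T (p - q) = T p - T q"
  using linop_add[of T p "-q"] linop_minus[of T q] by simp

lemma linop_comp: "linop S \<Longrightarrow> linop T \<Longrightarrow> linop (\<lambda>p. S (T p))"
  by (simp add: linop_def)

lemma linop_mult_left: "linop (\<lambda>p. (u :: 'a::comm_monoid_add \<Rightarrow>\<^sub>0 'f::field) * p)"
  by (simp add: linop_def algebra_simps)

lemma linop_eqI:
  assumes S: "linop S" and T: "linop T"
    and eq: "\<And>w. w \<in> keys p \<Longrightarrow> S (single w 1) = T (single w 1)"
  shows "S p = T p"
proof (induction p rule: poly_mapping_monomial_induct)
  case zero show ?case by (simp add: linop_0 S T)
next
  case (single x c)
  have "S (cst c * single x 1) = T (cst c * single x 1)"
    using eq[OF single] by (simp only: linop_cst[OF S] linop_cst[OF T])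
  then show ?case by (simp add: mult_single)
next
  case (add u v) then show ?case by (simp add: linop_add S T)
qed

text \<open>The linear operator with \<open>x\<^sup>\<omega> \<mapsto> \<tau>(\<omega>) x\<^sup>\<omega>\<close>.\<close>

definition diag_op :: "('a \<Rightarrow> ('a::monoid_add \<Rightarrow>\<^sub>0 'f::field)) \<Rightarrow> ('a \<Rightarrow>\<^sub>0 'f) \<Rightarrow> ('a \<Rightarrow>\<^sub>0 'f)" where
  "diag_op \<tau> p = (\<Sum>w\<in>keys p. \<tau> w * single w (lookup p w))"

lemma diag_op_superset:
  assumes "finite S" "keys p \<subseteq> S"
  shows "diag_op \<tau> p = (\<Sum>w\<in>S. \<tau> w * single w (lookup p w))"
  unfolding diag_op_def using assms
  by (intro sum.mono_neutral_left) (auto simp: in_keys_iff)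

lemma diag_op_single: "diag_op \<tau> (single w c) = \<tau> w * single w c"
  using diag_op_superset[of "{w}" "single w c" \<tau>] by simp

lemma linop_diag_op:
  fixes \<tau> :: "'a \<Rightarrow> ('a::comm_monoid_add \<Rightarrow>\<^sub>0 'f::field)"
  shows "linop (diag_op \<tau>)"
proof -
  have "diag_op \<tau> (p + q) = diag_op \<tau> p + diag_op \<tau> q" for p q
  proof -
    let ?S = "keys p \<union> keys q"
    have "diag_op \<tau> (p + q) = (\<Sum>w\<in>?S. \<tau> w * single w (lookup (p + q) w))"
      by (rule diag_op_superset) (simp_all add: keys_add)
    also have "\<dots> = diag_op \<tau> p + diag_op \<tau> q"
      using diag_op_superset[of ?S p \<tau>] diag_op_superset[of ?S q \<tau>]
      by (simp add: lookup_add single_add distrib_left sum.distrib)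
    finally show ?thesis .
  qed
  moreover have "diag_op \<tau> (cst c * p) = cst c * diag_op \<tau> p" for c p
  proof -
    have l: "lookup (cst c * p) w = c * lookup p w" for w
      by (auto simp: mult_map_scale_conv_mult[symmetric] map.rep_eq when_def)
    have k: "keys (cst c * p) \<subseteq> keys p"
      by (auto simp: in_keys_iff l)
    show ?thesis
      using diag_op_superset[OF _ k, of \<tau>] 
      by (simp add: l diag_op_def sum_distrib_left mult_single mult.left_commute)
  qed
  ultimately show ?thesis by (simp add: linop_def)
qed

lemma mono_power_add:
  "c \<noteq> 0 \<Longrightarrow> mono_power c v (i + j) = mono_power c v i * mono_power c v j"
  by (simp add: mono_power_def mult_single scaleR_add_left power_int_add)

lemma mono_power_0: "mono_power c v 0 = 1"
  by (simp add: mono_power_def)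

text \<open>The quotient \<open>(1 - y\<^sup>N) / (1 - y)\<close> for \<open>y = (c x\<^sup>v)\<^sup>m\<close>, written out for both signs of \<open>N\<close>: one of
  the two sums is empty.\<close>

definition geom :: "'f::field \<Rightarrow> 'e::euclidean_space \<Rightarrow> int \<Rightarrow> int \<Rightarrow> ('e \<Rightarrow>\<^sub>0 'f)" where
  "geom c v m N = (\<Sum>j\<in>{0..<N}. mono_power c v (m * j)) - (\<Sum>j\<in>{N..<0}. mono_power c v (m * j))"

lemma geom_0 [simp]: "geom c v m 0 = 0"
  by (simp add: geom_def)

lemma geom_1 [simp]: "geom c v m 1 = 1"
proof -
  have "{0..<1::int} = {0}" by auto
  then show ?thesis by (simp add: geom_def mono_power_0)
qed

lemma geom_succ: "geom c v m (N + 1) = geom c v m N + mono_power c v (m * N)"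
proof (cases "N \<ge> 0")
  case True
  then have "{0..<N + 1} = insert N {0..<N}" "{N..<0} = {}" "{N+1..<0} = {}" by auto
  then show ?thesis by (simp add: geom_def)
next
  case False
  then have "{N..<0} = insert N {N+1..<0}" "{0..<N + 1} = {}" "{0..<N} = {}" by auto
  then show ?thesis by (simp add: geom_def)
qed

lemma geom_mult: 
  assumes "c \<noteq> 0"
  shows "geom c v m N * (1 - mono_power c v m) = 1 - mono_power c v (m * N)"
proof -
  have e: "mono_power c v (m * (N + 1)) = mono_power c v (m * N) * mono_power c v m" for N
    using mono_power_add[OF assms, of v "m * N" m] by (simp add: algebra_simps)
  show ?thesis
  proof (induction N rule: int_induct[where k = 0])
    case base show ?case by (simp add: mono_power_0)
  next
    case (step1 i)
    have "geom c v m (i + 1) * (1 - mono_power c v m)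
        = geom c v m i * (1 - mono_power c v m) + mono_power c v (m * i) * (1 - mono_power c v m)"
      by (simp add: geom_succ distrib_right)
    then show ?case unfolding step1 e by (simp add: right_diff_distrib)
  next
    case (step2 i)
    have "(geom c v m (i - 1) + mono_power c v (m * (i - 1))) * (1 - mono_power c v m) = 1 - mono_power c v (m * i)"
      using step2 geom_succ[of c v m "i - 1"] by simp
    with e[of "i - 1"] show ?case by (simp add: algebra_simps)
  qed
qed

lemma one_minus_monomial_regular:
  fixes g :: "'e::euclidean_space \<Rightarrow>\<^sub>0 'f::field"
  assumes v: "v \<noteq> 0" and g: "g * (1 - single v c) = 0"
  shows "g = 0"
proof (rule ccontr)
  assume "g \<noteq> 0"
  then have ne: "keys g \<noteq> {}" by simp
  \<comment> \<open>compare the two sides at a key with the smallest scalar product with \<open>v\<close>\<close>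
  have "\<exists>w\<in>keys g. \<forall>w'\<in>keys g. w \<bullet> v \<le> w' \<bullet> v"
    using ex_min_if_finite[of "(\<lambda>w. w \<bullet> v) ` keys g"] ne
    by (auto simp: not_less)
  then obtain w where w: "w \<in> keys g" and min: "\<And>w'. w' \<in> keys g \<Longrightarrow> w \<bullet> v \<le> w' \<bullet> v"
    by blast
  have eq: "g = g * single v c" using g by (simp add: algebra_simps)
  then have "w \<in> keys (g * single v c)" using w by simp
  then obtain w' where w': "w' \<in> keys g" "w = w' + v"
    using keys_mult[of g "single v c"] by (auto split: if_splits)
  have "w \<bullet> v = w' \<bullet> v + v \<bullet> v" by (simp add: w' inner_add_left)
  moreover have "v \<bullet> v > 0" using v by simp
  ultimately show False using min[OF w'(1)] by linarith
qed

lemma exact_quotient_monomial: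
  fixes g :: "'e::euclidean_space \<Rightarrow>\<^sub>0 'f::field"
  assumes v: "v \<noteq> 0" and g: "g * (1 - single v c) = p"
  shows "exact_quotient p (1 - single v c) = g"
  unfolding exact_quotient_def
proof (rule the_equality)
  show "g * (1 - single v c) = p" by fact
  fix g' assume "g' * (1 - single v c) = p"
  then have "(g' - g) * (1 - single v c) = 0" using g by (simp add: left_diff_distrib)
  from one_minus_monomial_regular[OF v this] show "g' = g" by simp
qed

text \<open>The fractions in the theorem are of this form.\<close>

lemma exact_quotient_geom:
  assumes "v \<noteq> 0" "c \<noteq> 0" "m \<noteq> 0"
  shows "exact_quotient (u * (1 - mono_power c v (m * N))) (1 - mono_power c v m) = u * geom c v m N"
proof -
  have "u * geom c v m N * (1 - mono_power c v m) = u * (1 - mono_power c v (m * N))"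
    using geom_mult[OF assms(2), of v m N] by (simp add: mult.assoc)
  then show ?thesis
    using exact_quotient_monomial[of "of_int m *\<^sub>R v" _ "c powi m"] assms
    unfolding mono_power_def by (metis of_int_eq_0_iff scaleR_eq_0_iff)
qed

lemma geom_add:
  assumes "v \<noteq> 0" "c \<noteq> 0" "m \<noteq> 0"
  shows "geom c v m (M + N) = geom c v m M + mono_power c v (m * M) * geom c v m N"
proof -
  have "(geom c v m M + mono_power c v (m * M) * geom c v m N) * (1 - mono_power c v m)
     = 1 - mono_power c v (m * (M + N))"
    using geom_mult[OF assms(2), of v m M] geom_mult[OF assms(2), of v m N]
    by (simp only: distrib_right mult.assoc distrib_left mono_power_add[OF assms(2)])
      (simp add: right_diff_distrib)
  moreover have "geom c v m (M+N) * (1 - mono_power c v m) = 1 - mono_power c v (m * (M + N))"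
    by (rule geom_mult[OF assms(2)])
  ultimately have "(geom c v m (M + N) - (geom c v m M + mono_power c v (m * M) * geom c v m N)) * (1 - mono_power c v m) = 0"
    by (simp only: left_diff_distrib diff_self)
  then have "(geom c v m (M + N) - (geom c v m M + mono_power c v (m * M) * geom c v m N))
      * (1 - single (of_int m *\<^sub>R v) (c powi m)) = 0"
    by (simp only: mono_power_def)
  moreover have "of_int m *\<^sub>R v \<noteq> 0" using assms by simp
  ultimately have "geom c v m (M + N) - (geom c v m M + mono_power c v (m * M) * geom c v m N) = 0"
    by (rule one_minus_monomial_regular[rotated])
  then show ?thesis by simp
qed

lemma geom_m1: 
  assumes "v \<noteq> 0" "c \<noteq> 0" "m \<noteq> 0"
  shows "geom c v m (-1) = - mono_power c v (- m)"
  using geom_add[OF assms, of "-1" 1] by (simp add: add_eq_0_iff2)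

lemma keys_geom: "keys (geom c v m N) \<subseteq> (\<lambda>j::int. (of_int (m * j)) *\<^sub>R v) ` UNIV"
proof -
  have "keys (\<Sum>j\<in>S. mono_power c v (m * j)) \<subseteq> (\<lambda>j::int. (of_int (m * j)) *\<^sub>R v) ` UNIV" (is "_ \<subseteq> ?K") for S
  proof (induction S rule: infinite_finite_induct)
    case (insert j S)
    have "keys (mono_power c v (m * j)) \<subseteq> ?K" by (auto simp: mono_power_def)
    with insert have "keys (mono_power c v (m * j) + (\<Sum>j\<in>S. mono_power c v (m * j))) \<subseteq> ?K"
      by (intro order_trans[OF keys_add] Un_least)
    then show ?case using insert by simp
  qed simp_all
  then show ?thesis unfolding geom_def by (intro order_trans[OF keys_diff] Un_least)
qed


section \<open>The metaplectic Demazure--Lusztig operator of one root\<close>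

text \<open>
  One root \<open>\<alpha>\<close> with \<open>m = m(\<alpha>)\<close>.  The monomial \<open>z = c x\<^bsup>\<alpha>\<^sup>\<or>\<^esup>\<close> replaces \<open>x\<^bsup>\<alpha>\<^sup>\<or>\<^esup>\<close>, so that the affine root is
  covered as well.  The number \<open>F j\<close> is the coefficient of the reflected monomial in the image of
  \<open>x\<^sup>\<omega>\<close> with \<open>\<alpha>(\<omega>) = j\<close>.  Only the three stated properties of the metaplectic parameters matter.
\<close>

locale metaplectic_operator =
  fixes \<alpha> :: "'e::euclidean_space dual" and m :: int and c k :: "'f::field" and F :: "int \<Rightarrow> 'f"
  assumes alpha_nz: "\<alpha> \<noteq> 0" and m_pos: "m > 0" and c_nz: "c \<noteq> 0" and k_nz: "k \<noteq> 0"
    and F_dvd: "m dvd j \<Longrightarrow> F j = k"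
    and F_inv: "\<not> m dvd j \<Longrightarrow> F j * F (- j) = 1"
    and F_per: "F (j + m) = F j"
begin

text \<open>The power \<open>z\<^sup>j\<close>.\<close>

definition Z :: "int \<Rightarrow> ('e \<Rightarrow>\<^sub>0 'f)" where "Z j = mono_power c (coroot \<alpha>) j"

text \<open>The parameter of the quadratic relation \<open>T\<^sup>2 = \<kappa> T + 1\<close>.\<close>

definition \<kappa> :: 'f where "\<kappa> = k - inverse k"

text \<open>The quotient \<open>(1 - z\<^bsup>m N\<^esup>) / (1 - z\<^sup>m)\<close>.\<close>

definition G :: "int \<Rightarrow> ('e \<Rightarrow>\<^sub>0 'f)" where "G N = geom c (coroot \<alpha>) m N"

text \<open>For \<open>0 \<le> j \<le> m\<close> the operator maps \<open>x\<^sup>\<omega>\<close> with \<open>\<alpha>(\<omega>) = j\<close> to \<open>\<phi> j z\<^sup>-\<^sup>j x\<^sup>\<omega>\<close>; see \<open>tau_small\<close>.\<close>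

definition \<phi> :: "int \<Rightarrow> 'f" where "\<phi> j = (if j = m then inverse k else F j)"

text \<open>The factor by which the operator multiplies \<open>x\<^sup>\<omega>\<close> with \<open>\<lfloor>\<alpha>(\<omega>)\<rfloor> = j\<close>.  The reflected monomial is
  \<open>z\<^sup>-\<^sup>j x\<^sup>\<omega>\<close>, and the exponent \<open>r\<^sub>m(j) - j\<close> of the theorem is \<open>m\<close> times \<open>- (j div m)\<close>.  The floor makes the
  operator total; the integrality of \<open>\<alpha>(\<omega>)\<close> is never used, as all shifts of exponents below
  change \<open>\<alpha>(\<omega>)\<close> by integers.\<close>

definition tau :: "int \<Rightarrow> ('e \<Rightarrow>\<^sub>0 'f)" where
  "tau j = cst (F j) * Z (- j) + cst \<kappa> * G (- (j div m))"

text \<open>The metaplectic Demazure--Lusztig operator.\<close>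

definition T :: "('e \<Rightarrow>\<^sub>0 'f) \<Rightarrow> ('e \<Rightarrow>\<^sub>0 'f)" where
  "T = diag_op (\<lambda>w. tau \<lfloor>\<alpha> \<cdot> w\<rfloor>)"

lemma alpha_coroot: "\<alpha> \<cdot> (coroot \<alpha>) = 2"
  using alpha_nz
  by (simp add: coroot_def blinfun.scaleR_right inner_riesz[symmetric] dot_square_norm norm_riesz)

lemma coroot_nz: "coroot \<alpha> \<noteq> 0"
  using alpha_coroot by (auto simp: blinfun.zero_right)

lemma Z_add: "Z (i + j) = Z i * Z j"
  by (simp add: Z_def mono_power_add c_nz)

lemma Z_0 [simp]: "Z 0 = 1"
  by (simp add: Z_def mono_power_0)

lemma Z_cancel: "Z (- j) * (Z j * p) = p" "Z j * (Z (- j) * p) = p"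
  using Z_add[of j "-j"] Z_add[of "-j" j] by (simp_all add: mult.assoc[symmetric])

lemma G_add: "G (M + N) = G M + Z (m * M) * G N"
  unfolding G_def Z_def using geom_add[OF coroot_nz c_nz] m_pos by simp

lemma G_0 [simp]: "G 0 = 0" and G_1 [simp]: "G 1 = 1"
  by (simp_all add: G_def)

lemma G_m1: "G (-1) = - Z (- m)"
  unfolding G_def Z_def using geom_m1[OF coroot_nz c_nz] m_pos by simp

lemma linop_T: "linop T"
  by (simp add: T_def linop_diag_op)

lemmas T_add = linop_add[OF linop_T] and T_cst = linop_cst[OF linop_T]
  and T_diff = linop_diff[OF linop_T] and T_minus = linop_minus[OF linop_T] and T_0 = linop_0[OF linop_T]

lemma T_single: "T (single w u) = tau \<lfloor>\<alpha> \<cdot> w\<rfloor> * single w u"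
  by (simp add: T_def diag_op_single)

lemma F_per_int: "F (j + m * N) = F j"
proof (induction N rule: int_induct[where k = 0])
  case (step1 i) then show ?case using F_per[of "j + m * i"] by (simp add: algebra_simps)
next
  case (step2 i) then show ?case using F_per[of "j + m * (i - 1)"] by (simp add: algebra_simps)
qed simp

lemma tau_shift: "tau (j + m * N) = Z (- (m * N)) * tau j + cst \<kappa> * G (- N)"
proof -
  have "(j + m * N) div m = N + j div m" using m_pos by simp
  then have "G (- ((j + m * N) div m)) = G (- N) + Z (- (m * N)) * G (- (j div m))"
    using G_add[of "-N" "- (j div m)"] by simp
  moreover have "Z (- (j + m * N)) = Z (- (m * N)) * Z (- j)"
    using Z_add[of "- (m * N)" "- j"] by (simp add: algebra_simps)
  ultimately show ?thesis
    unfolding tau_def F_per_int by (simp add: distrib_left mult.left_commute mult.assoc)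
qed

text \<open>The cross relation for monomials whose exponent takes a value in \<open>m \<int>\<close> on the root.\<close>

lemma cross:
  assumes "\<alpha> \<cdot> \<mu> = of_int (m * N)"
  shows "T (single \<mu> u * p)
    = Z (- (m * N)) * (single \<mu> u * T p) + cst \<kappa> * (G (- N) * (single \<mu> u * p))"
    (is "_ = ?R p")
proof (rule linop_eqI[of "\<lambda>p. T (single \<mu> u * p)" ?R])
  show "linop (\<lambda>p. T (single \<mu> u * p))" by (rule linop_comp[OF linop_T linop_mult_left])
  show "linop ?R"
    unfolding linop_def T_add T_cst by (simp add: distrib_left mult.left_commute add_ac)
  fix w
  have "\<lfloor>\<alpha> \<cdot> (\<mu> + w)\<rfloor> = \<lfloor>\<alpha> \<cdot> w\<rfloor> + m * N"
    by (simp only: blinfun.add_right assms add.commute[of "of_int _"] floor_add_int)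
  then have "T (single (\<mu> + w) u) = tau (\<lfloor>\<alpha> \<cdot> w\<rfloor> + m * N) * single (\<mu> + w) u"
    by (simp only: T_single)
  also have "single (\<mu> + w) u = single \<mu> u * xpow w"
    by (simp add: mult_single)
  finally show "T (single \<mu> u * xpow w) = ?R (xpow w)"
    unfolding tau_shift by (simp add: T_single algebra_simps)
qed

lemma cross_0:
  assumes "\<alpha> \<cdot> \<mu> = 0"
  shows "T (single \<mu> u * p) = single \<mu> u * T p"
  using cross[of \<mu> 0 u p] assms by simp

lemma cross_1:
  assumes "\<alpha> \<cdot> \<mu> = of_int m"
  shows "T (single \<mu> u * p) = Z (- m) * (single \<mu> u * (T p - cst \<kappa> * p))"
  using cross[of \<mu> 1 u p] assms by (simp add: G_m1 algebra_simps)

lemma cross_2: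
  assumes "\<alpha> \<cdot> \<mu> = of_int (2 * m)"
  shows "T (single \<mu> u * p) = Z (- (2 * m)) * (single \<mu> u * (T p - cst \<kappa> * p))
    - cst \<kappa> * (Z (- m) * (single \<mu> u * p))"
proof -
  have "G (- 2) = - Z (- m) - Z (- (2 * m))"
    using G_add[of "-1" "-1"] Z_add[of "-m" "-m"] by (simp add: G_m1)
  moreover have "T (single \<mu> u * p) = Z (- (2 * m)) * (single \<mu> u * T p)
      + cst \<kappa> * (G (- 2) * (single \<mu> u * p))"
    using cross[of \<mu> 2 u p] assms unfolding mult.commute[of m 2] by simp
  ultimately show ?thesis
    by (simp add: distrib_left distrib_right right_diff_distrib left_diff_distrib mult.left_commute)
qed

lemma Z_eq_single: "Z j = single (of_int j *\<^sub>R coroot \<alpha>) (c powi j)"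
  by (simp add: Z_def mono_power_def)

lemma alpha_Z: "\<alpha> \<cdot> (of_int j *\<^sub>R coroot \<alpha>) = of_int (2 * j)"
  by (simp add: blinfun.scaleR_right alpha_coroot)

lemma T_Z_m: "T (Z m * p) = Z (- m) * (T p - cst \<kappa> * p) - cst \<kappa> * p"
proof -
  have 1: "Z (- (2 * m)) * (Z m * q) = Z (- m) * q" for q
    using Z_add[of "- (2 * m)" m] by (simp add: mult.assoc[symmetric])
  have "\<alpha> \<cdot> (of_int m *\<^sub>R coroot \<alpha>) = of_int (2 * m)" by (rule alpha_Z)
  from cross_2[OF this, of "c powi m" p] show ?thesis
    unfolding Z_eq_single[symmetric] 1 Z_cancel .
qed

lemma T_Z_neg_m: "T (Z (- m) * p) = Z m * T p + cst \<kappa> * (Z (- m) * p + p)"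
proof -
  have 1: "Z (2 * m) * (Z (- m) * q) = Z m * q" for q
    using Z_add[of "2 * m" "- m"] by (simp add: mult.assoc[symmetric])
  have 2: "G 2 * (Z (- m) * p) = Z (- m) * p + p"
    using G_add[of 1 1] Z_cancel(2)[of m p] by (simp add: distrib_right mult.assoc)
  have "\<alpha> \<cdot> (of_int (- m) *\<^sub>R coroot \<alpha>) = of_int (m * (- 2))" unfolding alpha_Z by simp
  from cross[OF this, of "c powi (- m)" p] show ?thesis
    unfolding Z_eq_single[symmetric] mult_minus_right minus_minus mult.commute[of m 2] 1 2 .
qed

lemma tau_small: assumes "0 \<le> j" "j \<le> m" shows "tau j = cst (\<phi> j) * Z (- j)"
proof (cases "j = m")
  case True
  then show ?thesis using m_pos
    by (simp add: tau_def F_dvd \<phi>_def G_m1 \<kappa>_def single_diff algebra_simps)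
next
  case False
  then show ?thesis using assms by (simp add: tau_def \<phi>_def)
qed

lemma tau_small_neg: assumes "- m \<le> j" "j < 0" shows "tau j = cst (F j) * Z (- j) + cst \<kappa>"
proof -
  have "j div m = -1" using assms m_pos by (intro int_div_pos_eq[of _ _ _ "j + m"]) auto
  then show ?thesis by (simp add: tau_def)
qed

lemma phi_nz: "\<phi> j \<noteq> 0"
  using F_dvd[of j] F_inv[of j] k_nz by (cases "m dvd j") (auto simp: \<phi>_def)

lemma F_nz: "F j \<noteq> 0"
  using F_dvd[of j] F_inv[of j] k_nz by (cases "m dvd j") auto

lemma T_Z_single: 
  assumes "\<lfloor>\<alpha> \<cdot> w\<rfloor> = j"
  shows "T (Z i * single w u) = tau (j + 2 * i) * (Z i * single w u)"
proof -
  have "\<lfloor>\<alpha> \<cdot> (of_int i *\<^sub>R coroot \<alpha> + w)\<rfloor> = j + 2 * i"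
    unfolding blinfun.add_right alpha_Z using assms by linarith
  then show ?thesis by (simp add: Z_eq_single mult_single T_single)
qed

text \<open>The quadratic relation holds on the monomials with \<open>- m \<le> j < m\<close> and is preserved by
  multiplication by \<open>z\<^sup>m\<close> and its inverse.\<close>

lemma quadratic: "T (T p) = cst \<kappa> * T p + p"
proof -
  let ?K = "\<lambda>p. T (T p) = cst \<kappa> * T p + p"
  have up: "?K (Z m * p)" if "?K p" for p
  proof -
    have "T (T (Z m * p)) = Z m * (T (T p) - cst \<kappa> * T p)
        + cst \<kappa> * (Z (- m) * (T p - cst \<kappa> * p) + (T p - cst \<kappa> * p)) - cst \<kappa> * T p"
      by (simp only: T_Z_m T_Z_neg_m T_diff T_cst)
    with that show ?thesis by (simp add: T_Z_m right_diff_distrib distrib_left mult.left_commute)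
  qed
  have down: "?K (Z (- m) * p)" if "?K p" for p
  proof -
    have "T (T (Z (- m) * p)) = Z (- m) * (T (T p) - cst \<kappa> * T p) - cst \<kappa> * T p
        + cst \<kappa> * (Z m * T p + cst \<kappa> * (Z (- m) * p + p) + T p)"
      by (simp only: T_Z_m T_Z_neg_m T_add T_cst)
    with that show ?thesis by (simp add: T_Z_neg_m right_diff_distrib distrib_left mult.left_commute)
  qed
  have base: "?K (xpow w)" if range: "- m \<le> \<lfloor>\<alpha> \<cdot> w\<rfloor>" "\<lfloor>\<alpha> \<cdot> w\<rfloor> < m" for w
  proof -
    define j where "j = \<lfloor>\<alpha> \<cdot> w\<rfloor>"
    let ?e = "xpow w"
    have Te: "T ?e = tau j * ?e" by (simp add: T_single j_def)
    have TZ: "T (Z (- j) * ?e) = tau (- j) * (Z (- j) * ?e)" 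
      using T_Z_single[OF j_def[symmetric], of "-j" 1] by simp
    consider "j = 0" | "0 < j" "j < m" | "- m \<le> j" "j < 0" using range unfolding j_def by linarith
    then show ?thesis
    proof cases
      case 1
      have "k * k = \<kappa> * k + 1" using k_nz by (simp add: \<kappa>_def algebra_simps)
      then have kk: "cst (k * k) * ?e = cst (\<kappa> * k + 1) * ?e" by simp
      have "tau j = cst k" using 1 m_pos tau_small[of 0] by (simp add: \<phi>_def F_dvd)
      then have T1: "T ?e = cst k * ?e" using Te by simp
      then have "T (T ?e) = cst (k * k) * ?e" by (simp only: T_cst cst_mult mult.assoc)
      then show ?thesis unfolding kk T1 by (simp add: single_add distrib_right mult_single)
    next
      case 2
      have nd: "\<not> m dvd j" using 2 by (auto dest: zdvd_imp_le)
      have f: "cst (F j) * (cst (F (- j)) * p) = p" for p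
        using F_inv[OF nd] by (simp add: mult_single mult.assoc[symmetric])
      have "T ?e = cst (F j) * (Z (- j) * ?e)" using Te tau_small[of j] 2 by (simp add: \<phi>_def mult.assoc)
      moreover have "T (Z (- j) * ?e) = cst (F (- j)) * ?e + cst \<kappa> * (Z (- j) * ?e)"
        using tau_small_neg[of "-j"] 2 Z_cancel(2)[of j ?e] unfolding TZ by (simp add: distrib_right mult.assoc)
      ultimately show ?thesis using f by (simp add: T_cst distrib_left mult.left_commute add.commute)
    next
      case 3
      have f: "cst (F j) * (cst (\<phi> (- j)) * p) = p" for p
      proof -
        have "F j * \<phi> (- j) = 1"
        proof (cases "j = -m")
          case True then show ?thesis using k_nz by (simp add: \<phi>_def F_dvd)
        next
          case False
          then have "\<not> m dvd j" using 3 m_pos zdvd_imp_le[of m "-j"] by auto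
          then show ?thesis using F_inv[of j] False by (auto simp: \<phi>_def)
        qed
        then show ?thesis by (simp add: mult_single mult.assoc[symmetric])
      qed
      have T1: "T ?e = cst (F j) * (Z (- j) * ?e) + cst \<kappa> * ?e"
        using Te tau_small_neg[of j] 3 by (simp add: distrib_right mult.assoc)
      moreover have "T (Z (- j) * ?e) = cst (\<phi> (- j)) * ?e"
        using tau_small[of "-j"] 3 Z_cancel(2)[of j ?e] unfolding TZ by (simp add: mult.assoc)
      ultimately have "T (T ?e) = ?e + cst \<kappa> * T ?e" using f by (simp add: T_cst T_add)
      then show ?thesis by simp
    qed
  qed
  have all: "?K (xpow w)" for w
  proof (induction "nat \<bar>\<lfloor>\<alpha> \<cdot> w\<rfloor>\<bar>" arbitrary: w rule: less_induct)
    case less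
    let ?j = "\<lfloor>\<alpha> \<cdot> w\<rfloor>"
    have step: "\<lfloor>\<alpha> \<cdot> (w + of_int i *\<^sub>R coroot \<alpha>)\<rfloor> = ?j + 2 * i" for i
      unfolding blinfun.add_right alpha_Z by linarith
    have e: "xpow w = cst (c powi i) * (Z (- i) * xpow (w + of_int i *\<^sub>R coroot \<alpha>))" for i
      using c_nz by (simp add: Z_eq_single mult_single power_int_minus)
    consider "- m \<le> ?j" "?j < m" | "?j \<ge> m" | "?j < - m" by linarith
    then show ?case
    proof cases
      case 1 then show ?thesis by (rule base)
    next
      case 2
      show ?thesis
      proof (cases "?j = m")
        case True
        have "?K (single (w + of_int (- m) *\<^sub>R coroot \<alpha>) 1)"
          by (rule base) (unfold step, use True m_pos in auto)
        from up[OF this] show ?thesis unfolding e[of "-m"] minus_minus T_cst by (simp only: distrib_left mult.left_commute)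
      next
        case False
        have "?K (single (w + of_int (- m) *\<^sub>R coroot \<alpha>) 1)"
          by (rule less) (unfold step, use 2 False m_pos in auto)
        from up[OF this] show ?thesis unfolding e[of "-m"] minus_minus T_cst by (simp only: distrib_left mult.left_commute)
      qed
    next
      case 3
      have "?K (xpow (w + of_int m *\<^sub>R coroot \<alpha>))"
        by (rule less) (unfold step, use 3 m_pos in auto)
      from down[OF this] show ?thesis unfolding e[of m] T_cst by (simp only: distrib_left mult.left_commute)
    qed
  qed
  show ?thesis
    by (rule linop_eqI[of "\<lambda>p. T (T p)" "\<lambda>p. cst \<kappa> * T p + p"])
      (simp_all add: linop_def T_add T_cst distrib_left mult.left_commute add_ac all)
qed

text \<open>The inverse operator.\<close>

definition Tinv :: "('e \<Rightarrow>\<^sub>0 'f) \<Rightarrow> ('e \<Rightarrow>\<^sub>0 'f)" where "Tinv p = T p - cst \<kappa> * p"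

lemma T_Tinv: "T (Tinv p) = p" and Tinv_T: "Tinv (T p) = p"
  by (simp_all add: Tinv_def T_diff T_cst quadratic)

lemma keys_tau: "keys (tau j) \<subseteq> (\<lambda>i::int. of_int i *\<^sub>R coroot \<alpha>) ` UNIV" (is "_ \<subseteq> ?M")
proof -
  have M: "0 + u \<in> ?M" if "u \<in> ?M" for u using that by simp
  have Z: "keys (Z i) \<subseteq> ?M" for i by (auto simp: Z_eq_single)
  have G: "keys (G N) \<subseteq> ?M" for N
    unfolding G_def using keys_geom[of c "coroot \<alpha>" m N] by blast
  have C: "keys (cst d * p) \<subseteq> ?M" if "keys p \<subseteq> ?M" for d p
    using keys_mult[of "cst d" p] that by (fastforce split: if_splits)
  show ?thesis unfolding tau_def
    by (rule order_trans[OF keys_add]) (use C Z G in blast)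
qed

text \<open>The operator commutes with the elements supported on the kernel of the root.\<close>

lemma cross_ker:
  assumes "\<And>w. w \<in> keys u \<Longrightarrow> \<alpha> \<cdot> w = 0"
  shows "T (u * p) = u * T p"
proof (rule linop_eqI[of "\<lambda>u. T (u * p)" "\<lambda>u. u * T p"])
  show "linop (\<lambda>u. T (u * p))" "linop (\<lambda>u. u * T p)"
    by (simp_all add: linop_def T_add T_cst distrib_right mult.assoc)
qed (simp add: cross_0 assms)

lemma cross_1':
  assumes "\<alpha> \<cdot> \<mu> = of_int m"
  shows "T (single \<mu> u * p) = single (\<mu> - of_int m *\<^sub>R coroot \<alpha>) (c powi (- m) * u) * Tinv p"
  unfolding cross_1[OF assms] Tinv_def[symmetric]
  by (simp add: Z_eq_single mult_single mult.assoc[symmetric])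

lemma cross_2':
  assumes "\<alpha> \<cdot> \<mu> = of_int (2 * m)"
  shows "T (single \<mu> u * p) = single (\<mu> - of_int (2 * m) *\<^sub>R coroot \<alpha>) (c powi (- (2 * m)) * u) * Tinv p
    - cst \<kappa> * (single (\<mu> - of_int m *\<^sub>R coroot \<alpha>) (c powi (- m) * u) * p)"
  unfolding cross_2[OF assms] Tinv_def[symmetric]
  by (simp add: Z_eq_single mult_single mult.assoc[symmetric])

text \<open>Subspaces that are stable under the operator.\<close>

context
  fixes K :: "('e \<Rightarrow>\<^sub>0 'f) set"
  assumes K_add: "\<And>p p'. p \<in> K \<Longrightarrow> p' \<in> K \<Longrightarrow> p + p' \<in> K"
    and K_cst: "\<And>d p. p \<in> K \<Longrightarrow> cst d * p \<in> K"
    and K_T: "\<And>p. p \<in> K \<Longrightarrow> T p \<in> K"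
begin

lemma K_diff: "p \<in> K \<Longrightarrow> p' \<in> K \<Longrightarrow> p - p' \<in> K"
  using K_add[OF _ K_cst, of p p' "-1"] by (simp add: single_uminus)

lemma K_Tinv: "p \<in> K \<Longrightarrow> Tinv p \<in> K"
  unfolding Tinv_def by (intro K_diff K_T K_cst)

lemma K_cst_cancel: "cst d * p \<in> K \<Longrightarrow> d \<noteq> 0 \<Longrightarrow> p \<in> K"
  using K_cst[of "cst d * p" "inverse d"] by (simp add: mult.assoc[symmetric] mult_single)

lemma single_Z: "xpow (w + of_int i *\<^sub>R coroot \<alpha>) = cst (c powi (- i)) * (Z i * xpow w)"
  using c_nz by (simp add: Z_eq_single mult_single power_int_minus add.commute)

text \<open>For \<open>- m \<le> j \<le> m\<close> the image of \<open>x\<^sup>\<omega>\<close> is a multiple of the reflected monomial plus a multiple of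
  \<open>x\<^sup>\<omega>\<close> itself, so a stable subspace that contains \<open>x\<^sup>\<omega>\<close> contains the reflected monomial.\<close>

lemma stable_reflection:
  assumes w: "xpow w \<in> K" and j: "\<lfloor>\<alpha> \<cdot> w\<rfloor> = j" "- m \<le> j" "j \<le> m"
  shows "xpow (w - of_int j *\<^sub>R coroot \<alpha>) \<in> K"
proof -
  let ?e = "xpow w"
  have Te: "tau j * ?e \<in> K" using K_T[OF w] j by (simp add: T_single)
  have "Z (- j) * ?e \<in> K"
  proof (cases "0 \<le> j")
    case True
    then have "cst (\<phi> j) * (Z (- j) * ?e) \<in> K" using Te tau_small[of j] j by (simp add: mult.assoc)
    then show ?thesis by (rule K_cst_cancel[OF _ phi_nz])
  next
    case False
    then have "cst (F j) * (Z (- j) * ?e) + cst \<kappa> * ?e \<in> K"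
      using Te tau_small_neg[of j] j by (simp add: mult.assoc distrib_right)
    from K_diff[OF this K_cst[OF w, of \<kappa>]] have "cst (F j) * (Z (- j) * ?e) \<in> K" by simp
    then show ?thesis by (rule K_cst_cancel[OF _ F_nz])
  qed
  from K_cst[OF this] show ?thesis using single_Z[of w "-j"] by simp
qed

text \<open>Reflection of exponents whose monomials multiply the subspace into itself, by \<open>T x\<^sup>\<mu> T = x\<^bsup>s\<mu>\<^esup>\<close>.\<close>

lemma stable_translation_1:
  assumes t: "\<And>p. p \<in> K \<Longrightarrow> xpow \<mu> * p \<in> K" and \<mu>: "\<alpha> \<cdot> \<mu> = of_int m" and p: "p \<in> K"
  shows "xpow (\<mu> - of_int m *\<^sub>R coroot \<alpha>) * p \<in> K"
proof -
  have "T (xpow \<mu> * T p) \<in> K" by (intro K_T t p)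
  then have "Z (- m) * (xpow \<mu> * p) \<in> K"
    unfolding cross_1[OF \<mu>] Tinv_def[symmetric] Tinv_T .
  from K_cst[OF this] show ?thesis using single_Z[of \<mu> "-m"] by (simp add: mult.assoc)
qed

lemma stable_translation_2:
  assumes t: "\<And>p. p \<in> K \<Longrightarrow> xpow \<mu> * p \<in> K" and \<mu>: "\<alpha> \<cdot> \<mu> = of_int (2 * m)" and p: "p \<in> K"
    and t': "\<And>p. p \<in> K \<Longrightarrow> Z (- m) * (xpow \<mu> * p) \<in> K"
  shows "single (\<mu> - of_int (2 * m) *\<^sub>R coroot \<alpha>) 1 * p \<in> K"
proof -
  have "T (xpow \<mu> * T p) + cst \<kappa> * (Z (- m) * (xpow \<mu> * T p)) \<in> K"
    by (intro K_add K_cst K_T t t' p)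
  then have "Z (- (2 * m)) * (xpow \<mu> * p) \<in> K"
    unfolding cross_2[OF \<mu>] Tinv_def[symmetric] Tinv_T by simp
  from K_cst[OF this] show ?thesis using single_Z[of \<mu> "- (2 * m)"] by (simp add: mult.assoc)
qed

end

end


section \<open>Braid relations in rank two\<close>

text \<open>The alternating product \<open>f g f \<cdots>\<close> of \<open>l\<close> operators.\<close>

primrec altw :: "nat \<Rightarrow> ('a \<Rightarrow> 'a) \<Rightarrow> ('a \<Rightarrow> 'a) \<Rightarrow> 'a \<Rightarrow> 'a" where
  "altw 0 f g p = p"
| "altw (Suc l) f g p = f (altw l g f p)"

lemma altw_snoc: "altw (Suc l) f g p = altw l f g (if even l then f p else g p)"
  by (induction l arbitrary: f g) auto

lemma linop_altw: "linop f \<Longrightarrow> linop g \<Longrightarrow> linop (altw l f g)"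
  by (induction l arbitrary: f g) (auto simp: linop_def)

text \<open>The space on which a braid relation holds is stable under the two operators, as they
  satisfy quadratic relations.\<close>

lemma braid_kernel_stable:
  assumes f: "linop f" "\<And>p. f (f p) = cst a * f p + p" and g: "linop g" "\<And>p. g (g p) = cst b * g p + p"
    and ab: "odd l \<Longrightarrow> a = b" and l: "l > 0"
    and p: "altw l f g p = altw l g f p"
  shows "altw l f g (g p) = altw l g f (g p)"
proof (cases "even l")
  case True
  then obtain l' where l': "l = Suc l'" "odd l'" using l by (cases l) auto
  have "altw l f g (g p) = altw l' f g (g (g p))" using altw_snoc[of l' f g] l' by simp
  also have "\<dots> = cst b * altw l' f g (g p) + altw l' f g p"
    using linopD[OF linop_altw[OF f(1) g(1)]] by (simp add: g)
  also have "altw l' f g (g p) = altw l f g p" using altw_snoc[of l' f g] l' by simp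
  finally have 1: "altw l f g (g p) = cst b * altw l g f p + altw l' f g p" by (simp add: p)
  have "altw l g f (g p) = altw (Suc l) g f p" using altw_snoc[of l g f p] True by simp
  also have "\<dots> = g (altw l g f p)" by (simp add: p)
  also have "\<dots> = cst b * altw l g f p + altw l' f g p" by (simp add: l' g)
  finally show ?thesis using 1 by simp
next
  case False
  then obtain l' where l': "l = Suc l'" "even l'" by (cases l) auto
  have "altw l g f (g p) = altw l' g f (g (g p))" using altw_snoc[of l' g f] l' by simp
  also have "\<dots> = cst b * altw l' g f (g p) + altw l' g f p"
    using linopD[OF linop_altw[OF g(1) f(1)]] by (simp add: g)
  also have "altw l' g f (g p) = altw l g f p" using altw_snoc[of l' g f] l' by simp
  finally have 1: "altw l g f (g p) = cst b * altw l g f p + altw l' g f p" .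
  have "altw l f g (g p) = altw (Suc l) f g p" using altw_snoc[of l f g p] False by simp
  also have "\<dots> = f (altw l f g p)" by (simp add: p)
  also have "\<dots> = cst b * f (altw l' g f p) + altw l' g f p" using ab[OF False] by (simp add: l' f)
  also have "f (altw l' g f p) = altw l g f p" using p by (simp add: l')
  finally show ?thesis using 1 by simp
qed

text \<open>
  Let \<open>f\<close> commute with the multiplications by \<open>u\<close> and \<open>u'\<close>, and let \<open>Y = g f \<cdots> g\<close> carry \<open>u\<close> to
  \<open>u' Y\<^sup>-\<^sup>1\<close> up to a term that commutes with \<open>f\<close>.  If \<open>f\<close> and \<open>Y\<close> commute at
  \<open>Y\<^sup>-\<^sup>1 p\<close>, then they commute at \<open>u p\<close>.
\<close>

lemma braid_kernel_translation:
  assumes Y: "\<And>p. Y (u * p) = u' * Yi p + z * p" "\<And>p. Y (Yi p) = p" "\<And>p. Yi (Y p) = p"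
    and f: "linop f" "\<And>p. f (u * p) = u * f p" "\<And>p. f (u' * p) = u' * f p" "\<And>p. f (z * p) = z * f p"
    and p: "f (Y (Yi p)) = Y (f (Yi p))"
  shows "f (Y (u * p)) = Y (f (u * p))"
proof -
  have "Yi (f p) = f (Yi p)" using p Y by metis
  then show ?thesis by (simp add: Y f linop_add)
qed

text \<open>
  Two roots; \<open>- x\<close> and \<open>- y\<close> are the Cartan integers \<open>\<alpha>1(\<alpha>2\<^sup>\<or>)\<close> and \<open>\<alpha>2(\<alpha>1\<^sup>\<or>)\<close>, and \<open>- x'\<close> and \<open>- y'\<close> are those of
  the metaplectic roots \<open>\<alpha>1 / m1\<close> and \<open>\<alpha>2 / m2\<close>.
\<close>

locale metaplectic_pair =
  A: metaplectic_operator \<alpha>1 m1 c1 k1 F1 + B: metaplectic_operator \<alpha>2 m2 c2 k2 F2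
  for \<alpha>1 \<alpha>2 :: "'e::euclidean_space dual" and m1 m2 and c1 c2 k1 k2 :: "'f::field" and F1 F2 +
  fixes x y x' y' :: int
  assumes a12: "\<alpha>1 \<cdot> (coroot \<alpha>2) = - of_int x" and a21: "\<alpha>2 \<cdot> (coroot \<alpha>1) = - of_int y"
    and x': "x * m2 = x' * m1" and y': "y * m1 = y' * m2"
begin

text \<open>The space on which the braid relation with \<open>l\<close> letters holds.\<close>

definition K :: "nat \<Rightarrow> ('e \<Rightarrow>\<^sub>0 'f) set" where
  "K l = {p. altw l A.T B.T p = altw l B.T A.T p}"

lemma K_add: "p \<in> K l \<Longrightarrow> p' \<in> K l \<Longrightarrow> p + p' \<in> K l"
  and K_cst: "p \<in> K l \<Longrightarrow> cst d * p \<in> K l"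
  using linopD[OF linop_altw[OF A.linop_T B.linop_T]] linopD[OF linop_altw[OF B.linop_T A.linop_T]]
  by (auto simp: K_def)

lemma K_linop_all:
  assumes "\<And>w. xpow w \<in> K l" shows "altw l A.T B.T p = altw l B.T A.T p"
  by (rule linop_eqI) (use assms in \<open>auto simp: K_def linop_altw A.linop_T B.linop_T\<close>)

text \<open>Commuting operators.\<close>

lemma braid_2:
  assumes "x = 0" "y = 0" shows "altw 2 A.T B.T p = altw 2 B.T A.T p"
proof (rule K_linop_all)
  fix w
  have A: "A.T (B.tau j * p) = B.tau j * A.T p" for j p
    by (rule A.cross_ker) (use B.keys_tau a12 assms in \<open>fastforce simp: blinfun.scaleR_right\<close>)
  have B: "B.T (A.tau j * p) = A.tau j * B.T p" for j p
    by (rule B.cross_ker) (use A.keys_tau a21 assms in \<open>fastforce simp: blinfun.scaleR_right\<close>)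
  show "xpow w \<in> K 2"
    by (simp add: K_def numeral_2_eq_2 A.T_single B.T_single A B mult.left_commute)
qed

text \<open>Monomials \<open>Z\<^sub>1\<^sup>i Z\<^sub>2\<^sup>j x\<^sup>w\<close>.\<close>

context
  fixes w a b and E
  assumes a: "\<lfloor>\<alpha>1 \<cdot> w\<rfloor> = a" and b: "\<lfloor>\<alpha>2 \<cdot> w\<rfloor> = b"
  defines "E \<equiv> \<lambda>i j. A.Z i * (B.Z j * xpow w)"
begin

lemma A_T_E:
  assumes v: "v = a + 2 * i - x * j" and range: "0 \<le> v" "v \<le> m1" and i': "i' = i - v"
  shows "A.T (E i j) = cst (A.\<phi> v) * E i' j"
proof -
  have f: "\<lfloor>\<alpha>1 \<cdot> (of_int j *\<^sub>R coroot \<alpha>2 + w)\<rfloor> = a - x * j"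
  proof -
    have "\<alpha>1 \<cdot> (of_int j *\<^sub>R coroot \<alpha>2 + w) = \<alpha>1 \<cdot> w - of_int (x * j)"
      by (simp add: blinfun_right a12)
    then show ?thesis using a by linarith
  qed
  have E: "E i j = A.Z i * single (of_int j *\<^sub>R coroot \<alpha>2 + w) (c2 powi j)" for i
    by (simp add: E_def B.Z_eq_single mult_single)
  have "A.T (E i j) = A.tau v * E i j"
    using A.T_Z_single[OF f, of i] unfolding E v by (simp add: algebra_simps)
  also have "\<dots> = cst (A.\<phi> v) * (A.Z (- v) * E i j)"
    using A.tau_small[OF range] by (simp add: mult.assoc)
  also have "A.Z (- v) * E i j = E i' j"
    using A.Z_add[of "- v" i] by (simp add: E_def i' mult.assoc)
  finally show ?thesis .
qed

lemma B_T_E: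
  assumes v: "v = b + 2 * j - y * i" and range: "0 \<le> v" "v \<le> m2" and j': "j' = j - v"
  shows "B.T (E i j) = cst (B.\<phi> v) * E i j'"
proof -
  have f: "\<lfloor>\<alpha>2 \<cdot> (of_int i *\<^sub>R coroot \<alpha>1 + w)\<rfloor> = b - y * i"
  proof -
    have "\<alpha>2 \<cdot> (of_int i *\<^sub>R coroot \<alpha>1 + w) = \<alpha>2 \<cdot> w - of_int (y * i)"
      by (simp add: blinfun_right a21)
    then show ?thesis using b by linarith
  qed
  have E: "E i j = B.Z j * single (of_int i *\<^sub>R coroot \<alpha>1 + w) (c1 powi i)" for j
    by (simp add: E_def A.Z_eq_single mult_single mult.left_commute)
  have "B.T (E i j) = B.tau v * E i j"
    using B.T_Z_single[OF f, of j] unfolding E v by (simp add: algebra_simps)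
  also have "\<dots> = cst (B.\<phi> v) * (B.Z (- v) * E i j)"
    using B.tau_small[OF range] by (simp add: mult.assoc)
  also have "B.Z (- v) * E i j = E i j'"
    using B.Z_add[of "- v" j] by (simp add: E_def j' mult.left_commute mult.assoc)
  finally show ?thesis .
qed

lemma E_00: "xpow w = E 0 0"
  by (simp add: E_def)

text \<open>The braid relations on the monomials of the closed fundamental alcove.  Let \<open>w\<close> have the
  values \<open>a\<close> and \<open>b\<close>, rounded down, on the two roots.  Along the two words the values of the exponents on the
  current root are those of the positive roots, computed from \<open>a\<close> and \<open>b\<close>, in opposite orders; they all lie in the range in which the operators act by reflections.\<close>

lemma alcove_3:
  assumes "x = 1" "y = 1" "m1 = m2" "A.\<phi> = B.\<phi>" "a \<ge> 0" "b \<ge> 0" "a + b \<le> m2"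
  shows "xpow w \<in> K 3"
proof -
  have p1: "A.T (E 0 0) = cst (A.\<phi> a) * E (- a) 0"
    by (rule A_T_E) (use assms in auto)
  have p2: "B.T (E (- a) 0) = cst (B.\<phi> (a + b)) * E (- a) (- (a + b))"
    by (rule B_T_E) (use assms in auto)
  have p3: "A.T (E (- a) (- (a + b))) = cst (A.\<phi> b) * E (- (a + b)) (- (a + b))"
    by (rule A_T_E) (use assms in auto)
  have q1: "B.T (E 0 0) = cst (B.\<phi> b) * E 0 (- b)"
    by (rule B_T_E) (use assms in auto)
  have q2: "A.T (E 0 (- b)) = cst (A.\<phi> (a + b)) * E (- (a + b)) (- b)"
    by (rule A_T_E) (use assms in auto)
  have q3: "B.T (E (- (a + b)) (- b)) = cst (B.\<phi> a) * E (- (a + b)) (- (a + b))"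
    by (rule B_T_E) (use assms in auto)
  have "altw 3 A.T B.T (E 0 0) = altw 3 B.T A.T (E 0 0)"
    by (simp add: eval_nat_numeral p1 p2 p3 q1 q2 q3 A.T_cst B.T_cst mult.left_commute assms(4) del: minus_add_distrib)
  then show ?thesis by (simp add: K_def E_00)
qed

lemma alcove_4:
  assumes "(x = 1 \<and> y = 2 \<and> m1 = m2) \<or> (x = 2 \<and> y = 1 \<and> m1 = 2 * m2)" "a \<ge> 0" "b \<ge> 0" "y * a + b \<le> m2"
  shows "xpow w \<in> K 4"
proof -
  have p1: "A.T (E 0 0) = cst (A.\<phi> a) * E (- a) 0"
    by (rule A_T_E) (use assms in auto)
  have p2: "B.T (E (- a) 0) = cst (B.\<phi> (y * a + b)) * E (- a) (- (y * a + b))"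
    by (rule B_T_E) (use assms in auto)
  have p3: "A.T (E (- a) (- (y * a + b))) = cst (A.\<phi> (a + x * b)) * E (- (2 * a + x * b)) (- (y * a + b))"
    by (rule A_T_E) (use assms in auto)
  have p4: "B.T (E (- (2 * a + x * b)) (- (y * a + b))) = cst (B.\<phi> b) * E (- (2 * a + x * b)) (- (y * a + 2 * b))"
    by (rule B_T_E) (use assms in auto)
  have q1: "B.T (E 0 0) = cst (B.\<phi> b) * E 0 (- b)"
    by (rule B_T_E) (use assms in auto)
  have q2: "A.T (E 0 (- b)) = cst (A.\<phi> (a + x * b)) * E (- (a + x * b)) (- b)"
    by (rule A_T_E) (use assms in auto)
  have q3: "B.T (E (- (a + x * b)) (- b)) = cst (B.\<phi> (y * a + b)) * E (- (a + x * b)) (- (y * a + 2 * b))"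
    by (rule B_T_E) (use assms in auto)
  have q4: "A.T (E (- (a + x * b)) (- (y * a + 2 * b))) = cst (A.\<phi> a) * E (- (2 * a + x * b)) (- (y * a + 2 * b))"
    by (rule A_T_E) (use assms in auto)
  have "altw 4 A.T B.T (E 0 0) = altw 4 B.T A.T (E 0 0)"
    by (simp add: eval_nat_numeral p1 p2 p3 p4 q1 q2 q3 q4 A.T_cst B.T_cst mult.left_commute  del: minus_add_distrib)
  then show ?thesis by (simp add: K_def E_00)
qed

lemma alcove_6:
  assumes "(x = 1 \<and> y = 3 \<and> m1 = m2) \<or> (x = 3 \<and> y = 1 \<and> m1 = 3 * m2)" "a \<ge> 0" "b \<ge> 0" "y * a + 2 * b \<le> m2"
  shows "xpow w \<in> K 6"
proof -
  have p1: "A.T (E 0 0) = cst (A.\<phi> a) * E (- a) 0"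
    by (rule A_T_E) (use assms in auto)
  have p2: "B.T (E (- a) 0) = cst (B.\<phi> (y * a + b)) * E (- a) (- (y * a + b))"
    by (rule B_T_E) (use assms in auto)
  have p3: "A.T (E (- a) (- (y * a + b))) = cst (A.\<phi> (2 * a + x * b)) * E (- (3 * a + x * b)) (- (y * a + b))"
    by (rule A_T_E) (use assms in auto)
  have p4: "B.T (E (- (3 * a + x * b)) (- (y * a + b))) = cst (B.\<phi> (y * a + 2 * b)) * E (- (3 * a + x * b)) (- (2 * y * a + 3 * b))"
    by (rule B_T_E) (use assms in auto)
  have p5: "A.T (E (- (3 * a + x * b)) (- (2 * y * a + 3 * b))) = cst (A.\<phi> (a + x * b)) * E (- (4 * a + 2 * x * b)) (- (2 * y * a + 3 * b))"
    by (rule A_T_E) (use assms in auto)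
  have p6: "B.T (E (- (4 * a + 2 * x * b)) (- (2 * y * a + 3 * b))) = cst (B.\<phi> b) * E (- (4 * a + 2 * x * b)) (- (2 * y * a + 4 * b))"
    by (rule B_T_E) (use assms in auto)
  have q1: "B.T (E 0 0) = cst (B.\<phi> b) * E 0 (- b)"
    by (rule B_T_E) (use assms in auto)
  have q2: "A.T (E 0 (- b)) = cst (A.\<phi> (a + x * b)) * E (- (a + x * b)) (- b)"
    by (rule A_T_E) (use assms in auto)
  have q3: "B.T (E (- (a + x * b)) (- b)) = cst (B.\<phi> (y * a + 2 * b)) * E (- (a + x * b)) (- (y * a + 3 * b))"
    by (rule B_T_E) (use assms in auto)
  have q4: "A.T (E (- (a + x * b)) (- (y * a + 3 * b))) = cst (A.\<phi> (2 * a + x * b)) * E (- (3 * a + 2 * x * b)) (- (y * a + 3 * b))"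
    by (rule A_T_E) (use assms in auto)
  have q5: "B.T (E (- (3 * a + 2 * x * b)) (- (y * a + 3 * b))) = cst (B.\<phi> (y * a + b)) * E (- (3 * a + 2 * x * b)) (- (2 * y * a + 4 * b))"
    by (rule B_T_E) (use assms in auto)
  have q6: "A.T (E (- (3 * a + 2 * x * b)) (- (2 * y * a + 4 * b))) = cst (A.\<phi> a) * E (- (4 * a + 2 * x * b)) (- (2 * y * a + 4 * b))"
    by (rule A_T_E) (use assms in auto)
  have "altw 6 A.T B.T (E 0 0) = altw 6 B.T A.T (E 0 0)"
    by (simp add: eval_nat_numeral p1 p2 p3 p4 p5 p6 q1 q2 q3 q4 q5 q6 A.T_cst B.T_cst mult.left_commute  del: minus_add_distrib)
  then show ?thesis by (simp add: K_def E_00)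
qed

end

end


text \<open>Every point of the plane of a rank two root system can be moved to the closed fundamental
  alcove by translations in the coweight lattice and simple reflections.  Coordinates are the
  values of the two simple roots.  The reflections are only available for values in \<open>[-1, 1]\<close>,
  which the translations can always achieve.\<close>

context
  fixes P :: "real \<Rightarrow> real \<Rightarrow> bool" and y' :: int
  assumes tr: "\<And>u v i j. P u v \<Longrightarrow> P (u + of_int i) (v + of_int j)"
    and s1: "\<And>u v. P u v \<Longrightarrow> \<bar>u\<bar> \<le> 1 \<Longrightarrow> P (- u) (v + of_int y' * u)"
    and s2: "\<And>u v. P u v \<Longrightarrow> \<bar>v\<bar> \<le> 1 \<Longrightarrow> P (u + v) (- v)"
begin

lemma P_cong: "P u v \<Longrightarrow> u = u' \<Longrightarrow> v = v' \<Longrightarrow> P u' v'"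
  by simp

lemma tr': "P (u + of_int i) (v + of_int j) \<Longrightarrow> P u v"
  using tr[of "u + of_int i" "v + of_int j" "-i" "-j"] by simp

lemma s1': "P (- u) (v + of_int y' * u) \<Longrightarrow> \<bar>u\<bar> \<le> 1 \<Longrightarrow> P u v"
  using s1[of "- u" "v + of_int y' * u"] by simp

lemma s2': "P (u + v) (- v) \<Longrightarrow> \<bar>v\<bar> \<le> 1 \<Longrightarrow> P u v"
  using s2[of "u + v" "- v"] by simp

lemma unit_box: 
  assumes "\<And>u v. 0 \<le> u \<Longrightarrow> u < 1 \<Longrightarrow> 0 \<le> v \<Longrightarrow> v < 1 \<Longrightarrow> P u v"
  shows "P u v"
proof (rule tr'[of u "- \<lfloor>u\<rfloor>" v "- \<lfloor>v\<rfloor>"], rule assms)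
qed (auto, linarith+)

lemma reduce_A2:
  assumes y: "y' = 1" and alc: "\<And>u v. 0 \<le> u \<Longrightarrow> 0 \<le> v \<Longrightarrow> u + v \<le> 1 \<Longrightarrow> P u v"
  shows "P u v"
proof (rule unit_box)
  fix u v :: real assume b: "0 \<le> u" "u < 1" "0 \<le> v" "v < 1"
  show "P u v"
  proof (cases "u + v \<le> 1")
    case True then show ?thesis using b alc by simp
  next
    case False
    have "P (- u) (v + of_int y' * u)" by (rule tr'[of _ 1 _ "-1"], rule alc) (use b False y in auto)
    from s1'[OF this] b show ?thesis by simp
  qed
qed

lemma reduce_B2:
  assumes y: "y' = 2" and alc: "\<And>u v. 0 \<le> u \<Longrightarrow> 0 \<le> v \<Longrightarrow> 2 * u + v \<le> 1 \<Longrightarrow> P u v"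
  shows "P u v"
proof (rule unit_box)
  have A: "P u v" if b: "0 \<le> u" "u < 1" "0 \<le> v" "v < 1" and c: "u + v \<le> 1" for u v
  proof (cases "2 * u + v \<le> 1")
    case True then show ?thesis using b alc by simp
  next
    case False
    \<comment> \<open>reflect in the affine wall of the highest root, \<open>u \<mapsto> 1 - u - v\<close>\<close>
    have "P (1 - u - v) v" by (rule alc) (use b c False in auto)
    from tr[OF this, of "-1" 0] have "P (- u - v) v" by simp
    from P_cong[OF s1[OF this]] have "P (u + v) (- 2 * u - v)" using b c y by (simp add: algebra_simps)
    from P_cong[OF tr[OF this, of "-1" 1]] have "P (u + v - 1) (1 - 2 * u - v)" by simp
    from P_cong[OF s2[OF this]] b c False have "P (- u) (2 * u + v - 1)" by simp
    from s1[OF this] b y have "P u (v - 1)" by simp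
    from tr[OF this, of 0 1] show ?thesis by simp
  qed
  fix u v :: real assume b: "0 \<le> u" "u < 1" "0 \<le> v" "v < 1"
  show "P u v"
  proof (cases "u + v \<le> 1")
    case True then show ?thesis using b A by simp
  next
    case False
    have "P (u + v - 1) (1 - v)"
    proof (cases "v = 0")
      case True then show ?thesis using False b by simp
    next
      case F: False
      show ?thesis by (rule A) (use b False F in auto)
    qed
    from tr[OF this, of 1 "-1"] have "P (u + v) (- v)" by simp
    from s2'[OF this] b show ?thesis by simp
  qed
qed

lemma reduce_G2:
  assumes y: "y' = 3" and alc: "\<And>u v. 0 \<le> u \<Longrightarrow> 0 \<le> v \<Longrightarrow> 3 * u + 2 * v \<le> 1 \<Longrightarrow> P u v"
  shows "P u v"
proof -
  have s1'': "P u v" if "P (- u) (v + 3 * u)" for u v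
  proof (rule tr'[of u "- \<lfloor>u\<rfloor>" v 0])
    have "P (- (u + of_int (- \<lfloor>u\<rfloor>))) (v + of_int 0 + of_int y' * (u + of_int (- \<lfloor>u\<rfloor>)))"
      using tr[OF that, of "\<lfloor>u\<rfloor>" "- 3 * \<lfloor>u\<rfloor>"] y by (simp add: algebra_simps)
    then show "P (u + of_int (- \<lfloor>u\<rfloor>)) (v + of_int 0)" by (rule s1') (simp, linarith)
  qed
  have s2'': "P u v" if "P (u + v) (- v)" for u v
  proof (rule tr'[of u 0 v "- \<lfloor>v\<rfloor>"])
    have "P (u + of_int 0 + (v + of_int (- \<lfloor>v\<rfloor>))) (- (v + of_int (- \<lfloor>v\<rfloor>)))"
      using tr[OF that, of "- \<lfloor>v\<rfloor>" "\<lfloor>v\<rfloor>"] by (simp add: algebra_simps)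
    then show "P (u + of_int 0) (v + of_int (- \<lfloor>v\<rfloor>))" by (rule s2') (simp, linarith)
  qed
  \<comment> \<open>the reflection in the highest root, composed with a translation\<close>
  have R: "P u v" if "P u (of_int i - 3 * u - v)" for u v i
  proof -
    have "of_int i - 3 * u - v + of_int (- i) = - 3 * u - v" by simp
    then have "P u (- 3 * u - v)" using tr[OF that, of 0 "- i"] by simp
    then show ?thesis
      by - (rule s2'', rule s1'', rule s2'', rule s1'', rule s2'', erule P_cong, simp_all add: algebra_simps)
  qed
  have s1t: "P u v" if "P (of_int i - u) (of_int j + v + 3 * u)" for u v i j
    by (rule s1'', rule tr'[of _ i _ j]) (use that in \<open>simp add: algebra_simps\<close>)
  have s2t: "P u v" if "P (of_int i + u + v) (of_int j - v)" for u v i j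
    by (rule s2'', rule tr'[of _ i _ j]) (use that in \<open>simp add: algebra_simps\<close>)
  \<comment> \<open>The alcove lies in the strip \<open>0 \<le> u \<le> 1/3\<close>.  In this strip and in \<open>1/3 \<le> u \<le> 1/2\<close>, the symmetry \<open>R\<close>
    moves \<open>v\<close> to a range where the second reflection leads to a point that is closer to the alcove.\<close>
  have low: "P u v" if b: "0 \<le> u" "3 * u \<le> 1" "0 \<le> v" "v \<le> 1" for u v
  proof -
    have half: "P u v" if c: "2 - 3 * u \<le> 2 * v" "v \<le> 1" for v
    proof (cases "1 \<le> u + v")
      case True
      show ?thesis by (rule s2t[of "-1" _ _ 1], rule alc) (use b c True in auto)
    next
      case False
      have "P (u + v - 1) (1 - v)"
        by (rule s1t[of 0 _ 0], rule alc) (use b c False in auto)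
      from P_cong[OF this] show ?thesis by (intro s2t[of "-1" u v 1]) simp
    qed
    consider "3 * u + 2 * v \<le> 1" | "3 * u + 2 * v \<ge> 1" "3 * u + v \<le> 1" | "3 * u + v \<ge> 1" "2 - 3 * u \<le> 2 * v"
      | "3 * u + v \<ge> 1" "2 * v \<le> 2 - 3 * u" by linarith
    then show ?thesis
    proof cases
      case 1 then show ?thesis using b alc by simp
    next
      case 2 show ?thesis by (rule R[of _ 1], rule alc) (use b 2 in auto)
    next
      case 3 then show ?thesis using half b by simp
    next
      case 4 show ?thesis by (rule R[of _ 2], rule half) (use b 4 in auto)
    qed
  qed
  have mid: "P u v" if b: "1 \<le> 3 * u" "2 * u \<le> 1" "0 \<le> v" "v \<le> 1" for u v
  proof -
    have neg: "P u v" if c: "- 1 \<le> 3 * u" "u \<le> 0" "0 \<le> v" "v \<le> 1" for u v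
    proof -
      let ?w = "v + 3 * u"
      show ?thesis
      proof (rule s1t[of 0 _ "- \<lfloor>?w\<rfloor>"], rule low)
        show "0 \<le> of_int 0 - u" "3 * (of_int 0 - u) \<le> 1" using c by auto
        show "0 \<le> of_int (- \<lfloor>?w\<rfloor>) + v + 3 * u" "of_int (- \<lfloor>?w\<rfloor>) + v + 3 * u \<le> 1" by (simp_all, linarith+)
      qed
    qed
    have both: "P u v" if "- 1 \<le> 3 * u" "3 * u \<le> 1" "0 \<le> v" "v \<le> 1" for u v
      using neg[of u v] low[of u v] that by (cases "u \<le> 0") auto
    have hi: "P u v" if c: "2 - 3 * u \<le> v" "2 * v \<le> 3 - 3 * u" "v \<le> 1" for v
      by (rule s2t[of "-1" _ _ 1], rule both) (use b c in auto)
    have lo: "P u v" if c: "v \<le> 2 - 3 * u" "2 - 3 * u \<le> 2 * v" for v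
      by (rule s2t[of "-1" _ _ 1], rule both) (use b c in auto)
    consider "2 - 3 * u \<le> v" "2 * v \<le> 3 - 3 * u" | "2 - 3 * u \<le> v" "3 - 3 * u \<le> 2 * v"
      | "v \<le> 2 - 3 * u" "2 - 3 * u \<le> 2 * v" | "v \<le> 2 - 3 * u" "2 * v \<le> 2 - 3 * u" by linarith
    then show ?thesis
    proof cases
      case 1 then show ?thesis using b by (intro hi) auto
    next
      case 2 show ?thesis by (rule R[of _ 3], rule hi) (use b 2 in auto)
    next
      case 3 then show ?thesis by (rule lo)
    next
      case 4 show ?thesis by (rule R[of _ 2], rule lo) (use b 4 in auto)
    qed
  qed
  have half: "P u v" if "0 \<le> u" "2 * u \<le> 1" "0 \<le> v" "v \<le> 1" for u v
    using low[of u v] mid[of u v] that by (cases "3 * u \<le> 1") auto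
  show ?thesis
  proof (rule unit_box)
    fix u v :: real assume b: "0 \<le> u" "u < 1" "0 \<le> v" "v < 1"
    show "P u v"
    proof (cases "2 * u \<le> 1")
      case True then show ?thesis using b half by simp
    next
      case False
      let ?w = "v + 3 * u"
      show ?thesis
      proof (rule s1t[of 1 _ "- \<lfloor>?w\<rfloor>"], rule half)
        show "0 \<le> of_int 1 - u" "2 * (of_int 1 - u) \<le> 1" using b False by auto
        show "0 \<le> of_int (- \<lfloor>?w\<rfloor>) + v + 3 * u" "of_int (- \<lfloor>?w\<rfloor>) + v + 3 * u \<le> 1" by (simp_all, linarith+)
      qed
    qed
  qed
qed

end


context metaplectic_pair
begin

text \<open>The number \<open>l\<close> of letters; for odd \<open>l\<close> the two operators have the same parameter.\<close>

context
  fixes l :: nat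
  assumes l_pos: "l > 0" and l_odd: "odd l \<longrightarrow> A.\<kappa> = B.\<kappa>"
begin

lemma K_A: "p \<in> K l \<Longrightarrow> A.T p \<in> K l"
  using braid_kernel_stable[OF B.linop_T B.quadratic A.linop_T A.quadratic _ l_pos, of p] l_odd by (auto simp: K_def)

lemma K_B: "p \<in> K l \<Longrightarrow> B.T p \<in> K l"
  using braid_kernel_stable[OF A.linop_T A.quadratic B.linop_T B.quadratic _ l_pos, of p] l_odd by (auto simp: K_def)

text \<open>The monomials whose exponents have the values \<open>m\<^sub>1 u\<close> and \<open>m\<^sub>2 v\<close>, rounded down, on the two roots
  satisfy the braid relation.\<close>

definition P :: "real \<Rightarrow> real \<Rightarrow> bool" where
  "P u v \<longleftrightarrow> (\<forall>w. of_int \<lfloor>\<alpha>1 \<cdot> w\<rfloor> = of_int m1 * u \<and> of_int \<lfloor>\<alpha>2 \<cdot> w\<rfloor> = of_int m2 * v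
     \<longrightarrow> xpow w \<in> K l)"

lemma P_s1:
  assumes "P u v" "\<bar>u\<bar> \<le> 1" shows "P (- u) (v + of_int y' * u)"
  unfolding P_def
proof (intro allI impI, elim conjE)
  fix w assume 1: "of_int \<lfloor>\<alpha>1 \<cdot> w\<rfloor> = of_int m1 * - u" and 2: "of_int \<lfloor>\<alpha>2 \<cdot> w\<rfloor> = of_int m2 * (v + of_int y' * u)"
  define a where "a = \<lfloor>\<alpha>1 \<cdot> w\<rfloor>"
  let ?w = "w - of_int a *\<^sub>R coroot \<alpha>1"
  have "\<alpha>1 \<cdot> ?w = \<alpha>1 \<cdot> w - of_int (2 * a)"
    by (simp add: blinfun_right A.alpha_coroot)
  then have a': "\<lfloor>\<alpha>1 \<cdot> ?w\<rfloor> = - a" unfolding a_def by linarith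
  have "\<alpha>2 \<cdot> ?w = \<alpha>2 \<cdot> w + of_int (y * a)"
    by (simp add: blinfun_right a21)
  then have b': "\<lfloor>\<alpha>2 \<cdot> ?w\<rfloor> = \<lfloor>\<alpha>2 \<cdot> w\<rfloor> + y * a" by linarith
  have ua: "of_int a = - (of_int m1 * u)" using 1 by (simp add: a_def)
  have "of_int (y * a) = - (of_int (y * m1) * u)" using ua by simp
  also have "\<dots> = - (of_int m2 * (of_int y' * u))" unfolding y' by simp
  finally have "of_int (\<lfloor>\<alpha>2 \<cdot> w\<rfloor> + y * a) = of_int m2 * v" using 2 by (simp add: distrib_left)
  then have "single ?w 1 \<in> K l"
    using \<open>P u v\<close> a' b' ua unfolding P_def by (metis minus_minus of_int_minus)
  moreover have "- m1 \<le> - a" "- a \<le> m1"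
  proof -
    have "\<bar>of_int a\<bar> \<le> (of_int m1 :: real)" using ua assms(2) A.m_pos mult_left_mono[of "\<bar>u\<bar>" 1 "of_int m1"] by (simp add: abs_mult)
    then show "- m1 \<le> - a" "- a \<le> m1" by linarith+
  qed
  ultimately have "single (?w - of_int (- a) *\<^sub>R coroot \<alpha>1) 1 \<in> K l"
    by (intro A.stable_reflection[OF K_add K_cst K_A _ a'])
  then show "xpow w \<in> K l" by simp
qed

lemma P_s2:
  assumes "P u v" "\<bar>v\<bar> \<le> 1" shows "P (u + of_int x' * v) (- v)"
proof -
  interpret S: metaplectic_pair \<alpha>2 \<alpha>1 m2 m1 c2 c1 k2 k1 F2 F1 y x y' x'
    by unfold_locales (fact a21 a12 y' x')+
  have l: "odd l \<longrightarrow> B.\<kappa> = A.\<kappa>" using l_odd by simp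
  have K: "S.K l = K l" by (auto simp: K_def S.K_def)
  have "S.P l v u" using assms(1) unfolding P_def S.P_def[OF l_pos l] K by blast
  from S.P_s1[OF l_pos l this assms(2)] show ?thesis unfolding P_def S.P_def[OF l_pos l] K by blast
qed

text \<open>The exponent \<open>\<mu>\<close> has the values \<open>m\<^sub>1 i\<close> and \<open>m\<^sub>2 j\<close> on the two roots, and its monomial
  multiplies \<open>K l\<close> into itself.\<close>

definition translates :: "'e \<Rightarrow> int \<Rightarrow> int \<Rightarrow> bool" where
  "translates \<mu> i j \<longleftrightarrow> \<alpha>1 \<cdot> \<mu> = of_int (m1 * i) \<and> \<alpha>2 \<cdot> \<mu> = of_int (m2 * j)
     \<and> (\<forall>p\<in>K l. xpow \<mu> * p \<in> K l)"

lemma P_translate: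
  assumes "translates \<mu> i j" "P u v" shows "P (u + of_int i) (v + of_int j)"
  unfolding P_def
proof (intro allI impI, elim conjE)
  fix w assume 1: "of_int \<lfloor>\<alpha>1 \<cdot> w\<rfloor> = of_int m1 * (u + of_int i)" and 2: "of_int \<lfloor>\<alpha>2 \<cdot> w\<rfloor> = of_int m2 * (v + of_int j)"
  have "\<lfloor>\<alpha>1 \<cdot> (w - \<mu>)\<rfloor> = \<lfloor>\<alpha>1 \<cdot> w\<rfloor> - m1 * i"
    "\<lfloor>\<alpha>2 \<cdot> (w - \<mu>)\<rfloor> = \<lfloor>\<alpha>2 \<cdot> w\<rfloor> - m2 * j"
    using assms(1) unfolding translates_def blinfun.diff_right by linarith+
  then have "xpow (w - \<mu>) \<in> K l"
    using assms(2) 1 2 unfolding P_def by (simp add: distrib_left)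
  then have "xpow \<mu> * xpow (w - \<mu>) \<in> K l"
    using assms(1) unfolding translates_def by blast
  then show "xpow w \<in> K l" by (simp add: mult_single)
qed

lemma translates_s1: "translates \<mu> 1 j \<Longrightarrow> translates (\<mu> - of_int m1 *\<^sub>R coroot \<alpha>1) (- 1) (j + y')"
  using A.stable_translation_1[OF K_add K_cst K_A, of \<mu>] y'
  unfolding translates_def
  by (auto simp: blinfun_right A.alpha_coroot a21 algebra_simps simp flip: of_int_mult)

lemma translates_s2: "translates \<mu> i 1 \<Longrightarrow> translates (\<mu> - of_int m2 *\<^sub>R coroot \<alpha>2) (i + x') (- 1)"
  using B.stable_translation_1[OF K_add K_cst K_B, of \<mu>] x'
  unfolding translates_def
  by (auto simp: blinfun_right B.alpha_coroot a12 algebra_simps simp flip: of_int_mult)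

lemma K_cross_0:
  assumes "\<alpha>1 \<cdot> \<mu> = 0" "\<alpha>2 \<cdot> \<mu> = 0" "p \<in> K l"
  shows "single \<mu> d * p \<in> K l"
proof -
  have "altw n A.T B.T (single \<mu> d * p) = single \<mu> d * altw n A.T B.T p
    \<and> altw n B.T A.T (single \<mu> d * p) = single \<mu> d * altw n B.T A.T p" for n
    by (induction n) (auto simp: A.cross_0[OF assms(1)] B.cross_0[OF assms(2)])
  then show ?thesis using assms(3) by (simp add: K_def)
qed

lemma translates_s2_double:
  assumes t: "translates \<mu> i 2" and i: "i = - x'"
  shows "translates (\<mu> - of_int (2 * m2) *\<^sub>R coroot \<alpha>2) (i + 2 * x') (- 2)"
proof -
  have \<mu>: "\<alpha>2 \<cdot> \<mu> = of_int (2 * m2)" "\<alpha>1 \<cdot> \<mu> = of_int (m1 * i)" using t by (auto simp: translates_def)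
  have z: "B.Z (- m2) * (xpow \<mu> * p) \<in> K l" if "p \<in> K l" for p
  proof -
    let ?z = "of_int (- m2) *\<^sub>R coroot \<alpha>2 + \<mu>"
    have "\<alpha>1 \<cdot> ?z = of_int (x * m2) + of_int (m1 * i)"
      by (simp add: blinfun_right a12 \<mu>(2))
    then have "\<alpha>1 \<cdot> ?z = 0" unfolding x' i by simp
    moreover have "\<alpha>2 \<cdot> ?z = 0"
      by (simp add: blinfun_right B.alpha_coroot \<mu>(1))
    ultimately show ?thesis
      using K_cross_0[OF _ _ that, of ?z] by (simp add: B.Z_eq_single mult_single mult.assoc[symmetric])
  qed
  have "\<forall>p\<in>K l. single (\<mu> - of_int (2 * m2) *\<^sub>R coroot \<alpha>2) 1 * p \<in> K l"
    using B.stable_translation_2[OF K_add K_cst K_B _ \<mu>(1) _ z] t unfolding translates_def by blast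
  moreover have "\<alpha>1 \<cdot> (\<mu> - of_int (2 * m2) *\<^sub>R coroot \<alpha>2) = of_int (m1 * i + 2 * (x * m2))"
    by (simp add: blinfun_right a12 \<mu>(2))
  ultimately show ?thesis unfolding translates_def x'
    by (simp add: blinfun_right B.alpha_coroot \<mu> algebra_simps)
qed

text \<open>The four translations by \<open>(0, \<plusminus>1)\<close> and \<open>\<plusminus>(1, -1)\<close> generate all integral ones.\<close>

lemma P_lattice:
  assumes t: "\<And>u v. P u v \<Longrightarrow> P u (v + 1)" "\<And>u v. P u v \<Longrightarrow> P u (v - 1)"
      "\<And>u v. P u v \<Longrightarrow> P (u + 1) (v - 1)" "\<And>u v. P u v \<Longrightarrow> P (u - 1) (v + 1)"
    and "P u v"
  shows "P (u + of_int i) (v + of_int j)"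
proof -
  have up: "P u (v + of_int n)" "P u (v - of_int n)" if "P u v" for u v and n :: nat
    using that t(1,2) by (induction n) (force simp: algebra_simps)+
  have V: "P u (v + of_int j)" if "P u v" for u v j
    using up[OF that, of "nat j"] up[OF that, of "nat (- j)"] by (cases "j \<ge> 0") auto
  have D: "P (u + of_int n) (v - of_int n)" "P (u - of_int n) (v + of_int n)" if "P u v" for u v and n :: nat
    using that t(3,4) by (induction n) (force simp: algebra_simps)+
  have D': "P (u + of_int i) (v - of_int i)" if "P u v" for u v i
    using D[OF that, of "nat i"] D[OF that, of "nat (- i)"] by (cases "i \<ge> 0") auto
  from V[OF D'[OF \<open>P u v\<close>, of i], of "i + j"] show ?thesis by simp
qed

text \<open>The inequality defining the alcove, in the coordinates of \<open>P\<close>: the highest metaplectic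
  root is \<open>y'\<close> times the first one plus \<open>t\<close> times the second one.\<close>

lemma P_alcove:
  assumes alcove: "\<And>w. 0 \<le> \<lfloor>\<alpha>1 \<cdot> w\<rfloor> \<Longrightarrow> 0 \<le> \<lfloor>\<alpha>2 \<cdot> w\<rfloor> \<Longrightarrow>
      y * \<lfloor>\<alpha>1 \<cdot> w\<rfloor> + t * \<lfloor>\<alpha>2 \<cdot> w\<rfloor> \<le> m2 \<Longrightarrow> xpow w \<in> K l"
    and uv: "0 \<le> u" "0 \<le> v" "of_int y' * u + of_int t * v \<le> 1"
  shows "P u v"
  unfolding P_def
proof (intro allI impI, elim conjE)
  fix w assume w: "of_int \<lfloor>\<alpha>1 \<cdot> w\<rfloor> = of_int m1 * u" "of_int \<lfloor>\<alpha>2 \<cdot> w\<rfloor> = of_int m2 * v"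
  have "of_int y * (of_int m1 * u) = of_int (y * m1) * u" by simp
  also have "\<dots> = of_int m2 * (of_int y' * u)" unfolding y' by simp
  finally have e: "of_int y * (of_int m1 * u) = of_int m2 * (of_int y' * u)" .
  have "of_int m2 * (of_int y' * u + of_int t * v) \<le> of_int m2 * 1"
    using uv B.m_pos by (intro mult_left_mono) auto
  moreover have "real_of_int (y * \<lfloor>\<alpha>1 \<cdot> w\<rfloor> + t * \<lfloor>\<alpha>2 \<cdot> w\<rfloor>)
      = of_int m2 * (of_int y' * u + of_int t * v)"
    unfolding of_int_add of_int_mult w e by (simp add: distrib_left)
  ultimately have "real_of_int (y * \<lfloor>\<alpha>1 \<cdot> w\<rfloor> + t * \<lfloor>\<alpha>2 \<cdot> w\<rfloor>) \<le> of_int m2"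
    by simp
  moreover have "0 \<le> real_of_int \<lfloor>\<alpha>1 \<cdot> w\<rfloor>" "0 \<le> real_of_int \<lfloor>\<alpha>2 \<cdot> w\<rfloor>"
    unfolding w using uv A.m_pos B.m_pos by auto
  ultimately show "xpow w \<in> K l" by (intro alcove) linarith+
qed

text \<open>Every monomial has some coordinates.\<close>

lemma P_D:
  assumes "\<And>u v. P u v" shows "xpow w \<in> K l"
  using assms[of "of_int \<lfloor>\<alpha>1 \<cdot> w\<rfloor> / of_int m1" "of_int \<lfloor>\<alpha>2 \<cdot> w\<rfloor> / of_int m2"] A.m_pos B.m_pos
  unfolding P_def by simp

end

text \<open>The fundamental coweight of the second metaplectic root; it need not lie in any given lattice.\<close>

lemma ex_coweight:
  assumes "x * y \<noteq> 4"
  obtains \<omega> where "\<alpha>1 \<cdot> \<omega> = 0" "\<alpha>2 \<cdot> \<omega> = of_int m2"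
proof
  let ?d = "4 - of_int (x * y) :: real"
  have d: "?d \<noteq> 0" using assms by (metis eq_iff_diff_eq_0 of_int_eq_iff of_int_numeral)
  let ?w = "(of_int m2 / ?d) *\<^sub>R (of_int x *\<^sub>R coroot \<alpha>1 + 2 *\<^sub>R coroot \<alpha>2)"
  show "\<alpha>1 \<cdot> ?w = 0"
    by (simp add: blinfun_right A.alpha_coroot a12)
  have "\<alpha>2 \<cdot> ?w = of_int m2 / ?d * ?d"
    by (simp add: blinfun_right B.alpha_coroot a21)
  then show "\<alpha>2 \<cdot> ?w = of_int m2" using d by simp
qed

text \<open>
  Multiplication by the monomial of this coweight \<open>\<omega>\<close> preserves the braid relation.  In the proofs
  \<open>\<omega>1, \<omega>2, \<dots>\<close> are the successive reflections of \<open>\<omega>\<close>, starting with the second root.  Each takes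
  the value \<open>m1\<close> or \<open>m2\<close> on the next root, except that the last one vanishes there and that in type
  \<open>G\<^sub>2\<close> one value is \<open>2 m2\<close>; the extra term is then a multiple of the monomial of \<open>\<zeta>\<close>, on which both
  roots vanish.
\<close>

lemma translation_3:
  assumes xy: "x' = 1" "y' = 1" and kap: "A.\<kappa> = B.\<kappa>"
    and \<omega>: "\<alpha>1 \<cdot> \<omega> = 0" "\<alpha>2 \<cdot> \<omega> = of_int m2" and p: "p \<in> K 3"
  shows "xpow \<omega> * p \<in> K 3"
proof -
  define \<omega>1 where "\<omega>1 = \<omega> - of_int m2 *\<^sub>R coroot \<alpha>2"
  define \<omega>2 where "\<omega>2 = \<omega>1 - of_int m1 *\<^sub>R coroot \<alpha>1"
  have xm: "of_int x * of_int m2 = (of_int m1 :: real)" "of_int y * of_int m1 = (of_int m2 :: real)"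
    using x' y' xy by (metis mult_1 of_int_mult)+
  have 1: "\<alpha>1 \<cdot> \<omega>1 = of_int m1" "\<alpha>2 \<cdot> \<omega>1 = - of_int m2"
    using xm by (simp_all add: \<omega>1_def blinfun_right \<omega> a12 B.alpha_coroot mult.commute)
  have 2: "\<alpha>2 \<cdot> \<omega>2 = 0"
    using xm by (simp add: \<omega>2_def blinfun_right 1 a21 mult.commute)
  have A: "A.T (single \<omega> u * p) = single \<omega> u * A.T p" for u p
    by (rule A.cross_0[OF \<omega>(1)])
  have B: "B.T (single \<omega> u * p) = single \<omega>1 (c2 powi (- m2) * u) * B.Tinv p" for u p
    unfolding \<omega>1_def by (rule B.cross_1'[OF \<omega>(2)])
  have A1: "A.T (single \<omega>1 u * p) = single \<omega>2 (c1 powi (- m1) * u) * A.Tinv p" for u p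
    unfolding \<omega>2_def by (rule A.cross_1'[OF 1(1)])
  have B2: "B.T (single \<omega>2 u * p) = single \<omega>2 u * B.T p" for u p
    by (rule B.cross_0[OF 2])
  define q where "q = A.Tinv (B.Tinv p)"
  have "q \<in> K 3" unfolding q_def using kap
    by (intro A.K_Tinv[OF K_add K_cst K_A] B.K_Tinv[OF K_add K_cst K_B] p) auto
  then have "B.T (A.T (B.T q)) = A.T (B.T (A.T q))" by (simp add: K_def numeral_3_eq_3)
  also have "\<dots> = A.T p" by (simp add: q_def A.T_Tinv B.T_Tinv)
  finally have "A.Tinv (B.Tinv (A.T p)) = B.T q" by (metis A.Tinv_T B.Tinv_T)
  then show ?thesis by (simp add: K_def numeral_3_eq_3 A B A1 B2 q_def)
qed

lemma translation_4:
  assumes xy: "x' = 1" "y' = 2"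
    and \<omega>: "\<alpha>1 \<cdot> \<omega> = 0" "\<alpha>2 \<cdot> \<omega> = of_int m2" and p: "p \<in> K 4"
  shows "xpow \<omega> * p \<in> K 4"
proof -
  define \<omega>1 where "\<omega>1 = \<omega> - of_int m2 *\<^sub>R coroot \<alpha>2"
  define \<omega>2 where "\<omega>2 = \<omega>1 - of_int m1 *\<^sub>R coroot \<alpha>1"
  define \<omega>3 where "\<omega>3 = \<omega>2 - of_int m2 *\<^sub>R coroot \<alpha>2"
  have xm: "of_int x * of_int m2 = (of_int m1 :: real)" "of_int y * of_int m1 = (2 * of_int m2 :: real)"
    using x' y' xy by (metis mult_1 of_int_mult of_int_numeral)+
  have 1: "\<alpha>1 \<cdot> \<omega>1 = of_int m1" "\<alpha>2 \<cdot> \<omega>1 = - of_int m2"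
    using xm by (simp_all add: \<omega>1_def blinfun_right \<omega> a12 B.alpha_coroot mult.commute)
  have 2: "\<alpha>2 \<cdot> \<omega>2 = of_int m2" "\<alpha>1 \<cdot> \<omega>2 = - of_int m1"
    using xm by (simp_all add: \<omega>2_def blinfun_right 1 a21 A.alpha_coroot mult.commute)
  have 3: "\<alpha>1 \<cdot> \<omega>3 = 0"
    using xm by (simp add: \<omega>3_def blinfun_right 2 a12 mult.commute)
  have B: "B.T (single \<omega> u * p) = single \<omega>1 (c2 powi (- m2) * u) * B.Tinv p" for u p
    unfolding \<omega>1_def by (rule B.cross_1'[OF \<omega>(2)])
  have A1: "A.T (single \<omega>1 u * p) = single \<omega>2 (c1 powi (- m1) * u) * A.Tinv p" for u p
    unfolding \<omega>2_def by (rule A.cross_1'[OF 1(1)])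
  have B2: "B.T (single \<omega>2 u * p) = single \<omega>3 (c2 powi (- m2) * u) * B.Tinv p" for u p
    unfolding \<omega>3_def by (rule B.cross_1'[OF 2(1)])
  define Yi where "Yi p = B.Tinv (A.Tinv (B.Tinv p))" for p
  have Yi: "Yi p \<in> K 4" unfolding Yi_def
    by (intro A.K_Tinv[OF K_add K_cst K_A] B.K_Tinv[OF K_add K_cst K_B] p) auto
  let ?Y = "\<lambda>p. B.T (A.T (B.T p))"
  have "A.T (?Y (xpow \<omega> * p)) = ?Y (A.T (xpow \<omega> * p))"
  proof (rule braid_kernel_translation[where Yi = Yi and z = 0, OF _ _ _ A.linop_T A.cross_0[OF \<omega>(1)] A.cross_0[OF 3]])
    show "?Y (xpow \<omega> * p) = single \<omega>3 (c2 powi (- m2) * (c1 powi (- m1) * (c2 powi (- m2) * 1))) * Yi p + 0 * p" for p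
      by (simp add: Yi_def B A1 B2)
    show "?Y (Yi p) = p" "Yi (?Y p) = p" for p by (simp_all add: Yi_def A.T_Tinv B.T_Tinv A.Tinv_T B.Tinv_T)
    show "A.T (?Y (Yi p)) = ?Y (A.T (Yi p))" using Yi by (simp add: K_def eval_nat_numeral)
  qed (simp add: A.T_0)
  then show ?thesis by (simp add: K_def eval_nat_numeral)
qed

lemma translation_6:
  assumes xy: "x' = 1" "y' = 3"
    and \<omega>: "\<alpha>1 \<cdot> \<omega> = 0" "\<alpha>2 \<cdot> \<omega> = of_int m2" and p: "p \<in> K 6"
  shows "xpow \<omega> * p \<in> K 6"
proof -
  define \<omega>1 where "\<omega>1 = \<omega> - of_int m2 *\<^sub>R coroot \<alpha>2"
  define \<omega>2 where "\<omega>2 = \<omega>1 - of_int m1 *\<^sub>R coroot \<alpha>1"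
  define \<zeta> where "\<zeta> = \<omega>2 - of_int m2 *\<^sub>R coroot \<alpha>2"
  define \<omega>3 where "\<omega>3 = \<omega>2 - of_int (2 * m2) *\<^sub>R coroot \<alpha>2"
  define \<omega>4 where "\<omega>4 = \<omega>3 - of_int m1 *\<^sub>R coroot \<alpha>1"
  define \<omega>5 where "\<omega>5 = \<omega>4 - of_int m2 *\<^sub>R coroot \<alpha>2"
  have xm: "of_int x * of_int m2 = (of_int m1 :: real)" "of_int y * of_int m1 = (3 * of_int m2 :: real)"
    using x' y' xy by (metis mult_1 of_int_mult of_int_numeral)+
  have 1: "\<alpha>1 \<cdot> \<omega>1 = of_int m1" "\<alpha>2 \<cdot> \<omega>1 = - of_int m2"
    using xm by (simp_all add: \<omega>1_def blinfun_right \<omega> a12 B.alpha_coroot mult.commute)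
  have 2: "\<alpha>2 \<cdot> \<omega>2 = of_int (2 * m2)" "\<alpha>1 \<cdot> \<omega>2 = - of_int m1"
    using xm by (simp_all add: \<omega>2_def blinfun_right 1 a21 A.alpha_coroot mult.commute)
  have \<zeta>: "\<alpha>1 \<cdot> \<zeta> = 0" "\<alpha>2 \<cdot> \<zeta> = 0"
    using xm by (simp_all add: \<zeta>_def blinfun_right 2 a12 B.alpha_coroot mult.commute)
  have 3: "\<alpha>1 \<cdot> \<omega>3 = of_int m1" "\<alpha>2 \<cdot> \<omega>3 = - of_int (2 * m2)"
    using xm by (simp_all add: \<omega>3_def blinfun_right 2 a12 B.alpha_coroot mult.commute)
  have 4: "\<alpha>1 \<cdot> \<omega>4 = - of_int m1" "\<alpha>2 \<cdot> \<omega>4 = of_int m2"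
    using xm by (simp_all add: \<omega>4_def blinfun_right 3 a21 A.alpha_coroot mult.commute)
  have 5: "\<alpha>1 \<cdot> \<omega>5 = 0"
    using xm by (simp add: \<omega>5_def blinfun_right 4 a12 mult.commute)
  have B: "B.T (single \<omega> u * p) = single \<omega>1 (c2 powi (- m2) * u) * B.Tinv p" for u p
    unfolding \<omega>1_def by (rule B.cross_1'[OF \<omega>(2)])
  have A1: "A.T (single \<omega>1 u * p) = single \<omega>2 (c1 powi (- m1) * u) * A.Tinv p" for u p
    unfolding \<omega>2_def by (rule A.cross_1'[OF 1(1)])
  have B2: "B.T (single \<omega>2 u * p) = single \<omega>3 (c2 powi (- (2 * m2)) * u) * B.Tinv p
      - cst B.\<kappa> * (single \<zeta> (c2 powi (- m2) * u) * p)" for u p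
    unfolding \<omega>3_def \<zeta>_def by (rule B.cross_2'[OF 2(1)])
  have A3: "A.T (single \<omega>3 u * p) = single \<omega>4 (c1 powi (- m1) * u) * A.Tinv p" for u p
    unfolding \<omega>4_def by (rule A.cross_1'[OF 3(1)])
  have B4: "B.T (single \<omega>4 u * p) = single \<omega>5 (c2 powi (- m2) * u) * B.Tinv p" for u p
    unfolding \<omega>5_def by (rule B.cross_1'[OF 4(2)])
  define Yi where "Yi p = B.Tinv (A.Tinv (B.Tinv (A.Tinv (B.Tinv p))))" for p
  have Yi: "Yi p \<in> K 6" unfolding Yi_def
    by (intro A.K_Tinv[OF K_add K_cst K_A] B.K_Tinv[OF K_add K_cst K_B] p) auto
  let ?Y = "\<lambda>p. B.T (A.T (B.T (A.T (B.T p))))"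
  let ?u2 = "c1 powi (- m1) * (c2 powi (- m2) * 1)"
  let ?z = "single \<zeta> (- B.\<kappa> * (c2 powi (- m2) * ?u2))"
  have z: "?z * p = - (cst B.\<kappa> * (single \<zeta> (c2 powi (- m2) * ?u2) * p))" for p
    by (simp add: mult.assoc[symmetric] mult_single single_uminus)
  have "A.T (?Y (xpow \<omega> * p)) = ?Y (A.T (xpow \<omega> * p))"
  proof (rule braid_kernel_translation[where Yi = Yi and z = ?z, OF _ _ _ A.linop_T A.cross_0[OF \<omega>(1)] A.cross_0[OF 5] A.cross_0[OF \<zeta>(1)]])
    show "?Y (xpow \<omega> * p) = single \<omega>5 (c2 powi (- m2) * (c1 powi (- m1) * (c2 powi (- (2 * m2)) * ?u2))) * Yi p + ?z * p" for p
      unfolding z B A1 B2 A.T_diff B.T_diff A.T_cst B.T_cst A3 B4 A.cross_0[OF \<zeta>(1)] B.cross_0[OF \<zeta>(2)]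
      by (simp only: Yi_def A.T_Tinv B.T_Tinv diff_conv_add_uminus)
    show "?Y (Yi p) = p" "Yi (?Y p) = p" for p by (simp_all add: Yi_def A.T_Tinv B.T_Tinv A.Tinv_T B.Tinv_T)
    show "A.T (?Y (Yi p)) = ?Y (A.T (Yi p))" using Yi by (simp add: K_def eval_nat_numeral)
  qed
  then show ?thesis by (simp add: K_def eval_nat_numeral)
qed

lemma braid_3:
  assumes xy: "x = 1" "y = 1" and xy': "x' = 1" "y' = 1" and kap: "A.\<kappa> = B.\<kappa>" and phi: "A.\<phi> = B.\<phi>"
  shows "altw 3 A.T B.T p = altw 3 B.T A.T p"
proof (rule K_linop_all)
  fix w
  have l: "(3::nat) > 0" "odd (3::nat) \<longrightarrow> A.\<kappa> = B.\<kappa>" using kap by auto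
  have "x * y \<noteq> 4" using xy by auto
  then obtain \<omega> where \<omega>: "\<alpha>1 \<cdot> \<omega> = 0" "\<alpha>2 \<cdot> \<omega> = of_int m2"
    by (rule ex_coweight)
  have t1: "translates 3 \<omega> 0 1" using translation_3[OF xy' kap \<omega>] \<omega> by (simp add: translates_def[OF l])
  obtain \<omega>1 where t2: "translates 3 \<omega>1 1 (- 1)" using translates_s2[OF l t1] xy' by auto
  obtain \<omega>2 where t3: "translates 3 \<omega>2 (- 1) 0" using translates_s1[OF l t2] xy' by auto
  have m: "m1 = m2" using x' xy xy' by simp
  note t = P_translate[OF l t1, simplified] P_translate[OF l t2, simplified] P_translate[OF l t3, simplified]
  have "P 3 u v" for u v
  proof (rule reduce_A2[of "P 3" y'])
    show "P 3 (u + of_int i) (v + of_int j)" if "P 3 u v" for u v i j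
      using that by (rule P_lattice[OF l, rotated 4]) (use t in \<open>force+\<close>)
    show "P 3 (- u) (v + of_int y' * u)" if "P 3 u v" "\<bar>u\<bar> \<le> 1" for u v using P_s1[OF l that] .
    show "P 3 (u + v) (- v)" if "P 3 u v" "\<bar>v\<bar> \<le> 1" for u v using P_s2[OF l that] xy' by simp
    show "P 3 u v" if "0 \<le> u" "0 \<le> v" "u + v \<le> 1" for u v
      by (rule P_alcove[OF l, where t = 1], rule alcove_3[OF refl refl xy m phi]) (use that xy xy' in auto)
  qed fact
  then show "xpow w \<in> K 3" by (rule P_D[OF l])
qed

lemma braid_4:
  assumes xy: "(x = 1 \<and> y = 2) \<or> (x = 2 \<and> y = 1)" and xy': "x' = 1" "y' = 2"
  shows "altw 4 A.T B.T p = altw 4 B.T A.T p"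
proof (rule K_linop_all)
  fix w
  have l: "(4::nat) > 0" "odd (4::nat) \<longrightarrow> A.\<kappa> = B.\<kappa>" by auto
  have "x * y \<noteq> 4" using xy by auto
  then obtain \<omega> where \<omega>: "\<alpha>1 \<cdot> \<omega> = 0" "\<alpha>2 \<cdot> \<omega> = of_int m2"
    by (rule ex_coweight)
  have t1: "translates 4 \<omega> 0 1" using translation_4[OF xy' \<omega>] \<omega> by (simp add: translates_def[OF l])
  obtain \<omega>1 where t2: "translates 4 \<omega>1 1 (- 1)" using translates_s2[OF l t1] xy' by auto
  obtain \<omega>2 where t3: "translates 4 \<omega>2 (- 1) 1" using translates_s1[OF l t2] xy' by auto
  obtain \<omega>3 where t4: "translates 4 \<omega>3 0 (- 1)" using translates_s2[OF l t3] xy' by auto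
  have m: "(x = 1 \<and> y = 2 \<and> m1 = m2) \<or> (x = 2 \<and> y = 1 \<and> m1 = 2 * m2)" using x' xy xy' by auto
  note t = P_translate[OF l t1, simplified] P_translate[OF l t2, simplified] P_translate[OF l t3, simplified] P_translate[OF l t4, simplified]
  have "P 4 u v" for u v
  proof (rule reduce_B2[of "P 4" y'])
    show "P 4 (u + of_int i) (v + of_int j)" if "P 4 u v" for u v i j
      using that by (rule P_lattice[OF l, rotated 4]) (use t in \<open>force+\<close>)
    show "P 4 (- u) (v + of_int y' * u)" if "P 4 u v" "\<bar>u\<bar> \<le> 1" for u v using P_s1[OF l that] .
    show "P 4 (u + v) (- v)" if "P 4 u v" "\<bar>v\<bar> \<le> 1" for u v using P_s2[OF l that] xy' by simp
    show "P 4 u v" if "0 \<le> u" "0 \<le> v" "2 * u + v \<le> 1" for u v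
      by (rule P_alcove[OF l, where t = 1], rule alcove_4[OF refl refl m]) (use that xy xy' in auto)
  qed fact
  then show "xpow w \<in> K 4" by (rule P_D[OF l])
qed

lemma braid_6:
  assumes xy: "(x = 1 \<and> y = 3) \<or> (x = 3 \<and> y = 1)" and xy': "x' = 1" "y' = 3"
  shows "altw 6 A.T B.T p = altw 6 B.T A.T p"
proof (rule K_linop_all)
  fix w
  have l: "(6::nat) > 0" "odd (6::nat) \<longrightarrow> A.\<kappa> = B.\<kappa>" by auto
  have "x * y \<noteq> 4" using xy by auto
  then obtain \<omega> where \<omega>: "\<alpha>1 \<cdot> \<omega> = 0" "\<alpha>2 \<cdot> \<omega> = of_int m2"
    by (rule ex_coweight)
  have t1: "translates 6 \<omega> 0 1" using translation_6[OF xy' \<omega>] \<omega> by (simp add: translates_def[OF l])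
  obtain \<omega>1 where t2: "translates 6 \<omega>1 1 (- 1)" using translates_s2[OF l t1] xy' by auto
  obtain \<omega>2 where t3: "translates 6 \<omega>2 (- 1) 2" using translates_s1[OF l t2] xy' by auto
  obtain \<omega>3 where t4: "translates 6 \<omega>3 1 (- 2)" using translates_s2_double[OF l t3] xy' by auto
  obtain \<omega>4 where t5: "translates 6 \<omega>4 (- 1) 1" using translates_s1[OF l t4] xy' by auto
  obtain \<omega>5 where t6: "translates 6 \<omega>5 0 (- 1)" using translates_s2[OF l t5] xy' by auto
  have m: "(x = 1 \<and> y = 3 \<and> m1 = m2) \<or> (x = 3 \<and> y = 1 \<and> m1 = 3 * m2)" using x' xy xy' by auto
  note t = P_translate[OF l t1, simplified] P_translate[OF l t2, simplified] P_translate[OF l t5, simplified] P_translate[OF l t6, simplified]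
  have "P 6 u v" for u v
  proof (rule reduce_G2[of "P 6" y'])
    show "P 6 (u + of_int i) (v + of_int j)" if "P 6 u v" for u v i j
      using that by (rule P_lattice[OF l, rotated 4]) (use t in \<open>force+\<close>)
    show "P 6 (- u) (v + of_int y' * u)" if "P 6 u v" "\<bar>u\<bar> \<le> 1" for u v using P_s1[OF l that] .
    show "P 6 (u + v) (- v)" if "P 6 u v" "\<bar>v\<bar> \<le> 1" for u v using P_s2[OF l that] xy' by simp
    show "P 6 u v" if "0 \<le> u" "0 \<le> v" "3 * u + 2 * v \<le> 1" for u v
      by (rule P_alcove[OF l, where t = 2], rule alcove_6[OF refl refl m]) (use that xy xy' in auto)
  qed fact
  then show "xpow w \<in> K 6" by (rule P_D[OF l])
qed

end


section \<open>Representations of algebras given by generators and relations\<close>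

lemma free_algebra_simps [simp]:
  "carrier (free_algebra X) = {p. \<forall>w\<in>keys p. set w \<subseteq> X}"
  "mult (free_algebra X) = (*)" "one (free_algebra X) = 1" "zero (free_algebra X) = 0"
  "add (free_algebra X) = (+)" "smult (free_algebra X) = scale"
  by (simp_all add: free_algebra_def)

lemma free_algebra_closed:
  assumes "p \<in> carrier (free_algebra X)" "p' \<in> carrier (free_algebra X)"
  shows free_algebra_add_closed: "p + p' \<in> carrier (free_algebra X)"
    and free_algebra_diff_closed: "p - p' \<in> carrier (free_algebra X)"
    and free_algebra_mult_closed: "p * p' \<in> carrier (free_algebra X)"
  using assms keys_add[of p p'] keys_diff[of p p'] keys_mult[of p p']
  by (auto simp: plus_list_def) fastforce+

lemma free_algebra_single: "set w \<subseteq> X \<Longrightarrow> single w c \<in> carrier (free_algebra X)"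
  by simp

lemma free_algebra_uminus_closed: "p \<in> carrier (free_algebra X) \<Longrightarrow> - p \<in> carrier (free_algebra X)"
  using free_algebra_diff_closed[of 0 X p] by simp

lemma one_eq_empty_word: "(1 :: 'g list \<Rightarrow>\<^sub>0 'f::field) = single [] 1"
  by (simp add: zero_list_def[symmetric])

lemma free_algebra_one_closed: "1 \<in> carrier (free_algebra X)"
  unfolding one_eq_empty_word by (rule free_algebra_single) simp

lemma ring_free_algebra: "ring (free_algebra X)"
proof (rule ringI)
  show "abelian_group (free_algebra X)"
    by (rule abelian_groupI)
      (use free_algebra_add_closed free_algebra_uminus_closed in \<open>auto simp: add_ac simp del: free_algebra_simps(1) intro!: bexI[of _ "- _"]\<close>, simp)
  show "monoid (free_algebra X)"
    by (rule monoidI) (use free_algebra_mult_closed free_algebra_one_closed in \<open>auto simp: mult.assoc simp del: free_algebra_simps(1)\<close>)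
qed (auto simp: distrib_left distrib_right)

lemma free_algebra_a_inv: "p \<in> carrier (free_algebra X) \<Longrightarrow> \<ominus>\<^bsub>free_algebra X\<^esub> p = - p"
proof -
  interpret ring "free_algebra X" by (rule ring_free_algebra)
  assume p: "p \<in> carrier (free_algebra X)"
  show ?thesis by (rule minus_equality) (use p free_algebra_uminus_closed[OF p] in simp_all)
qed

text \<open>
  An action of letters by linear operators, a stable subspace \<open>V\<close> for the letters in \<open>X\<close>, and relations \<open>R\<close>.
  Letters outside \<open>X\<close> act as well, by operators that play no role.
\<close>

locale generator_action =
  fixes act :: "'g \<Rightarrow> ('a::monoid_add \<Rightarrow>\<^sub>0 'f::field) \<Rightarrow> ('a \<Rightarrow>\<^sub>0 'f)"
    and V :: "('a \<Rightarrow>\<^sub>0 'f) set" and X :: "'g set" and R :: "('g list \<Rightarrow>\<^sub>0 'f) set"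
  assumes linop_act: "linop (act g)"
    and V_0: "0 \<in> V" and V_add: "p \<in> V \<Longrightarrow> p' \<in> V \<Longrightarrow> p + p' \<in> V" and V_cst: "p \<in> V \<Longrightarrow> cst c * p \<in> V"
    and V_act: "g \<in> X \<Longrightarrow> p \<in> V \<Longrightarrow> act g p \<in> V"
    and R_carrier: "R \<subseteq> carrier (free_algebra X)"
begin

abbreviation "Fr \<equiv> free_algebra X :: ('f, 'g list \<Rightarrow>\<^sub>0 'f) module"
abbreviation "H \<equiv> presented_algebra X R"
text \<open>The ideal of relations and its cosets.\<close>

definition I where "I = genideal Fr R"
abbreviation coset :: "('g list \<Rightarrow>\<^sub>0 'f) \<Rightarrow> ('g list \<Rightarrow>\<^sub>0 'f) set" where
  "coset P \<equiv> I +>\<^bsub>Fr\<^esub> P"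

sublocale Fr: ring Fr by (rule ring_free_algebra)
sublocale I: ideal I Fr unfolding I_def by (rule Fr.genideal_ideal[OF R_carrier])

text \<open>The action of words and of the free algebra.\<close>

definition word_act :: "'g list \<Rightarrow> ('a \<Rightarrow>\<^sub>0 'f) \<Rightarrow> ('a \<Rightarrow>\<^sub>0 'f)" where
  "word_act w p = foldr act w p"

definition ev :: "('g list \<Rightarrow>\<^sub>0 'f) \<Rightarrow> ('a \<Rightarrow>\<^sub>0 'f) \<Rightarrow> ('a \<Rightarrow>\<^sub>0 'f)" where
  "ev P p = (\<Sum>w\<in>keys P. cst (lookup P w) * word_act w p)"

lemma linop_word_act: "linop (word_act w)"
  unfolding word_act_def[abs_def]
  by (induction w) (use linop_act in \<open>auto simp: linop_def\<close>)

lemma word_act_V: "set w \<subseteq> X \<Longrightarrow> p \<in> V \<Longrightarrow> word_act w p \<in> V"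
  unfolding word_act_def by (induction w) (auto intro: V_act)

lemma ev_superset:
  assumes "finite S" "keys P \<subseteq> S"
  shows "ev P p = (\<Sum>w\<in>S. cst (lookup P w) * word_act w p)"
  unfolding ev_def using assms by (intro sum.mono_neutral_left) (auto simp: in_keys_iff)

lemma ev_single: "ev (single w c) p = cst c * word_act w p"
  using ev_superset[of "{w}" "single w c" p] by simp

lemma ev_0 [simp]: "ev 0 p = 0"
  by (simp add: ev_def)

lemma ev_add: "ev (P + P') p = ev P p + ev P' p"
proof -
  let ?S = "keys P \<union> keys P'"
  have "ev (P + P') p = (\<Sum>w\<in>?S. cst (lookup (P + P') w) * word_act w p)"
    by (rule ev_superset) (simp_all add: keys_add)
  also have "\<dots> = ev P p + ev P' p"
    using ev_superset[of ?S P p] ev_superset[of ?S P' p]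
    by (simp add: lookup_add single_add distrib_right sum.distrib)
  finally show ?thesis .
qed

lemma ev_1: "ev 1 p = p"
  unfolding one_eq_empty_word ev_single by (simp add: word_act_def)

lemma linop_ev: "linop (ev P)"
proof (induction P rule: poly_mapping_monomial_induct)
  case zero show ?case by (simp add: linop_def)
next
  case (single w c)
  have "cst c * (cst d * p) = cst d * (cst c * p)" for d and p :: "'a \<Rightarrow>\<^sub>0 'f"
    by (simp only: mult.assoc[symmetric] mult_single mult.commute[of c])
  then show ?case using linop_word_act[of w] by (simp add: linop_def ev_single distrib_left)
next
  case (add P P') then show ?case by (simp add: linop_def ev_add distrib_left add_ac)
qed

lemma ev_mult: "ev (P * P') p = ev P (ev P' p)"
proof (induction P rule: poly_mapping_monomial_induct)
  case zero show ?case by simp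
next
  case (single w c)
  show ?case
  proof (induction P' rule: poly_mapping_monomial_induct)
    case zero show ?case by (simp add: linop_0[OF linop_ev])
  next
    case (single w' c')
    have "word_act w (cst c' * word_act w' p) = cst c' * word_act (w @ w') p"
      using linop_cst[OF linop_word_act] by (simp add: word_act_def)
    then show ?case by (simp add: mult_single ev_single plus_list_def mult.assoc[symmetric])
  next
    case (add P P') then show ?case by (simp add: distrib_left ev_add linop_add[OF linop_ev])
  qed
next
  case (add P P'') then show ?case by (simp add: distrib_right ev_add)
qed

lemma ev_uminus: "ev (- P) p = - ev P p"
  using ev_add[of "-P" P p] by (simp add: eq_neg_iff_add_eq_0)

lemma ev_diff: "ev (P - P') p = ev P p - ev P' p"
  using ev_add[of P "- P'" p] by (simp add: ev_uminus)

lemma ev_V: "P \<in> carrier Fr \<Longrightarrow> p \<in> V \<Longrightarrow> ev P p \<in> V"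
proof -
  assume P: "P \<in> carrier Fr" and p: "p \<in> V"
  show ?thesis
  proof (rule poly_mapping_monomial_induct[of "\<lambda>P. ev P p \<in> V"])
    fix w c assume "w \<in> keys P"
    then show "ev (single w c) p \<in> V" using P p by (auto simp: ev_single intro!: V_cst word_act_V)
  qed (auto simp: V_0 ev_add V_add)
qed

lemma coset_closed: "P \<in> carrier Fr \<Longrightarrow> coset P \<in> carrier H"
  unfolding presented_algebra_def Let_def I_def[symmetric]
  by (simp add: FactRing_def A_RCOSETS_def RCOSETS_def a_r_coset_def del: free_algebra_simps(1)) blast

lemma carrier_H: "Y \<in> carrier H \<longleftrightarrow> (\<exists>P\<in>carrier Fr. Y = coset P)"
  unfolding presented_algebra_def Let_def I_def[symmetric]
  by (auto simp add: FactRing_def A_RCOSETS_def RCOSETS_def a_r_coset_def simp del: free_algebra_simps(1))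

lemma H_simps:
  assumes "P \<in> carrier Fr" "P' \<in> carrier Fr"
  shows "(coset P) \<otimes>\<^bsub>H\<^esub> (coset P') = coset (P * P')"
    "(coset P) \<oplus>\<^bsub>H\<^esub> (coset P') = coset (P + P')"
    "\<one>\<^bsub>H\<^esub> = coset 1"
    "c \<odot>\<^bsub>H\<^esub> (coset P) = coset (scale c P)"
proof -
  have 1: "cst c \<in> carrier Fr" by (rule free_algebra_single) (simp add: zero_list_def)
  show "(coset P) \<otimes>\<^bsub>H\<^esub> (coset P') = coset (P * P')"
    "(coset P) \<oplus>\<^bsub>H\<^esub> (coset P') = coset (P + P')"
    "\<one>\<^bsub>H\<^esub> = coset 1"
    "c \<odot>\<^bsub>H\<^esub> (coset P) = coset (scale c P)"
    unfolding presented_algebra_def Let_def I_def[symmetric]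
    using I.rcoset_mult_add[OF assms] I.a_rcos_sum[OF assms] I.rcoset_mult_add[OF 1 assms(1)]
    by (simp_all add: FactRing_def scale_eq_cst_mult del: free_algebra_simps(1))
qed

lemma presented_gen_eq: "presented_gen X R g = coset (single [g] 1)"
  by (simp add: presented_gen_def I_def)

context
  assumes R_ev: "\<And>\<rho> p. \<rho> \<in> R \<Longrightarrow> p \<in> V \<Longrightarrow> ev \<rho> p = 0"
begin

text \<open>The elements that act as zero form an ideal, which contains the relations.\<close>

lemma I_ev: assumes "P \<in> I" "p \<in> V" shows "ev P p = 0"
proof -
  let ?J = "{P \<in> carrier Fr. \<forall>p\<in>V. ev P p = 0}"
  have "ideal ?J Fr"
  proof (rule idealI[OF ring_free_algebra])
    show "subgroup ?J (add_monoid Fr)"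
    proof (rule Fr.add.subgroupI)
      show "\<ominus>\<^bsub>Fr\<^esub> P \<in> ?J" if "P \<in> ?J" for P
        using that free_algebra_a_inv[of P X] free_algebra_uminus_closed[of P X] by (simp add: ev_uminus)
      show "?J \<noteq> {}" using ev_0 by (auto intro!: exI[of _ 0])
    qed (use free_algebra_add_closed in \<open>auto simp: ev_add simp del: free_algebra_simps(1)\<close>)
  qed (use free_algebra_mult_closed in \<open>auto simp: ev_mult ev_V linop_0[OF linop_ev] simp del: free_algebra_simps(1)\<close>)
  moreover have "R \<subseteq> ?J" using R_carrier R_ev by blast
  ultimately have "I \<subseteq> ?J" unfolding I_def by (rule Fr.genideal_minimal)
  then show ?thesis using assms by blast
qed

text \<open>The representation of the quotient on \<open>V\<close>; by \<open>I_ev\<close> the representative of the coset does not matter.\<close>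

definition rep :: "('g list \<Rightarrow>\<^sub>0 'f) set \<Rightarrow> ('a \<Rightarrow>\<^sub>0 'f) \<Rightarrow> ('a \<Rightarrow>\<^sub>0 'f)" where
  "rep = (\<lambda>Y\<in>carrier H. \<lambda>p\<in>V. ev (SOME P. P \<in> carrier Fr \<and> Y = coset P) p)"

lemma rep_coset: assumes P: "P \<in> carrier Fr" shows "rep (coset P) = (\<lambda>p\<in>V. ev P p)"
proof -
  define P' where "P' = (SOME P'. P' \<in> carrier Fr \<and> coset P = coset P')"
  have P': "P' \<in> carrier Fr" "coset P = coset P'"
    unfolding P'_def using someI[of "\<lambda>P'. P' \<in> carrier Fr \<and> coset P = coset P'" P] P by blast+
  then have "P \<ominus>\<^bsub>Fr\<^esub> P' \<in> I" using Fr.quotient_eq_iff_same_a_r_cos[OF I.ideal_axioms P] by simp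
  then have "P - P' \<in> I" using P'(1) by (simp add: a_minus_def free_algebra_a_inv)
  then have "ev P p = ev P' p" if "p \<in> V" for p
    using I_ev[of "P - P'" p] that by (simp add: ev_diff)
  then show ?thesis using coset_closed[OF P] unfolding rep_def P'_def
    by (auto simp: fun_eq_iff simp del: free_algebra_simps(1))
qed

lemma ev_End: "P \<in> carrier Fr \<Longrightarrow> (\<lambda>p\<in>V. ev P p) \<in> carrier (End_algebra V)"
  using ev_V linopD[OF linop_ev[of P]] V_add V_cst
  by (auto simp: End_algebra_def linear_on_def scale_eq_cst_mult)

lemma rep_hom: "rep \<in> algebra_hom H (End_algebra V)"
  unfolding algebra_hom_def
proof (intro CollectI conjI ballI allI ring_hom_memI)
  fix Y assume "Y \<in> carrier H"
  then obtain P where P: "P \<in> carrier Fr" "Y = coset P" by (auto simp: carrier_H simp del: free_algebra_simps(1))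
  show "rep Y \<in> carrier (End_algebra V)" using ev_End[OF P(1)] rep_coset[OF P(1)] P(2) by simp
  fix c
  have 1: "cst c \<in> carrier Fr" by (rule free_algebra_single) (simp add: zero_list_def)
  have "rep (c \<odot>\<^bsub>H\<^esub> Y) = (\<lambda>p\<in>V. ev (cst c * P) p)"
    unfolding P(2) H_simps(4)[OF P(1) P(1)] scale_eq_cst_mult by (rule rep_coset[OF free_algebra_mult_closed[OF 1 P(1)]])
  also have "\<dots> = c \<odot>\<^bsub>End_algebra V\<^esub> rep Y"
    using rep_coset[OF P(1)] P(2)
    by (auto simp: End_algebra_def ev_mult ev_single[of "0::'g list", unfolded zero_list_def] word_act_def zero_list_def scale_eq_cst_mult fun_eq_iff)
  finally show "rep (c \<odot>\<^bsub>H\<^esub> Y) = c \<odot>\<^bsub>End_algebra V\<^esub> rep Y" .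
  fix Y' assume "Y' \<in> carrier H"
  then obtain P' where P': "P' \<in> carrier Fr" "Y' = coset P'" by (auto simp: carrier_H simp del: free_algebra_simps(1))
  have "rep (Y \<otimes>\<^bsub>H\<^esub> Y') = (\<lambda>p\<in>V. ev (P * P') p)"
    unfolding P(2) P'(2) H_simps(1)[OF P(1) P'(1)] by (rule rep_coset[OF free_algebra_mult_closed[OF P(1) P'(1)]])
  also have "\<dots> = rep Y \<otimes>\<^bsub>End_algebra V\<^esub> rep Y'"
    using rep_coset[OF P(1)] rep_coset[OF P'(1)] P(2) P'(2) ev_V[OF P'(1)]
    by (auto simp: End_algebra_def ev_mult fun_eq_iff)
  finally show "rep (Y \<otimes>\<^bsub>H\<^esub> Y') = rep Y \<otimes>\<^bsub>End_algebra V\<^esub> rep Y'" .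
  have "rep (Y \<oplus>\<^bsub>H\<^esub> Y') = (\<lambda>p\<in>V. ev (P + P') p)"
    unfolding P(2) P'(2) H_simps(2)[OF P(1) P'(1)] by (rule rep_coset[OF free_algebra_add_closed[OF P(1) P'(1)]])
  also have "\<dots> = rep Y \<oplus>\<^bsub>End_algebra V\<^esub> rep Y'"
    using rep_coset[OF P(1)] rep_coset[OF P'(1)] P(2) P'(2)
    by (auto simp: End_algebra_def ev_add fun_eq_iff)
  finally show "rep (Y \<oplus>\<^bsub>H\<^esub> Y') = rep Y \<oplus>\<^bsub>End_algebra V\<^esub> rep Y'" .
next
  show "rep \<one>\<^bsub>H\<^esub> = \<one>\<^bsub>End_algebra V\<^esub>"
    using rep_coset[OF free_algebra_one_closed] H_simps(3)[OF free_algebra_one_closed free_algebra_one_closed]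
    by (auto simp: End_algebra_def ev_1 fun_eq_iff)
qed

lemma rep_gen: "g \<in> X \<Longrightarrow> p \<in> V \<Longrightarrow> rep (presented_gen X R g) p = act g p"
  using rep_coset[OF free_algebra_single[of "[g]" X 1]]
  by (simp add: presented_gen_eq ev_single word_act_def)

end

text \<open>A representation is determined by the operators of the generators.\<close>

lemma hom_ev:
  assumes hom: "\<pi> \<in> algebra_hom H (End_algebra V)"
    and gen: "\<And>g p. g \<in> X \<Longrightarrow> p \<in> V \<Longrightarrow> \<pi> (presented_gen X R g) p = act g p"
    and P: "P \<in> carrier Fr"
  shows "\<pi> (coset P) = (\<lambda>p\<in>V. ev P p)"
proof -
  have rh: "\<pi> \<in> ring_hom H (End_algebra V)"
    and sm: "\<And>c Y. Y \<in> carrier H \<Longrightarrow> \<pi> (c \<odot>\<^bsub>H\<^esub> Y) = c \<odot>\<^bsub>End_algebra V\<^esub> \<pi> Y"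
    using hom by (auto simp: algebra_hom_def)
  have End: "\<pi> Y \<in> carrier (End_algebra V)" if "Y \<in> carrier H" for Y
    using rh that by (rule ring_hom_closed)
  have one: "\<pi> (coset 1) = (\<lambda>p\<in>V. p)"
    using ring_hom_one[OF rh] H_simps(3)[OF free_algebra_one_closed free_algebra_one_closed] by (simp add: End_algebra_def)
  have word: "\<pi> (coset (single w 1)) = (\<lambda>p\<in>V. word_act w p)" if "set w \<subseteq> X" for w
    using that
  proof (induction w)
    case Nil then show ?case using one by (simp add: one_eq_empty_word[symmetric] word_act_def)
  next
    case (Cons g w)
    have c: "single [g] (1::'f) \<in> carrier Fr" "single w (1::'f) \<in> carrier Fr"
      using Cons.prems by (auto intro!: free_algebra_single simp del: free_algebra_simps)
    have "single (g # w) (1::'f) = single [g] 1 * single w 1"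
      by (simp add: mult_single plus_list_def)
    then have "\<pi> (coset (single (g # w) 1))
       = \<pi> (presented_gen X R g) \<otimes>\<^bsub>End_algebra V\<^esub> \<pi> (coset (single w 1))"
      using H_simps(1)[OF c] ring_hom_mult[OF rh coset_closed[OF c(1)] coset_closed[OF c(2)]]
      by (simp add: presented_gen_eq)
    also have "\<dots> = (\<lambda>p\<in>V. word_act (g # w) p)"
      using Cons gen word_act_V by (auto simp: End_algebra_def word_act_def fun_eq_iff)
    finally show ?case .
  qed
  have "P \<in> carrier Fr \<and> \<pi> (coset P) = (\<lambda>p\<in>V. ev P p)"
  proof (rule poly_mapping_monomial_induct[of "\<lambda>P. P \<in> carrier Fr \<and> \<pi> (coset P) = (\<lambda>p\<in>V. ev P p)"])
    have single: "single w c \<in> carrier Fr \<and> \<pi> (coset (single w c)) = (\<lambda>p\<in>V. ev (single w c) p)"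
      if w: "set w \<subseteq> X" for w c
    proof
      show "single w c \<in> carrier Fr" using w by (rule free_algebra_single)
      have w1: "single w (1::'f) \<in> carrier Fr" using w by (rule free_algebra_single)
      have "scale c (single w 1) = single w c"
        by simp
      then show "\<pi> (coset (single w c)) = (\<lambda>p\<in>V. ev (single w c) p)"
        using sm[OF coset_closed[OF w1], of c] H_simps(4)[OF w1 w1, of c] word[OF w]
        by (auto simp: End_algebra_def ev_single scale_eq_cst_mult[where 'a='a] fun_eq_iff)
    qed
    show "single w c \<in> carrier Fr \<and> \<pi> (coset (single w c)) = (\<lambda>p\<in>V. ev (single w c) p)"
      if "w \<in> keys P" for w c
      using that P by (intro single) auto
    show "0 \<in> carrier Fr \<and> \<pi> (coset 0) = (\<lambda>p\<in>V. ev 0 p)"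
      using single[of "[]" 0] by simp
    fix P P' assume a: "P \<in> carrier Fr \<and> \<pi> (coset P) = (\<lambda>p\<in>V. ev P p)" "P' \<in> carrier Fr \<and> \<pi> (coset P') = (\<lambda>p\<in>V. ev P' p)"
    then have c: "P \<in> carrier Fr" "P' \<in> carrier Fr" by auto
    have "\<pi> (coset (P + P')) = \<pi> (coset P) \<oplus>\<^bsub>End_algebra V\<^esub> \<pi> (coset P')"
      using H_simps(2)[OF c] ring_hom_add[OF rh coset_closed[OF c(1)] coset_closed[OF c(2)]] by simp
    then show "P + P' \<in> carrier Fr \<and> \<pi> (coset (P + P')) = (\<lambda>p\<in>V. ev (P + P') p)"
      using a free_algebra_add_closed[OF c] by (auto simp: End_algebra_def ev_add fun_eq_iff simp del: free_algebra_simps)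
  qed
  then show ?thesis by simp
qed

theorem ex1_representation:
  assumes "\<And>\<rho> p. \<rho> \<in> R \<Longrightarrow> p \<in> V \<Longrightarrow> ev \<rho> p = 0"
  shows "\<exists>!\<pi>. \<pi> \<in> extensional (carrier H) \<and> \<pi> \<in> algebra_hom H (End_algebra V) \<and>
    (\<forall>g\<in>X. \<forall>p\<in>V. \<pi> (presented_gen X R g) p = act g p)"
proof (rule ex1I[of _ "rep"], intro conjI ballI)
  show "rep \<in> extensional (carrier H)" by (simp add: rep_def[OF assms])
  show "rep \<in> algebra_hom H (End_algebra V)" by (rule rep_hom[OF assms])
  show "rep (presented_gen X R g) p = act g p" if "g \<in> X" "p \<in> V" for g p
    using assms that by (rule rep_gen)
  fix \<pi> assume \<pi>: "\<pi> \<in> extensional (carrier H) \<and> \<pi> \<in> algebra_hom H (End_algebra V) \<and>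
    (\<forall>g\<in>X. \<forall>p\<in>V. \<pi> (presented_gen X R g) p = act g p)"
  show "\<pi> = rep"
  proof (rule extensionalityI[of _ "carrier H"])
    show "\<pi> \<in> extensional (carrier H)" using \<pi> by blast
    show "rep \<in> extensional (carrier H)" by (simp add: rep_def[OF assms])
    fix Y assume "Y \<in> carrier H"
    then obtain P where P: "P \<in> carrier Fr" "Y = coset P" by (auto simp: carrier_H simp del: free_algebra_simps(1))
    have "\<pi> Y = (\<lambda>p\<in>V. ev P p)" unfolding P(2) by (rule hom_ev) (use \<pi> P in auto)
    moreover have "rep Y = (\<lambda>p\<in>V. ev P p)" unfolding P(2) using assms P(1) by (rule rep_coset)
    ultimately show "\<pi> Y = rep Y" by simp
  qed
qed

end


section \<open>Root systems and metaplectic data\<close>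

text \<open>Integer spans are spans in the \<open>\<int>\<close>-module underlying a real vector space.\<close>

interpretation int_module: Modules.module "\<lambda>(j::int) (x::'e::real_vector). of_int j *\<^sub>R x"
  by unfold_locales (simp_all add: scaleR_add_left scaleR_add_right)

lemma int_span_eq: "int_span S = int_module.span S"
  by (simp add: int_span_def)

lemma int_span_add: "x \<in> int_span S \<Longrightarrow> y \<in> int_span S \<Longrightarrow> x + y \<in> int_span S"
  and int_span_scale: "x \<in> int_span S \<Longrightarrow> of_int j *\<^sub>R x \<in> int_span S"
  and int_span_base: "x \<in> S \<Longrightarrow> x \<in> int_span S"
  and int_span_0: "0 \<in> int_span S"
  unfolding int_span_eq
  by (rule int_module.span_add int_module.span_scale int_module.span_base int_module.span_zero; assumption)+

lemma int_span_diff: "x \<in> int_span S \<Longrightarrow> y \<in> int_span S \<Longrightarrow> x - y \<in> int_span S"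
  using int_span_add[of x S "of_int (-1) *\<^sub>R y"] int_span_scale[of y S "-1"] by simp

lemma int_span_induct [consumes 1, case_names zero add scale base]:
  assumes "x \<in> int_span S" "P 0" "\<And>x y. P x \<Longrightarrow> P y \<Longrightarrow> P (x + y)" "\<And>(j::int) x. P x \<Longrightarrow> P (of_int j *\<^sub>R x)"
    "\<And>x. x \<in> S \<Longrightarrow> P x"
  shows "P x"
proof -
  have "int_module.subspace (Collect P)"
    by (rule int_module.subspaceI) (use assms in auto)
  from int_module.span_induct[OF assms(1)[unfolded int_span_eq], OF this] assms(5) show ?thesis by blast
qed

subsection \<open>Reflections\<close>

lemma riesz_diff: "riesz (\<alpha> - \<beta>) = riesz \<alpha> - riesz \<beta>"
  and riesz_scaleR: "riesz (t *\<^sub>R \<alpha>) = t *\<^sub>R riesz \<alpha>"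
  and riesz_minus: "riesz (- \<alpha>) = - riesz \<alpha>"
  by (simp_all add: riesz_def blinfun.diff_left blinfun.scaleR_left blinfun.minus_left scaleR_left_diff_distrib
      sum_subtractf scaleR_sum_right sum_negf)

lemma riesz_inject: "riesz \<alpha> = riesz \<beta> \<Longrightarrow> \<alpha> = \<beta>"
  by (rule blinfun_eqI) (metis inner_riesz)

lemma coroot_minus: "coroot (- \<alpha>) = - coroot \<alpha>"
  by (simp add: coroot_def riesz_minus)

lemma coroot_scaleR: "t \<noteq> 0 \<Longrightarrow> coroot (t *\<^sub>R \<alpha>) = (1 / t) *\<^sub>R coroot \<alpha>"
  by (simp add: coroot_def riesz_scaleR power_mult_distrib) (simp add: power2_eq_square)

lemma reflection_minus: "reflection (- \<alpha>) = reflection \<alpha>"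
  by (rule ext) (simp add: reflection_def coroot_minus blinfun.minus_left)

lemma apply_coroot_self: "\<alpha> \<noteq> 0 \<Longrightarrow> \<alpha> \<cdot> (coroot \<alpha>) = 2"
  by (simp add: coroot_def blinfun.scaleR_right inner_riesz[symmetric] dot_square_norm norm_riesz)

lemma apply_coroot: "\<beta> \<cdot> (coroot \<alpha>) = 2 * (riesz \<alpha> \<bullet> riesz \<beta>) / (norm \<alpha>)\<^sup>2"
  by (simp add: coroot_def blinfun.scaleR_right inner_riesz)

lemma reflection_reflection: "\<alpha> \<noteq> 0 \<Longrightarrow> reflection \<alpha> (reflection \<alpha> y) = y"
  by (simp add: reflection_def blinfun_right apply_coroot_self algebra_simps)

lemma linear_reflection: "linear (reflection \<alpha>)"
  by (rule linearI) (simp_all add: reflection_def blinfun_right algebra_simps)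

lemma riesz_reflect: "riesz (\<beta> - \<beta> \<cdot> (coroot \<alpha>) *\<^sub>R \<alpha>) = reflection \<alpha> (riesz \<beta>)"
  by (simp add: riesz_diff riesz_scaleR reflection_def apply_coroot inner_riesz coroot_def flip: inner_riesz)
    (simp add: inner_commute)

lemma norm_reflect: 
  assumes "\<alpha> \<noteq> 0" shows "norm (\<beta> - \<beta> \<cdot> (coroot \<alpha>) *\<^sub>R \<alpha>) = norm \<beta>"
proof -
  let ?a = "riesz \<alpha>" and ?b = "riesz \<beta>"
  have "?a \<bullet> ?a \<noteq> 0" using assms norm_riesz[of \<alpha>] by (simp add: dot_square_norm)
  then have "(?b - (2 * (?a \<bullet> ?b) / (?a \<bullet> ?a)) *\<^sub>R ?a) \<bullet> (?b - (2 * (?a \<bullet> ?b) / (?a \<bullet> ?a)) *\<^sub>R ?a) = ?b \<bullet> ?b"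
    by (simp add: inner_diff_left inner_diff_right inner_commute field_simps)
  moreover have "riesz (\<beta> - \<beta> \<cdot> (coroot \<alpha>) *\<^sub>R \<alpha>) = ?b - (2 * (?a \<bullet> ?b) / (?a \<bullet> ?a)) *\<^sub>R ?a"
    by (simp add: riesz_diff riesz_scaleR apply_coroot dot_square_norm norm_riesz)
  ultimately show ?thesis
    by (metis norm_eq_sqrt_inner norm_riesz)
qed

lemma coroot_reflect:
  assumes "\<alpha> \<noteq> 0" shows "coroot (\<beta> - \<beta> \<cdot> (coroot \<alpha>) *\<^sub>R \<alpha>) = reflection \<alpha> (coroot \<beta>)"
  by (simp add: coroot_def[of "\<beta> - _"] norm_reflect[OF assms] riesz_reflect coroot_def[of \<beta>]
      linear_cmul[OF linear_reflection])

subsection \<open>Pairs of roots\<close>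

lemma cartan_product_le: 
  assumes "\<alpha> \<noteq> 0" "\<beta> \<noteq> 0"
  shows "\<alpha> \<cdot> (coroot \<beta>) * \<beta> \<cdot> (coroot \<alpha>) \<le> 4"
    and "\<alpha> \<cdot> (coroot \<beta>) * \<beta> \<cdot> (coroot \<alpha>) = 4 \<Longrightarrow> \<exists>t. \<beta> = t *\<^sub>R \<alpha>"
proof -
  let ?a = "riesz \<alpha>" and ?b = "riesz \<beta>"
  have pos: "norm \<alpha> > 0" "norm \<beta> > 0" using assms by auto
  have e: "\<alpha> \<cdot> (coroot \<beta>) * \<beta> \<cdot> (coroot \<alpha>) = 4 * ((?a \<bullet> ?b)\<^sup>2 / (norm \<alpha> * norm \<beta>)\<^sup>2)"
    by (simp add: apply_coroot inner_commute power2_eq_square)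
  have cs: "(?a \<bullet> ?b)\<^sup>2 \<le> (norm \<alpha> * norm \<beta>)\<^sup>2"
    using Cauchy_Schwarz_ineq[of ?a ?b] by (simp add: dot_square_norm norm_riesz power_mult_distrib)
  show "\<alpha> \<cdot> (coroot \<beta>) * \<beta> \<cdot> (coroot \<alpha>) \<le> 4"
    unfolding e using cs pos by (simp add: divide_le_eq)
  assume "\<alpha> \<cdot> (coroot \<beta>) * \<beta> \<cdot> (coroot \<alpha>) = 4"
  then have "(?a \<bullet> ?b)\<^sup>2 = (norm \<alpha> * norm \<beta>)\<^sup>2" unfolding e using pos by (simp add: field_simps)
  then have "\<bar>?a \<bullet> ?b\<bar>\<^sup>2 = (norm ?a * norm ?b)\<^sup>2" by (simp add: norm_riesz)
  then have "\<bar>?a \<bullet> ?b\<bar> = norm ?a * norm ?b" by (rule power2_eq_imp_eq) simp_all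
  then have "norm \<alpha> *\<^sub>R ?b = norm \<beta> *\<^sub>R ?a \<or> norm \<alpha> *\<^sub>R ?b = - norm \<beta> *\<^sub>R ?a"
    using norm_cauchy_schwarz_abs_eq[of ?a ?b, THEN iffD1] by (simp add: norm_riesz)
  then obtain s where s: "norm \<alpha> *\<^sub>R ?b = s *\<^sub>R ?a" by blast
  have "?b = (1 / norm \<alpha>) *\<^sub>R (norm \<alpha> *\<^sub>R ?b)" using pos by simp
  also have "\<dots> = riesz ((s / norm \<alpha>) *\<^sub>R \<alpha>)" unfolding s by (simp add: riesz_scaleR)
  finally have "?b = riesz ((s / norm \<alpha>) *\<^sub>R \<alpha>)" .
  then show "\<exists>t. \<beta> = t *\<^sub>R \<alpha>" by (blast dest: riesz_inject)
qed

text \<open>The sequence \<open>\<beta>(v\<^sup>N \<beta>\<^sup>\<or>)\<close> for the product \<open>v\<close> of the reflections of two roots \<open>\<alpha>\<close>, \<open>\<beta>\<close> whose Cartan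
  integers have product \<open>p\<close>.  Its value is \<open>2\<close> if \<open>v\<^sup>N\<close> is the identity.\<close>

fun rotation_seq :: "int \<Rightarrow> nat \<Rightarrow> int" where
  "rotation_seq p 0 = 2"
| "rotation_seq p (Suc 0) = p - 2"
| "rotation_seq p (Suc (Suc N)) = (p - 2) * rotation_seq p (Suc N) - rotation_seq p N"

text \<open>The order of that rotation for \<open>p = 0, 1, 2, 3\<close>.\<close>

definition coxeter_number :: "int \<Rightarrow> nat" where
  "coxeter_number p = (if p = 0 then 2 else if p = 1 then 3 else if p = 2 then 4 else 6)"

lemma rotation_seq_eq_2:
  assumes p: "0 \<le> p" "p \<le> 3" and N: "rotation_seq p N = 2"
  shows "coxeter_number p dvd N"
proof -
  let ?l = "coxeter_number p"
  have p': "p = 0 \<or> p = 1 \<or> p = 2 \<or> p = 3" using p by linarith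
  have per: "rotation_seq p (N + ?l) = rotation_seq p N" for N
  proof (cases "p = 0")
    case True
    have "rotation_seq 0 (Suc N) = - rotation_seq 0 N" for N by (induction N) simp_all
    then show ?thesis by (simp add: True coxeter_number_def)
  next
    case False
    then show ?thesis using p' by (elim disjE) (simp_all add: coxeter_number_def eval_nat_numeral)
  qed
  have "rotation_seq p (N + i * ?l) = rotation_seq p N" for N i
  proof (induction i)
    case (Suc i)
    have "N + Suc i * ?l = (N + i * ?l) + ?l" by simp
    then show ?case using per Suc by presburger
  qed simp
  from this[of "N mod ?l" "N div ?l"] N have e: "rotation_seq p (N mod ?l) = 2" by simp
  have small: "i = 0" if "rotation_seq p i = 2" "i < ?l" for i
  proof -
    have "i = 0 \<or> i = 1 \<or> i = 2 \<or> i = 3 \<or> i = 4 \<or> i = 5" "p = 0 \<longrightarrow> i < 2" "p = 1 \<longrightarrow> i < 3" "p = 2 \<longrightarrow> i < 4"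
      using that(2) by (auto simp: coxeter_number_def split: if_splits)
    then show ?thesis using p' that(1) by (elim disjE) (simp_all add: eval_nat_numeral)
  qed
  have "N mod ?l < ?l" by (simp add: coxeter_number_def)
  then have "N mod ?l = 0" using small[OF e] by blast
  then show ?thesis by (simp add: mod_eq_0_iff_dvd)
qed

lemma rotation_order:
  assumes nz: "\<alpha> \<noteq> 0" "\<beta> \<noteq> 0" and x: "\<alpha> \<cdot> (coroot \<beta>) = - of_int x" and y: "\<beta> \<cdot> (coroot \<alpha>) = - of_int y"
    and p: "x * y \<ge> 0" "x * y \<le> 3"
    and N: "(reflection \<alpha> \<circ> reflection \<beta>) ^^ N = id"
  shows "coxeter_number (x * y) dvd N"
proof -
  define v where "v = reflection \<alpha> \<circ> reflection \<beta>"
  let ?u = "coroot \<alpha>" and ?w = "coroot \<beta>"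
  have lin: "linear v" unfolding v_def by (intro linear_compose linear_reflection)
  have vw: "v ?w = - of_int x *\<^sub>R ?u - ?w" 
    using nz x by (simp add: v_def reflection_def apply_coroot_self blinfun_right scaleR_2)
  have vu: "v ?u = (of_int (x * y) - 1) *\<^sub>R ?u + of_int y *\<^sub>R ?w"
    using nz x y by (simp add: v_def reflection_def apply_coroot_self blinfun_right algebra_simps scaleR_2)
  \<comment> \<open>Cayley--Hamilton on the plane of the coroots, where \<open>v\<close> has trace \<open>x y - 2\<close> and determinant \<open>1\<close>\<close>
  have rec: "v (v ?w) = of_int (x * y - 2) *\<^sub>R v ?w - ?w"
    unfolding vw linear_diff[OF lin] linear_cmul[OF lin] vu
    by (rule euclidean_eqI) (simp add: algebra_simps)
  have linN: "linear (v ^^ N)" for N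
  proof (induction N)
    case 0 show ?case by (auto intro: linearI)
  next
    case (Suc N) from linear_compose[OF this lin] show ?case by (simp add: o_def)
  qed
  have "\<beta> \<cdot> ((v ^^ N) ?w) = of_int (rotation_seq (x * y) N)
      \<and> \<beta> \<cdot> ((v ^^ Suc N) ?w) = of_int (rotation_seq (x * y) (Suc N))" for N
  proof (induction N)
    case 0
    show ?case using nz y by (simp add: vw apply_coroot_self blinfun_right)
  next
    case (Suc N)
    have "(v ^^ Suc (Suc N)) ?w = (v ^^ N) (v (v ?w))" by (simp add: funpow_swap1)
    also have "\<dots> = of_int (x * y - 2) *\<^sub>R (v ^^ Suc N) ?w - (v ^^ N) ?w"
      unfolding rec linear_diff[OF linN] linear_cmul[OF linN] by (simp add: funpow_swap1)
    finally show ?case using Suc by (simp add: blinfun_right)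
  qed
  then have "real_of_int (rotation_seq (x * y) N) = 2"
    using N nz by (metis v_def apply_coroot_self id_apply)
  then have "rotation_seq (x * y) N = 2" by linarith
  from rotation_seq_eq_2[OF p this] show ?thesis .
qed

text \<open>A braid relation implies those whose length is a multiple.\<close>

lemma altw_add: "altw (l + l') f g p = altw l f g (if even l then altw l' f g p else altw l' g f p)"
  by (induction l arbitrary: f g) auto

lemma altw_dvd:
  assumes "\<And>p. altw l f g p = altw l g f p" "l dvd l'"
  shows "altw l' f g p = altw l' g f p"
proof -
  have "altw (i * l) f g p = altw (i * l) g f p" for i
    by (induction i arbitrary: p) (auto simp: altw_add assms(1))
  with assms(2) show ?thesis by (metis dvd_def mult.commute)
qed

text \<open>If \<open>Q(\<alpha>\<^sup>\<or>) = p Q(\<beta>\<^sup>\<or>)\<close>, then \<open>m(\<beta>)\<close> is \<open>m(\<alpha>)\<close> or \<open>p m(\<alpha>)\<close>.\<close>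

lemma metaplectic_ratio:
  fixes n Q p :: int
  assumes "n > 0" "Q > 0" "p = 1 \<or> prime p"
  defines "m1 \<equiv> n div gcd n (p * Q)" and "m2 \<equiv> n div gcd n Q"
  shows "m2 = m1 \<or> m2 = p * m1"
proof -
  have p: "p > 0" using assms(3) by (auto simp: prime_gt_0_int)
  define g where "g = gcd n Q"
  define g' where "g' = gcd n (p * Q)"
  have g: "g > 0" "g' > 0" using assms(1) by (auto simp: g_def g'_def)
  have "g dvd g'" by (auto simp: g_def g'_def)
  then obtain d where d: "g' = g * d" by (auto elim: dvdE)
  have "p * g = gcd (p * n) (p * Q)"
    using p gcd_mult_distrib_int[of p n Q] by (simp add: g_def)
  then have "g' dvd p * g" by (auto simp: g'_def)
  then have "d dvd p" using d g by (simp add: mult.commute)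
  moreover have "d > 0" using d g by (simp add: zero_less_mult_iff)
  ultimately have "d = 1 \<or> d = p"
    using assms(3) by (metis zdvd_antisym_nonneg less_imp_le one_dvd prime_int_iff zero_le_one)
  moreover have "m2 = d * m1"
  proof -
    have "n = g' * m1" "n = g * m2" by (simp_all add: m1_def m2_def g_def g'_def)
    then have "g * m2 = g * (d * m1)" using d by (simp add: mult.assoc)
    then show ?thesis using g by simp
  qed
  ultimately show ?thesis by auto
qed


text \<open>The data of the theorem.\<close>

locale metaplectic_daha =
  fixes \<Phi> :: "'e::euclidean_space dual set" and r :: nat and a :: "nat \<Rightarrow> 'e dual" and \<theta> :: "'e dual"
    and M :: nat and \<Lambda> :: "'e set" and q :: "'f::field_char_0" and n :: nat and Q :: "'e \<Rightarrow> rat"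
    and k :: "'e dual \<Rightarrow> 'f" and h :: "int \<Rightarrow> 'e dual \<Rightarrow> 'f"
  assumes root_system: "reduced_root_system \<Phi>" and irreducible: "irreducible_root_system \<Phi>"
    and long_roots: "Max ((\<lambda>\<alpha>. (norm \<alpha>)\<^sup>2) ` \<Phi>) = 2 / (real M)\<^sup>2" and M_pos: "M > 0"
    and simple: "simple_roots \<Phi> r a"
    and q_nz: "q \<noteq> 0"
    and lattice: "\<exists>S. \<Lambda> = int_span S"
    and coroot_lattice_subset: "coroot_lattice \<Phi> \<subseteq> \<Lambda>"
    and integral: "\<forall>\<alpha>\<in>\<Phi>. \<forall>\<omega>\<in>\<Lambda>. \<alpha> \<cdot> \<omega> \<in> \<int>"
    and datum: "metaplectic_datum \<Phi> \<Lambda> n Q"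
    and theta_root: "\<theta> \<in> \<Phi>"
    and highest: "highest_root (metaplectic_roots \<Phi> n Q) r (\<lambda>i. mroot n Q (a i)) (mroot n Q \<theta>)"
    and k_nz: "\<forall>\<beta>\<in>metaplectic_roots \<Phi> n Q. k \<beta> \<noteq> 0"
    and k_norm: "\<forall>\<beta>\<in>metaplectic_roots \<Phi> n Q. \<forall>\<gamma>\<in>metaplectic_roots \<Phi> n Q. norm \<beta> = norm \<gamma> \<longrightarrow> k \<beta> = k \<gamma>"
    and h_param: "h \<in> metaplectic_parameters \<Phi> n Q k"
begin

lemma root_nz: "\<alpha> \<in> \<Phi> \<Longrightarrow> \<alpha> \<noteq> 0"
  and root_reflect: "\<alpha> \<in> \<Phi> \<Longrightarrow> \<beta> \<in> \<Phi> \<Longrightarrow> \<beta> - \<beta> \<cdot> (coroot \<alpha>) *\<^sub>R \<alpha> \<in> \<Phi>"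
  and root_int: "\<alpha> \<in> \<Phi> \<Longrightarrow> \<beta> \<in> \<Phi> \<Longrightarrow> \<beta> \<cdot> (coroot \<alpha>) \<in> \<int>"
  and root_reduced: "\<alpha> \<in> \<Phi> \<Longrightarrow> t *\<^sub>R \<alpha> \<in> \<Phi> \<Longrightarrow> t = 1 \<or> t = -1"
  using root_system unfolding reduced_root_system_def by blast+

lemma root_minus: "\<alpha> \<in> \<Phi> \<Longrightarrow> - \<alpha> \<in> \<Phi>"
  using root_reflect[of \<alpha> \<alpha>] root_nz[of \<alpha>] by (simp add: apply_coroot_self scaleR_2)

subsection \<open>The lattice and the quadratic form\<close>

lemma Lambda_add: "x \<in> \<Lambda> \<Longrightarrow> y \<in> \<Lambda> \<Longrightarrow> x + y \<in> \<Lambda>"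
  and Lambda_diff: "x \<in> \<Lambda> \<Longrightarrow> y \<in> \<Lambda> \<Longrightarrow> x - y \<in> \<Lambda>"
  and Lambda_scale: "x \<in> \<Lambda> \<Longrightarrow> of_int j *\<^sub>R x \<in> \<Lambda>"
  and Lambda_0: "0 \<in> \<Lambda>"
  using lattice by (auto intro: int_span_add int_span_diff int_span_scale int_span_0)

lemma coroot_Lambda: "\<alpha> \<in> \<Phi> \<Longrightarrow> coroot \<alpha> \<in> \<Lambda>"
  using coroot_lattice_subset unfolding coroot_lattice_def by (blast intro: int_span_base)

lemma apply_Lambda: "\<alpha> \<in> \<Phi> \<Longrightarrow> \<omega> \<in> \<Lambda> \<Longrightarrow> of_int \<lfloor>\<alpha> \<cdot> \<omega>\<rfloor> = \<alpha> \<cdot> \<omega>"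
  using integral by simp

lemma reflection_weyl: "\<alpha> \<in> \<Phi> \<Longrightarrow> reflection \<alpha> \<in> weyl_group \<Phi>"
  using weyl_step[OF weyl_id] by simp

lemma reflection_Lambda_eq: "\<alpha> \<in> \<Phi> \<Longrightarrow> \<omega> \<in> \<Lambda> \<Longrightarrow> reflection \<alpha> \<omega> = \<omega> - of_int \<lfloor>\<alpha> \<cdot> \<omega>\<rfloor> *\<^sub>R coroot \<alpha>"
  by (simp add: reflection_def apply_Lambda)

lemma n_pos: "n > 0"
  and Q_scale: "\<omega> \<in> \<Lambda> \<Longrightarrow> Q (of_int j *\<^sub>R \<omega>) = of_int (j\<^sup>2) * Q \<omega>"
  and polar_add: "\<omega> \<in> \<Lambda> \<Longrightarrow> \<mu> \<in> \<Lambda> \<Longrightarrow> \<nu> \<in> \<Lambda> \<Longrightarrow> polar_form Q \<nu> (\<omega> + \<mu>) = polar_form Q \<nu> \<omega> + polar_form Q \<nu> \<mu>"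
  and Q_weyl: "v \<in> weyl_group \<Phi> \<Longrightarrow> \<omega> \<in> \<Lambda> \<Longrightarrow> Q (v \<omega>) = Q \<omega>"
  and Q_int: "\<omega> \<in> coroot_lattice \<Phi> \<Longrightarrow> Q \<omega> \<in> \<int>"
  and Q_pos: "\<alpha> \<in> \<Phi> \<Longrightarrow> Q (coroot \<alpha>) > 0"
  using datum unfolding metaplectic_datum_def quadratic_form_on_def by blast+

lemma Q_coroot: "\<alpha> \<in> \<Phi> \<Longrightarrow> of_int (Q_coroot Q \<alpha>) = Q (coroot \<alpha>)"
  unfolding Q_coroot_def using Q_int[of "coroot \<alpha>"]
  by (simp add: coroot_lattice_def int_span_base)

lemma Q_coroot_pos: "\<alpha> \<in> \<Phi> \<Longrightarrow> Q_coroot Q \<alpha> > 0"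
  using Q_coroot[of \<alpha>] Q_pos[of \<alpha>] by (metis of_int_0_less_iff)

lemma polar_scale:
  assumes "\<nu> \<in> \<Lambda>" "\<omega> \<in> \<Lambda>" shows "polar_form Q \<nu> (of_int j *\<^sub>R \<omega>) = of_int j * polar_form Q \<nu> \<omega>"
proof (induction j rule: int_induct[where k = 0])
  case base
  show ?case using polar_add[of 0 0 \<nu>] assms by (simp add: Lambda_0)
next
  case (step1 i)
  then show ?case using polar_add[of "of_int i *\<^sub>R \<omega>" \<omega> \<nu>] assms
    by (simp add: Lambda_scale scaleR_add_left distrib_right)
next
  case (step2 i)
  then show ?case using polar_add[of "of_int (i - 1) *\<^sub>R \<omega>" \<omega> \<nu>] assms
    by (simp add: Lambda_scale scaleR_diff_left left_diff_distrib Lambda_diff)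
qed

lemma Q_add: "Q (\<omega> + \<mu>) = Q \<omega> + Q \<mu> + polar_form Q \<omega> \<mu>"
  by (simp add: polar_form_def)

text \<open>The identity \<open>B(\<omega>, \<alpha>\<^sup>\<or>) = Q(\<alpha>\<^sup>\<or>) \<alpha>(\<omega>)\<close>.  It follows from the invariance of \<open>Q\<close> under the reflection
  at \<open>\<omega>\<close> if \<open>\<alpha>(\<omega>) \<noteq> 0\<close>, and at \<open>\<omega> + \<alpha>\<^sup>\<or>\<close> otherwise.\<close>

lemma polar_coroot:
  assumes \<alpha>: "\<alpha> \<in> \<Phi>" and \<omega>: "\<omega> \<in> \<Lambda>"
  shows "polar_form Q \<omega> (coroot \<alpha>) = of_int (Q_coroot Q \<alpha> * \<lfloor>\<alpha> \<cdot> \<omega>\<rfloor>)"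
proof -
  let ?v = "coroot \<alpha>" and ?P = "polar_form Q \<omega> (coroot \<alpha>)"
  have v: "?v \<in> \<Lambda>" using \<alpha> by (rule coroot_Lambda)
  define j where "j = \<lfloor>\<alpha> \<cdot> \<omega>\<rfloor>"
  have shift: "Q (\<omega> + of_int i *\<^sub>R ?v) = Q \<omega> + of_int (i\<^sup>2) * Q ?v + of_int i * ?P" for i
    unfolding Q_add Q_scale[OF v] polar_scale[OF \<omega> v] ..
  have inv: "Q (reflection \<alpha> \<mu>) = Q \<mu>" if "\<mu> \<in> \<Lambda>" for \<mu>
    using Q_weyl[OF reflection_weyl[OF \<alpha>] that] .
  have "?P = of_int j * Q ?v"
  proof (cases "j = 0")
    case True
    then have "\<alpha> \<cdot> \<omega> = 0" using apply_Lambda[OF \<alpha> \<omega>] by (simp add: j_def)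
    then have "reflection \<alpha> (\<omega> + of_int 1 *\<^sub>R ?v) = \<omega> + of_int (-1) *\<^sub>R ?v"
      using root_nz[OF \<alpha>] by (simp add: reflection_def blinfun.add_right apply_coroot_self scaleR_2)
    moreover have "\<omega> + of_int 1 *\<^sub>R ?v \<in> \<Lambda>" using \<omega> v by (simp add: Lambda_add)
    ultimately have "Q (\<omega> + of_int 1 *\<^sub>R ?v) = Q (\<omega> + of_int (-1) *\<^sub>R ?v)" using inv by metis
    then show ?thesis unfolding shift using True by simp
  next
    case False
    have "reflection \<alpha> \<omega> = \<omega> + of_int (- j) *\<^sub>R ?v" using reflection_Lambda_eq[OF \<alpha> \<omega>] by (simp add: j_def)
    then have "Q (\<omega> + of_int (- j) *\<^sub>R ?v) = Q \<omega>" using inv[OF \<omega>] by simp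
    then have "of_int j * (of_int j * Q ?v) = of_int j * ?P" unfolding shift by (simp add: power2_eq_square)
    then show ?thesis using False by auto
  qed
  then show ?thesis using Q_coroot[OF \<alpha>] by (simp add: j_def mult.commute)
qed

lemma floor_polar_coroot:
  "\<alpha> \<in> \<Phi> \<Longrightarrow> \<omega> \<in> \<Lambda> \<Longrightarrow> \<lfloor>polar_form Q \<omega> (coroot \<alpha>)\<rfloor> = Q_coroot Q \<alpha> * \<lfloor>\<alpha> \<cdot> \<omega>\<rfloor>"
  by (simp only: polar_coroot floor_of_int)

lemma Q_coroot_sym:
  assumes "\<alpha> \<in> \<Phi>" "\<beta> \<in> \<Phi>" "\<alpha> \<cdot> (coroot \<beta>) = of_int i" "\<beta> \<cdot> (coroot \<alpha>) = of_int j"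
  shows "Q_coroot Q \<alpha> * i = Q_coroot Q \<beta> * j"
proof -
  have "polar_form Q (coroot \<beta>) (coroot \<alpha>) = polar_form Q (coroot \<alpha>) (coroot \<beta>)"
    by (simp add: polar_form_def add.commute)
  then show ?thesis
    using polar_coroot[OF assms(1) coroot_Lambda[OF assms(2)]] polar_coroot[OF assms(2) coroot_Lambda[OF assms(1)]] assms(3,4)
    by (simp del: of_int_mult)
qed

lemma Q_coroot_reflect:
  assumes "\<alpha> \<in> \<Phi>" "\<beta> \<in> \<Phi>" shows "Q_coroot Q (\<beta> - \<beta> \<cdot> (coroot \<alpha>) *\<^sub>R \<alpha>) = Q_coroot Q \<beta>"
  unfolding Q_coroot_def coroot_reflect[OF root_nz[OF assms(1)]]
  using Q_weyl[OF reflection_weyl[OF assms(1)] coroot_Lambda[OF assms(2)]] by simp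

lemma Q_coroot_minus: "\<alpha> \<in> \<Phi> \<Longrightarrow> Q_coroot Q (- \<alpha>) = Q_coroot Q \<alpha>"
  using Q_coroot_reflect[of \<alpha> \<alpha>] root_nz[of \<alpha>] by (simp add: apply_coroot_self scaleR_2)

abbreviation m :: "'e dual \<Rightarrow> int" where "m \<equiv> m_root n Q"

lemma m_reflect: "\<alpha> \<in> \<Phi> \<Longrightarrow> \<beta> \<in> \<Phi> \<Longrightarrow> m (\<beta> - \<beta> \<cdot> (coroot \<alpha>) *\<^sub>R \<alpha>) = m \<beta>"
  by (simp add: m_root_def Q_coroot_reflect)

lemma m_minus: "\<alpha> \<in> \<Phi> \<Longrightarrow> m (- \<alpha>) = m \<alpha>"
  by (simp add: m_root_def Q_coroot_minus)

lemma m_pos: "m \<alpha> > 0"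
  using n_pos by (simp add: m_root_def pos_imp_zdiv_pos_iff zdvd_imp_le)

lemma lcm_eq: "\<alpha> \<in> \<Phi> \<Longrightarrow> lcm (int n) (Q_coroot Q \<alpha>) = m \<alpha> * Q_coroot Q \<alpha>"
  using Q_coroot_pos[of \<alpha>] n_pos lcm_altdef_int[of "int n" "Q_coroot Q \<alpha>"]
  unfolding m_root_def dvd_div_mult[OF gcd_dvd1] by simp

lemma m_Q_dvd: "int n dvd m \<alpha> * Q_coroot Q \<alpha>"
  unfolding m_root_def dvd_div_mult[OF gcd_dvd1] by (simp add: div_mult_swap[symmetric])

lemma m_dvd_iff: "\<alpha> \<in> \<Phi> \<Longrightarrow> lcm (int n) (Q_coroot Q \<alpha>) dvd Q_coroot Q \<alpha> * i \<longleftrightarrow> m \<alpha> dvd i"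
  using Q_coroot_pos[of \<alpha>] by (simp add: lcm_eq mult.commute)

lemma coroot_mroot: "coroot (mroot n Q \<alpha>) = of_int (m \<alpha>) *\<^sub>R coroot \<alpha>"
  using m_pos[of \<alpha>] by (simp add: mroot_def coroot_scaleR)

subsection \<open>The metaplectic parameters\<close>

lemma h_0: "\<alpha> \<in> \<Phi> \<Longrightarrow> h 0 \<alpha> = -1"
  and h_weyl: "\<alpha> \<in> \<Phi> \<Longrightarrow> Q_coroot Q \<alpha> dvd s \<Longrightarrow> v \<in> weyl_group \<Phi> \<Longrightarrow> h (s + lcm (int n) (Q_coroot Q \<alpha>)) (dual_act v \<alpha>) = h s \<alpha>"
  and h_inverse: "\<alpha> \<in> \<Phi> \<Longrightarrow> Q_coroot Q \<alpha> dvd s \<Longrightarrow> \<not> lcm (int n) (Q_coroot Q \<alpha>) dvd s \<Longrightarrow> h s \<alpha> * h (- s) \<alpha> = inverse ((k (mroot n Q \<alpha>))\<^sup>2)"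
  using h_param unfolding metaplectic_parameters_def by blast+

lemma dual_act_id: "dual_act id \<alpha> = \<alpha>"
  by (simp add: dual_act_def inv_id[unfolded id_def] id_def blinfun_apply_inverse)

lemma h_periodic: "\<alpha> \<in> \<Phi> \<Longrightarrow> Q_coroot Q \<alpha> dvd s \<Longrightarrow> h (s + lcm (int n) (Q_coroot Q \<alpha>)) \<alpha> = h s \<alpha>"
  using h_weyl[OF _ _ weyl_id] by (simp add: dual_act_id)

lemma h_reflect:
  assumes "\<alpha> \<in> \<Phi>" "\<beta> \<in> \<Phi>" "Q_coroot Q \<beta> dvd s"
  shows "h s (\<beta> - \<beta> \<cdot> (coroot \<alpha>) *\<^sub>R \<alpha>) = h s \<beta>"
proof -
  let ?l = "lcm (int n) (Q_coroot Q \<beta>)"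
  have d: "Q_coroot Q \<beta> dvd s - ?l" using assms(3) by simp
  have "h (s - ?l + ?l) (dual_act (reflection \<alpha>) \<beta>) = h (s - ?l) \<beta>"
    by (rule h_weyl[OF assms(2) d reflection_weyl[OF assms(1)]])
  moreover have "h (s - ?l + ?l) \<beta> = h (s - ?l) \<beta>" by (rule h_periodic[OF assms(2) d])
  ultimately show ?thesis using dual_act_reflection[OF root_nz[OF assms(1)]] by simp
qed

lemma h_minus: "\<alpha> \<in> \<Phi> \<Longrightarrow> Q_coroot Q \<alpha> dvd s \<Longrightarrow> h s (- \<alpha>) = h s \<alpha>"
  using h_reflect[of \<alpha> \<alpha> s] root_nz[of \<alpha>] by (simp add: apply_coroot_self scaleR_2)

lemma h_multiple: "\<alpha> \<in> \<Phi> \<Longrightarrow> h (lcm (int n) (Q_coroot Q \<alpha>) * j) \<alpha> = -1"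
proof (induction j rule: int_induct[where k = 0])
  case base then show ?case by (simp add: h_0)
next
  case (step1 i)
  then show ?case using h_periodic[of \<alpha> "lcm (int n) (Q_coroot Q \<alpha>) * i"] by (simp add: distrib_left)
next
  case (step2 i)
  then show ?case using h_periodic[of \<alpha> "lcm (int n) (Q_coroot Q \<alpha>) * (i - 1)"] by (simp add: right_diff_distrib)
qed

text \<open>The coefficient of the reflected monomial in the image of \<open>x\<^sup>\<omega>\<close> with \<open>\<alpha>(\<omega>) = i\<close>.  It takes the same values
  at \<open>\<alpha>\<close> and \<open>- \<alpha>\<close>, which gives the opposite sign of the index of \<open>h\<close> for the affine root.\<close>

definition hecke_coeff :: "'e dual \<Rightarrow> int \<Rightarrow> 'f" where
  "hecke_coeff \<alpha> i = - k (mroot n Q \<alpha>) * h (- (Q_coroot Q \<alpha> * i)) \<alpha>"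

lemma mroot_minus: "\<alpha> \<in> \<Phi> \<Longrightarrow> mroot n Q (- \<alpha>) = - mroot n Q \<alpha>"
  by (simp add: mroot_def m_minus)

lemma mroot_mem: "\<alpha> \<in> \<Phi> \<Longrightarrow> mroot n Q \<alpha> \<in> metaplectic_roots \<Phi> n Q"
  by (simp add: metaplectic_roots_def)

lemma k_minus: "\<alpha> \<in> \<Phi> \<Longrightarrow> k (mroot n Q (- \<alpha>)) = k (mroot n Q \<alpha>)"
proof -
  assume \<alpha>: "\<alpha> \<in> \<Phi>"
  have "norm (mroot n Q (- \<alpha>)) = norm (mroot n Q \<alpha>)" by (simp add: mroot_minus[OF \<alpha>])
  then show ?thesis using k_norm mroot_mem[OF \<alpha>] mroot_mem[OF root_minus[OF \<alpha>]] by blast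
qed

lemma hecke_coeff_minus: "\<alpha> \<in> \<Phi> \<Longrightarrow> hecke_coeff (- \<alpha>) = hecke_coeff \<alpha>"
  by (rule ext) (simp add: hecke_coeff_def k_minus Q_coroot_minus h_minus)

lemma metaplectic_operator:
  assumes \<alpha>: "\<alpha> \<in> \<Phi>" and c: "c \<noteq> 0"
  shows "metaplectic_operator \<alpha> (m \<alpha>) c (k (mroot n Q \<alpha>)) (hecke_coeff \<alpha>)"
proof
  show "\<alpha> \<noteq> 0" using \<alpha> by (rule root_nz)
  show "m \<alpha> > 0" by (rule m_pos)
  show "c \<noteq> 0" by fact
  show kn: "k (mroot n Q \<alpha>) \<noteq> 0" using k_nz mroot_mem[OF \<alpha>] by blast
  show "hecke_coeff \<alpha> i = k (mroot n Q \<alpha>)" if "m \<alpha> dvd i" for i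
  proof -
    have "lcm (int n) (Q_coroot Q \<alpha>) dvd - (Q_coroot Q \<alpha> * i)" using that m_dvd_iff[OF \<alpha>] by simp
    then obtain j where "- (Q_coroot Q \<alpha> * i) = lcm (int n) (Q_coroot Q \<alpha>) * j" by (elim dvdE)
    then show ?thesis using h_multiple[OF \<alpha>] by (simp add: hecke_coeff_def)
  qed
  show "hecke_coeff \<alpha> i * hecke_coeff \<alpha> (- i) = 1" if "\<not> m \<alpha> dvd i" for i
  proof -
    have "\<not> lcm (int n) (Q_coroot Q \<alpha>) dvd Q_coroot Q \<alpha> * i" using that m_dvd_iff[OF \<alpha>] by simp
    from h_inverse[OF \<alpha> _ this] show ?thesis using kn
      by (simp add: hecke_coeff_def power2_eq_square field_simps)
  qed
  show "hecke_coeff \<alpha> (i + m \<alpha>) = hecke_coeff \<alpha> i" for i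
  proof -
    have "- (Q_coroot Q \<alpha> * (i + m \<alpha>)) + lcm (int n) (Q_coroot Q \<alpha>) = - (Q_coroot Q \<alpha> * i)"
      by (simp add: lcm_eq[OF \<alpha>] algebra_simps)
    then show ?thesis
      using h_periodic[OF \<alpha>, of "- (Q_coroot Q \<alpha> * (i + m \<alpha>))"] by (simp add: hecke_coeff_def)
  qed
qed

end


context metaplectic_daha
begin

subsection \<open>The simple affine roots\<close>

text \<open>The gradients of the simple affine roots (those of the metaplectic ones, up to positive multiples).\<close>

definition \<gamma> :: "nat \<Rightarrow> 'e dual" where "\<gamma> j = (if j = 0 then - \<theta> else a j)"

lemma gamma_root: "j \<le> r \<Longrightarrow> \<gamma> j \<in> \<Phi>"
  using simple theta_root root_minus[of \<theta>] unfolding simple_roots_def \<gamma>_def by auto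

lemma simple_coeffs:
  assumes "(\<Sum>i=1..r. f i *\<^sub>R a i) = (\<Sum>i=1..r. g i *\<^sub>R a i)" "j \<in> {1..r}"
  shows "f j = g j"
proof -
  have inj: "inj_on a {1..r}" and ind: "independent (a ` {1..r})" using simple by (auto simp: simple_roots_def)
  let ?u = "\<lambda>b. f (inv_into {1..r} a b) - g (inv_into {1..r} a b)"
  have "(\<Sum>b\<in>a ` {1..r}. ?u b *\<^sub>R b) = (\<Sum>i=1..r. (f i - g i) *\<^sub>R a i)"
    unfolding sum.reindex[OF inj] o_def by (rule sum.cong[OF refl]) (simp only: inv_into_f_f[OF inj])
  also have "\<dots> = 0" using assms(1) by (simp add: scaleR_diff_left sum_subtractf)
  finally have "?u (a j) = 0" using assms(2) by (intro independentD[OF ind _ order_refl, of ?u]) auto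
  then show ?thesis using inv_into_f_f[OF inj assms(2)] by simp
qed

lemma delta_comb: "i \<in> {1..r} \<Longrightarrow> a i = (\<Sum>l=1..r. (if l = i then 1 else 0) *\<^sub>R a l)"
  by (simp add: if_distrib[of "\<lambda>t. t *\<^sub>R _"] cong: if_cong)

lemma simple_cartan_nonpos:
  assumes ij: "i \<in> {1..r}" "j \<in> {1..r}" "i \<noteq> j"
  shows "(a i) \<cdot> (coroot (a j)) \<le> 0"
proof (rule ccontr)
  let ?c = "(a i) \<cdot> (coroot (a j))"
  assume "\<not> ?c \<le> 0"
  then have c: "?c > 0" by simp
  let ?\<beta> = "a i - ?c *\<^sub>R a j"
  have roots: "a i \<in> \<Phi>" "a j \<in> \<Phi>" using ij simple by (auto simp: simple_roots_def)
  have "?\<beta> \<in> \<Phi>" using roots by (intro root_reflect)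
  then have pm: "?\<beta> \<in> nonneg_comb r a \<or> - ?\<beta> \<in> nonneg_comb r a" using simple by (auto simp: simple_roots_def)
  let ?f = "\<lambda>l. (if l = i then 1 else 0) - ?c * (if l = j then 1 else 0)"
  have b: "?\<beta> = (\<Sum>l=1..r. ?f l *\<^sub>R a l)"
    using delta_comb[OF ij(1)] delta_comb[OF ij(2)]
    by (simp only: scaleR_diff_left sum_subtractf scaleR_scaleR[symmetric] scaleR_sum_right[symmetric])
  from pm show False
  proof
    assume "?\<beta> \<in> nonneg_comb r a"
    then obtain d :: "nat \<Rightarrow> nat" where "?\<beta> = (\<Sum>l=1..r. real (d l) *\<^sub>R a l)" by (auto simp: nonneg_comb_def)
    then have "?f j = real (d j)" using simple_coeffs[of ?f "\<lambda>l. real (d l)" j] b ij(2) by simp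
    then show False using c ij(3) by simp
  next
    assume "- ?\<beta> \<in> nonneg_comb r a"
    then obtain d :: "nat \<Rightarrow> nat" where "- ?\<beta> = (\<Sum>l=1..r. real (d l) *\<^sub>R a l)" by (auto simp: nonneg_comb_def)
    then have "?\<beta> = (\<Sum>l=1..r. (- real (d l)) *\<^sub>R a l)" by (simp add: sum_negf) (metis minus_diff_eq)
    then have "?f i = - real (d i)" using simple_coeffs[of ?f "\<lambda>l. - real (d l)" i] b ij(1) by simp
    then show False using ij(3) by simp
  qed
qed

lemma highest_cartan_nonneg:
  assumes j: "j \<in> {1..r}" shows "\<theta> \<cdot> (coroot (a j)) \<ge> 0"
proof -
  let ?c = "\<theta> \<cdot> (coroot (a j))"
  let ?\<beta> = "\<theta> - ?c *\<^sub>R a j"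
  have root: "a j \<in> \<Phi>" using j simple by (auto simp: simple_roots_def)
  have \<beta>: "?\<beta> \<in> \<Phi>" using root theta_root by (intro root_reflect)
  have "mroot n Q \<theta> - mroot n Q ?\<beta> \<in> nonneg_comb r (\<lambda>i. mroot n Q (a i))"
    using highest mroot_mem[OF \<beta>] by (simp add: highest_root_def)
  then obtain d :: "nat \<Rightarrow> nat" where d: "mroot n Q \<theta> - mroot n Q ?\<beta> = (\<Sum>l=1..r. real (d l) *\<^sub>R mroot n Q (a l))"
    by (auto simp: nonneg_comb_def)
  have "mroot n Q \<theta> - mroot n Q ?\<beta> = (?c / of_int (m \<theta>)) *\<^sub>R a j"
    by (simp add: mroot_def m_reflect[OF root theta_root] scaleR_diff_right)
  also have "\<dots> = (\<Sum>l=1..r. ((?c / of_int (m \<theta>)) * (if l = j then 1 else 0)) *\<^sub>R a l)"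
    by (subst delta_comb[OF j]) (simp only: scaleR_scaleR[symmetric] scaleR_sum_right)
  finally have "(\<Sum>l=1..r. ((?c / of_int (m \<theta>)) * (if l = j then 1 else 0)) *\<^sub>R a l)
      = (\<Sum>l=1..r. (real (d l) / of_int (m (a l))) *\<^sub>R a l)"
    unfolding d by (simp add: mroot_def)
  from simple_coeffs[OF this j] have "?c / of_int (m \<theta>) = real (d j) / of_int (m (a j))" by simp
  then have "?c / of_int (m \<theta>) \<ge> 0" using m_pos[of "a j"] by simp
  then show ?thesis using m_pos[of \<theta>] by (simp add: zero_le_divide_iff)
qed

lemma cartan_sign_sym: "\<alpha> \<cdot> (coroot \<beta>) \<le> 0 \<Longrightarrow> \<beta> \<noteq> 0 \<Longrightarrow> \<beta> \<cdot> (coroot \<alpha>) \<le> 0"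
  by (auto simp: apply_coroot inner_commute divide_le_0_iff)

lemma cartan_nonpos:
  assumes "i \<le> r" "j \<le> r" "i \<noteq> j"
  obtains x :: int where "x \<ge> 0" "(\<gamma> i) \<cdot> (coroot (\<gamma> j)) = - of_int x"
proof -
  have "(\<gamma> i) \<cdot> (coroot (\<gamma> j)) \<le> 0"
  proof -
    consider "i = 0" "j \<in> {1..r}" | "j = 0" "i \<in> {1..r}" | "i \<in> {1..r}" "j \<in> {1..r}" using assms by force
    then show ?thesis
    proof cases
      case 1 then show ?thesis using highest_cartan_nonneg[of j] by (simp add: \<gamma>_def blinfun.minus_left)
    next
      case 2
      then have "(- \<theta>) \<cdot> (coroot (a i)) \<le> 0" using highest_cartan_nonneg[of i] by (simp add: blinfun.minus_left)
      from cartan_sign_sym[OF this] show ?thesis using 2 root_nz gamma_root[OF assms(1)] by (simp add: \<gamma>_def)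
    next
      case 3 then show ?thesis using simple_cartan_nonpos[of i j] assms by (simp add: \<gamma>_def)
    qed
  qed
  moreover obtain z :: int where "(\<gamma> i) \<cdot> (coroot (\<gamma> j)) = of_int z"
    using root_int[OF gamma_root[OF assms(2)] gamma_root[OF assms(1)]] by (auto elim: Ints_cases)
  ultimately show ?thesis using that[of "- z"] by simp
qed

lemma cartan_zero_sym: "\<alpha> \<cdot> (coroot \<beta>) = 0 \<Longrightarrow> \<beta> \<noteq> 0 \<Longrightarrow> \<beta> \<cdot> (coroot \<alpha>) = 0"
  by (auto simp: apply_coroot inner_commute)

text \<open>The exceptional case of two proportional simple affine roots.\<close>

lemma cartan_product_4:
  assumes ij: "i \<le> r" "j \<le> r" "i \<noteq> j"
    and x: "(\<gamma> i) \<cdot> (coroot (\<gamma> j)) = - of_int x" "x \<ge> 0"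
    and y: "(\<gamma> j) \<cdot> (coroot (\<gamma> i)) = - of_int y"
    and p: "x * y = 4"
  shows "\<gamma> j = - \<gamma> i" "i = 0 \<or> j = 0"
proof -
  note roots = gamma_root[OF ij(1)] gamma_root[OF ij(2)]
  have "(\<gamma> i) \<cdot> (coroot (\<gamma> j)) * (\<gamma> j) \<cdot> (coroot (\<gamma> i)) = of_int (x * y)"
    by (simp add: x y)
  then have "\<exists>t. \<gamma> j = t *\<^sub>R \<gamma> i" using p by (intro cartan_product_le(2) root_nz roots) simp
  then obtain t where t: "\<gamma> j = t *\<^sub>R \<gamma> i" by blast
  then have "t = 1 \<or> t = -1" using roots root_reduced by metis
  moreover have "t \<noteq> 1"
  proof
    assume "t = 1"
    then have "(\<gamma> i) \<cdot> (coroot (\<gamma> j)) = 2" using t root_nz roots by (simp add: apply_coroot_self)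
    then show False using x by linarith
  qed
  ultimately show g: "\<gamma> j = - \<gamma> i" using t by simp
  show "i = 0 \<or> j = 0"
  proof (rule ccontr)
    assume "\<not> (i = 0 \<or> j = 0)"
    then have ij': "i \<in> {1..r}" "j \<in> {1..r}" using ij by auto
    have "a j = - a i" using g ij' by (simp add: \<gamma>_def)
    then have "(\<Sum>l=1..r. (if l = j then 1 else 0) *\<^sub>R a l) = (\<Sum>l=1..r. (- (if l = i then 1 else 0)) *\<^sub>R a l)"
      unfolding scaleR_minus_left sum_negf delta_comb[OF ij'(1), symmetric] delta_comb[OF ij'(2), symmetric] .
    from simple_coeffs[OF this ij'(2)] ij(3) show False by simp
  qed
qed

subsection \<open>The metaplectic affine Weyl group\<close>

text \<open>The translation lattice.\<close>

abbreviation L :: "'e set" where "L \<equiv> coroot_lattice (metaplectic_roots \<Phi> n Q)"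

lemma L_add: "x \<in> L \<Longrightarrow> y \<in> L \<Longrightarrow> x + y \<in> L"
  and L_diff: "x \<in> L \<Longrightarrow> y \<in> L \<Longrightarrow> x - y \<in> L"
  and L_scale: "x \<in> L \<Longrightarrow> of_int j *\<^sub>R x \<in> L"
  and L_0: "0 \<in> L"
  unfolding coroot_lattice_def by (auto intro: int_span_add int_span_diff int_span_scale int_span_0)

lemma L_coroot: "\<alpha> \<in> \<Phi> \<Longrightarrow> of_int (m \<alpha>) *\<^sub>R coroot \<alpha> \<in> L"
  unfolding coroot_lattice_def metaplectic_roots_def
  by (rule int_span_base) (auto simp flip: coroot_mroot)

lemma L_induct [consumes 1, case_names zero add scale coroot]:
  assumes "x \<in> L" "P 0" "\<And>x y. P x \<Longrightarrow> P y \<Longrightarrow> P (x + y)" "\<And>(j::int) x. P x \<Longrightarrow> P (of_int j *\<^sub>R x)"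
    "\<And>\<alpha>. \<alpha> \<in> \<Phi> \<Longrightarrow> P (of_int (m \<alpha>) *\<^sub>R coroot \<alpha>)"
  shows "P x"
  using assms(1) unfolding coroot_lattice_def
  by (induction rule: int_span_induct) (use assms in \<open>auto simp: metaplectic_roots_def coroot_mroot\<close>)

lemma L_subset_Lambda: "x \<in> L \<Longrightarrow> x \<in> \<Lambda>"
  by (induction rule: L_induct) (auto intro: Lambda_0 Lambda_add Lambda_scale coroot_Lambda)

text \<open>The metaplectic roots are integral on the metaplectic coroots.\<close>

lemma apply_L:
  assumes "\<mu> \<in> L" "\<alpha> \<in> \<Phi>" shows "\<exists>N::int. \<alpha> \<cdot> \<mu> = of_int (m \<alpha> * N)"
  using assms(1)
proof (induction rule: L_induct)
  case zero show ?case by (intro exI[of _ 0]) simp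
next
  case (add x y)
  then obtain N N' where "\<alpha> \<cdot> x = of_int (m \<alpha> * N)" "\<alpha> \<cdot> y = of_int (m \<alpha> * N')" by blast
  then show ?case by (intro exI[of _ "N + N'"]) (simp add: blinfun.add_right distrib_left)
next
  case (scale j x)
  then obtain N where "\<alpha> \<cdot> x = of_int (m \<alpha> * N)" by blast
  then show ?case by (intro exI[of _ "j * N"]) (simp add: blinfun.scaleR_right)
next
  case (coroot \<beta>)
  obtain i j :: int where ij: "\<alpha> \<cdot> (coroot \<beta>) = of_int i" "\<beta> \<cdot> (coroot \<alpha>) = of_int j"
    using root_int assms(2) coroot by (meson Ints_cases)
  from Q_coroot_sym[OF assms(2) coroot ij] have "m \<beta> * (Q_coroot Q \<alpha> * i) = m \<beta> * (Q_coroot Q \<beta> * j)" by simp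
  then have "Q_coroot Q \<alpha> * (m \<beta> * i) = m \<beta> * Q_coroot Q \<beta> * j" by (simp only: mult_ac)
  then have "int n dvd Q_coroot Q \<alpha> * (m \<beta> * i)" using m_Q_dvd[of \<beta>] by (metis dvd_mult2)
  then have "lcm (int n) (Q_coroot Q \<alpha>) dvd Q_coroot Q \<alpha> * (m \<beta> * i)" by simp
  then obtain N where "m \<beta> * i = m \<alpha> * N" using m_dvd_iff[OF assms(2)] by (auto elim: dvdE)
  then show ?case by (intro exI[of _ N]) (simp add: blinfun.scaleR_right ij flip: of_int_mult)
qed

lemma reflection_L:
  assumes "\<alpha> \<in> \<Phi>" "\<mu> \<in> L" shows "reflection \<alpha> \<mu> \<in> L"
proof -
  obtain N where "\<alpha> \<cdot> \<mu> = of_int (m \<alpha> * N)" using apply_L[OF assms(2,1)] by blast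
  then have "reflection \<alpha> \<mu> = \<mu> - of_int N *\<^sub>R (of_int (m \<alpha>) *\<^sub>R coroot \<alpha>)" by (simp add: reflection_def mult.commute)
  then show ?thesis using assms by (simp only: L_diff L_scale L_coroot)
qed

lemma weyl_comp: "u \<in> weyl_group \<Phi> \<Longrightarrow> v \<in> weyl_group \<Phi> \<Longrightarrow> u \<circ> v \<in> weyl_group \<Phi>"
  by (induction rule: weyl_group.induct) (auto simp: comp_assoc intro: weyl_step)

lemma weyl_inverse: "v \<in> weyl_group \<Phi> \<Longrightarrow> \<exists>u\<in>weyl_group \<Phi>. u \<circ> v = id"
proof (induction rule: weyl_group.induct)
  case weyl_id show ?case by (intro bexI[of _ id] weyl_group.weyl_id) simp
next
  case (weyl_step v \<alpha>)
  then obtain u where u: "u \<in> weyl_group \<Phi>" "u \<circ> v = id" by blast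
  have "reflection \<alpha> \<circ> reflection \<alpha> = id" using weyl_step root_nz by (auto simp: reflection_reflection)
  then have "(u \<circ> reflection \<alpha>) \<circ> (reflection \<alpha> \<circ> v) = id" using u(2) by (metis comp_assoc comp_id)
  then show ?case using weyl_comp[OF u(1) reflection_weyl[OF weyl_step(2)]] by blast
qed

lemma linear_weyl: "v \<in> weyl_group \<Phi> \<Longrightarrow> linear v"
proof (induction rule: weyl_group.induct)
  case (weyl_step v \<alpha>)
  from linear_compose[OF weyl_step.IH linear_reflection] show ?case .
qed (auto intro: linearI)

lemma weyl_L: "v \<in> weyl_group \<Phi> \<Longrightarrow> \<mu> \<in> L \<Longrightarrow> v \<mu> \<in> L"
  by (induction arbitrary: \<mu> rule: weyl_group.induct) (auto intro: reflection_L)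

abbreviation W where "W \<equiv> affine_weyl_group \<Phi> L"

lemma group_W: "group W"
proof (rule groupI)
  fix x assume "x \<in> carrier W"
  then obtain v \<mu> where x: "x = (v, \<mu>)" "v \<in> weyl_group \<Phi>" "\<mu> \<in> L" by (auto simp: affine_weyl_group_def)
  obtain u where u: "u \<in> weyl_group \<Phi>" "u \<circ> v = id" using weyl_inverse[OF x(2)] by blast
  have "u \<mu> \<in> L" using weyl_L u x by blast
  then have "- u \<mu> \<in> L" using L_diff[OF L_0] by fastforce
  then show "\<exists>y\<in>carrier W. y \<otimes>\<^bsub>W\<^esub> x = \<one>\<^bsub>W\<^esub>"
    using u by (intro bexI[of _ "(u, - u \<mu>)"]) (auto simp: affine_weyl_group_def x)
qed (auto simp: affine_weyl_group_def weyl_comp L_add L_0 weyl_L weyl_id comp_assoc linear_add[OF linear_weyl] linear_0[OF linear_weyl])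

lemma affine_gen_eq: "affine_gen n Q a \<theta> j = (reflection (\<gamma> j), if j = 0 then coroot (mroot n Q \<theta>) else 0)"
  by (simp add: affine_gen_def \<gamma>_def reflection_minus)

lemma affine_gen_W: "j \<le> r \<Longrightarrow> affine_gen n Q a \<theta> j \<in> carrier W"
  unfolding affine_gen_eq using L_coroot[OF theta_root]
  by (auto simp: affine_weyl_group_def reflection_weyl gamma_root L_0 coroot_mroot)

lemma fst_pow: "fst (g [^]\<^bsub>W\<^esub> (N::nat)) = fst g ^^ N"
proof -
  interpret group W by (rule group_W)
  show ?thesis
  proof (induction N)
    case 0 show ?case by (simp add: affine_weyl_group_def id_def)
  next
    case (Suc N)
    then show ?case by (simp add: affine_weyl_group_def case_prod_unfold funpow_swap1 fun_eq_iff)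
  qed
qed

lemma snd_pow: "fst g = id \<Longrightarrow> snd (g [^]\<^bsub>W\<^esub> (N::nat)) = real N *\<^sub>R snd g"
proof -
  interpret group W by (rule group_W)
  assume g: "fst g = id"
  show ?thesis
  proof (induction N)
    case 0 show ?case by (simp add: affine_weyl_group_def)
  next
    case (Suc N)
    have "fst (g [^]\<^bsub>W\<^esub> N) = id" using fst_pow[of g N] g by simp
    with Suc show ?case by (simp add: affine_weyl_group_def case_prod_unfold algebra_simps)
  qed
qed

subsection \<open>The braid relations\<close>

text \<open>The weight \<open>c\<close> of the \<open>j\<close>-th simple affine root.\<close>

definition cc :: "nat \<Rightarrow> 'f" where "cc j = (if j = 0 then q_root q \<theta> powi m \<theta> else 1)"

text \<open>The operator of the \<open>j\<close>-th generator.\<close>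

definition T :: "nat \<Rightarrow> ('e \<Rightarrow>\<^sub>0 'f) \<Rightarrow> ('e \<Rightarrow>\<^sub>0 'f)" where
  "T j = metaplectic_operator.T (\<gamma> j) (m (\<gamma> j)) (cc j) (k (mroot n Q (\<gamma> j))) (hecke_coeff (\<gamma> j))"

lemma cc_nz: "cc j \<noteq> 0"
  using q_nz by (simp add: cc_def q_root_def)

lemma operator_j: "j \<le> r \<Longrightarrow> metaplectic_operator (\<gamma> j) (m (\<gamma> j)) (cc j) (k (mroot n Q (\<gamma> j))) (hecke_coeff (\<gamma> j))"
  by (rule metaplectic_operator[OF gamma_root cc_nz])

lemma pair_ij:
  assumes "i \<le> r" "j \<le> r" "(\<gamma> i) \<cdot> (coroot (\<gamma> j)) = - of_int x" "(\<gamma> j) \<cdot> (coroot (\<gamma> i)) = - of_int y"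
    and "x * m (\<gamma> j) = x' * m (\<gamma> i)" "y * m (\<gamma> i) = y' * m (\<gamma> j)"
  shows "metaplectic_pair (\<gamma> i) (\<gamma> j) (m (\<gamma> i)) (m (\<gamma> j)) (cc i) (cc j) (k (mroot n Q (\<gamma> i))) (k (mroot n Q (\<gamma> j)))
    (hecke_coeff (\<gamma> i)) (hecke_coeff (\<gamma> j)) x y x' y'"
  using operator_j[OF assms(1)] operator_j[OF assms(2)] assms(3-)
  by (auto simp: metaplectic_pair_def metaplectic_pair_axioms_def)

text \<open>Cartan integers \<open>-1\<close> and \<open>-p\<close> for a prime \<open>p\<close>: the rank two metaplectic root system is either
  of the same type or of the dual type.\<close>

lemma braid_prime:
  assumes ij: "i \<le> r" "j \<le> r"
    and xy: "(\<gamma> i) \<cdot> (coroot (\<gamma> j)) = - 1" "(\<gamma> j) \<cdot> (coroot (\<gamma> i)) = - of_int p"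
    and p: "p = 2 \<or> p = 3"
  shows "altw (coxeter_number p) (T i) (T j) P = altw (coxeter_number p) (T j) (T i) P"
proof -
  have "Q_coroot Q (\<gamma> i) * (-1) = Q_coroot Q (\<gamma> j) * (- p)"
    by (rule Q_coroot_sym) (use ij xy gamma_root in auto)
  then have Qi: "Q_coroot Q (\<gamma> i) = p * Q_coroot Q (\<gamma> j)" by simp
  have "prime p" using p by auto
  then have "m (\<gamma> j) = m (\<gamma> i) \<or> m (\<gamma> j) = p * m (\<gamma> i)"
    using metaplectic_ratio[of "int n" "Q_coroot Q (\<gamma> j)" p] n_pos Q_coroot_pos[OF gamma_root[OF ij(2)]]
    unfolding m_root_def Qi by simp
  then show ?thesis
  proof
    assume "m (\<gamma> j) = m (\<gamma> i)"
    then interpret metaplectic_pair "\<gamma> i" "\<gamma> j" "m (\<gamma> i)" "m (\<gamma> j)" "cc i" "cc j" "k (mroot n Q (\<gamma> i))" "k (mroot n Q (\<gamma> j))"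
      "hecke_coeff (\<gamma> i)" "hecke_coeff (\<gamma> j)" 1 p 1 p
      using ij xy by (intro pair_ij) auto
    from p show ?thesis unfolding T_def using braid_4 braid_6 by (auto simp: coxeter_number_def)
  next
    assume "m (\<gamma> j) = p * m (\<gamma> i)"
    then interpret metaplectic_pair "\<gamma> j" "\<gamma> i" "m (\<gamma> j)" "m (\<gamma> i)" "cc j" "cc i" "k (mroot n Q (\<gamma> j))" "k (mroot n Q (\<gamma> i))"
      "hecke_coeff (\<gamma> j)" "hecke_coeff (\<gamma> i)" p 1 1 p
      using ij xy by (intro pair_ij) auto
    from p show ?thesis unfolding T_def using braid_4[symmetric] braid_6[symmetric] by (auto simp: coxeter_number_def)
  qed
qed

lemma braid_simply_laced:
  assumes ij: "i \<le> r" "j \<le> r"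
    and xy: "(\<gamma> i) \<cdot> (coroot (\<gamma> j)) = - 1" "(\<gamma> j) \<cdot> (coroot (\<gamma> i)) = - 1"
  shows "altw 3 (T i) (T j) P = altw 3 (T j) (T i) P"
proof -
  note roots = gamma_root[OF ij(1)] gamma_root[OF ij(2)]
  have "Q_coroot Q (\<gamma> i) * (-1) = Q_coroot Q (\<gamma> j) * (- 1)"
    by (rule Q_coroot_sym) (use roots xy in auto)
  then have Qi: "Q_coroot Q (\<gamma> i) = Q_coroot Q (\<gamma> j)" by simp
  then have mi: "m (\<gamma> i) = m (\<gamma> j)" by (simp add: m_root_def)
  \<comment> \<open>the two roots are conjugate, through the root \<open>\<gamma> i + \<gamma> j\<close>\<close>
  have s1: "\<gamma> i - (\<gamma> i) \<cdot> (coroot (\<gamma> j)) *\<^sub>R \<gamma> j = \<gamma> i + \<gamma> j" using xy by simp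
  have s2: "(\<gamma> i + \<gamma> j) - (\<gamma> i + \<gamma> j) \<cdot> (coroot (\<gamma> i)) *\<^sub>R \<gamma> i = \<gamma> j"
    using xy root_nz roots by (simp add: blinfun.add_left apply_coroot_self)
  have sum: "\<gamma> i + \<gamma> j \<in> \<Phi>" "Q_coroot Q (\<gamma> i + \<gamma> j) = Q_coroot Q (\<gamma> i)" "norm (\<gamma> i + \<gamma> j) = norm (\<gamma> i)"
    using root_reflect[OF roots(2,1)] Q_coroot_reflect[OF roots(2,1)] norm_reflect[OF root_nz[OF roots(2)], of "\<gamma> i"] unfolding s1 by auto
  have norm: "norm (\<gamma> j) = norm (\<gamma> i)"
    using norm_reflect[OF root_nz[OF roots(1)], of "\<gamma> i + \<gamma> j"] unfolding s2 sum(3) by simp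
  have h: "h s (\<gamma> j) = h s (\<gamma> i)" if "Q_coroot Q (\<gamma> i) dvd s" for s
    using h_reflect[OF roots(2,1) that] h_reflect[OF roots(1) sum(1), of s] that unfolding s1 s2 sum(2) by simp
  have "norm (mroot n Q (\<gamma> i)) = norm (mroot n Q (\<gamma> j))" by (simp add: mroot_def mi norm)
  then have k: "k (mroot n Q (\<gamma> i)) = k (mroot n Q (\<gamma> j))" using k_norm roots mroot_mem by blast
  have F: "hecke_coeff (\<gamma> i) = hecke_coeff (\<gamma> j)" by (rule ext) (simp add: hecke_coeff_def k h Qi)
  interpret metaplectic_pair "\<gamma> i" "\<gamma> j" "m (\<gamma> i)" "m (\<gamma> j)" "cc i" "cc j" "k (mroot n Q (\<gamma> i))" "k (mroot n Q (\<gamma> j))"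
      "hecke_coeff (\<gamma> i)" "hecke_coeff (\<gamma> j)" 1 1 1 1
    using ij xy mi by (intro pair_ij) auto
  have "A.\<kappa> = B.\<kappa>" by (simp add: A.\<kappa>_def B.\<kappa>_def k)
  moreover have "A.\<phi> = B.\<phi>" by (rule ext) (simp add: A.\<phi>_def B.\<phi>_def k F mi)
  ultimately show ?thesis unfolding T_def by (rule braid_3[OF refl refl refl refl])
qed

theorem braid_relation:
  assumes ij: "i \<le> r" "j \<le> r" "i \<noteq> j"
    and l: "l = group.ord W (affine_gen n Q a \<theta> i \<otimes>\<^bsub>W\<^esub> affine_gen n Q a \<theta> j)" "l > 0"
  shows "altw l (T i) (T j) P = altw l (T j) (T i) P"
proof -
  interpret W: group W by (rule group_W)
  let ?g = "affine_gen n Q a \<theta> i \<otimes>\<^bsub>W\<^esub> affine_gen n Q a \<theta> j"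
  have g: "?g \<in> carrier W" using affine_gen_W ij by simp
  have fst_g: "fst ?g = reflection (\<gamma> i) \<circ> reflection (\<gamma> j)"
    by (simp add: affine_gen_eq affine_weyl_group_def)
  have gl: "?g [^]\<^bsub>W\<^esub> l = \<one>\<^bsub>W\<^esub>" unfolding l(1) using g by simp
  note roots = gamma_root[OF ij(1)] gamma_root[OF ij(2)]
  obtain x where x: "x \<ge> 0" "(\<gamma> i) \<cdot> (coroot (\<gamma> j)) = - of_int x" using cartan_nonpos[OF ij] .
  obtain y where y: "y \<ge> 0" "(\<gamma> j) \<cdot> (coroot (\<gamma> i)) = - of_int y" using cartan_nonpos[OF ij(2,1)] ij(3) by metis
  have "real_of_int (x * y) \<le> 4" using cartan_product_le(1)[of "\<gamma> i" "\<gamma> j"] roots root_nz x y by simp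
  then have "x * y \<le> 4" by linarith
  moreover have "x * y \<noteq> 4"
  proof
    \<comment> \<open>otherwise the product of the two generators is a nontrivial translation\<close>
    assume p4: "x * y = 4"
    note c4 = cartan_product_4[OF ij x(2,1) y(2) p4]
    have id: "fst ?g = id" unfolding fst_g c4(1) reflection_minus using root_nz[OF roots(1)] by (auto simp: reflection_reflection)
    have nz: "coroot (mroot n Q \<theta>) \<noteq> 0"
      using apply_coroot_self[OF root_nz[OF theta_root]] m_pos[of \<theta>] by (auto simp: coroot_mroot blinfun.zero_right)
    have refl: "linear (reflection (\<gamma> i))" "reflection (\<gamma> i) z = 0 \<Longrightarrow> z = 0" for z
      using linear_reflection reflection_reflection[OF root_nz[OF roots(1)], of z] linear_0[OF linear_reflection, of "\<gamma> i"] by auto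
    have "snd ?g \<noteq> 0"
      using c4(2) ij(3) nz refl(2) linear_0[OF refl(1)] by (auto simp: affine_gen_eq affine_weyl_group_def)
    moreover have "real l *\<^sub>R snd ?g = 0" using snd_pow[OF id, of l] gl by (simp add: affine_weyl_group_def)
    ultimately show False using l(2) by simp
  qed
  ultimately have p: "0 \<le> x * y" "x * y \<le> 3" using x(1) y(1) by auto
  have "(reflection (\<gamma> i) \<circ> reflection (\<gamma> j)) ^^ l = id"
    using fst_pow[of ?g l] gl unfolding fst_g by (simp add: affine_weyl_group_def)
  from rotation_order[OF root_nz[OF roots(1)] root_nz[OF roots(2)] x(2) y(2) p this]
  have dvd: "coxeter_number (x * y) dvd l" .
  have xy0: "x = 0 \<longleftrightarrow> y = 0"
    using x y cartan_zero_sym[of "\<gamma> i" "\<gamma> j"] cartan_zero_sym[of "\<gamma> j" "\<gamma> i"] roots root_nz by auto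
  have "altw (coxeter_number (x * y)) (T i) (T j) P = altw (coxeter_number (x * y)) (T j) (T i) P" for P
  proof (cases "x = 0")
    case True
    then interpret metaplectic_pair "\<gamma> i" "\<gamma> j" "m (\<gamma> i)" "m (\<gamma> j)" "cc i" "cc j" "k (mroot n Q (\<gamma> i))" "k (mroot n Q (\<gamma> j))"
      "hecke_coeff (\<gamma> i)" "hecke_coeff (\<gamma> j)" 0 0 0 0
      using ij x y xy0 by (intro pair_ij) auto
    show ?thesis using True braid_2 by (simp add: T_def coxeter_number_def)
  next
    case False
    then have pos: "x \<ge> 1" "y \<ge> 1" using x(1) y(1) xy0 by auto
    have "x \<le> x * y" "y \<le> x * y" using pos mult_left_mono[of 1 y x] mult_right_mono[of 1 x y] by auto
    then have "x = 1 \<or> x = 2 \<or> x = 3" "y = 1 \<or> y = 2 \<or> y = 3" using p pos by linarith+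
    then have "x = 1 \<and> y = 1 \<or> x = 1 \<and> (y = 2 \<or> y = 3) \<or> y = 1 \<and> (x = 2 \<or> x = 3)"
      using p by auto
    then show ?thesis
    proof (elim disjE conjE)
      assume "x = 1" "y = 1"
      then show ?thesis using braid_simply_laced[OF ij(1,2)] x y by (simp add: coxeter_number_def)
    qed (use braid_prime[OF ij(1,2), of y P] braid_prime[OF ij(2,1), of x P] x y in \<open>simp_all\<close>)
  qed
  then show ?thesis by (rule altw_dvd[OF _ dvd])
qed

end


context metaplectic_daha
begin

subsection \<open>Integrality of the exponents of \<open>q\<close>\<close>

text \<open>Two nonorthogonal roots: the squared length of the longer one is an integral multiple of the other.\<close>

lemma norm_ratio_int:
  assumes \<alpha>: "\<alpha> \<in> \<Phi>" and \<beta>: "\<beta> \<in> \<Phi>" and le: "norm \<beta> \<le> norm \<alpha>" and nz: "riesz \<alpha> \<bullet> riesz \<beta> \<noteq> 0"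
  shows "(norm \<alpha>)\<^sup>2 / (norm \<beta>)\<^sup>2 \<in> \<int>"
proof -
  have pos: "norm \<alpha> > 0" "norm \<beta> > 0" using root_nz \<alpha> \<beta> by auto
  obtain i j :: int where i: "\<alpha> \<cdot> (coroot \<beta>) = of_int i" and j: "\<beta> \<cdot> (coroot \<alpha>) = of_int j"
    using root_int \<alpha> \<beta> by (meson Ints_cases)
  have eq: "of_int i * (norm \<beta>)\<^sup>2 = of_int j * (norm \<alpha>)\<^sup>2" "of_int j \<noteq> (0::real)"
    using pos nz unfolding i[symmetric] j[symmetric] apply_coroot by (simp_all add: inner_commute)
  then have ratio: "(norm \<alpha>)\<^sup>2 / (norm \<beta>)\<^sup>2 = of_int i / of_int j" using pos by (simp add: field_simps)
  have "(norm \<alpha>)\<^sup>2 / (norm \<beta>)\<^sup>2 \<ge> 1" using le pos by (simp add: power_mono)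
  then have ge: "of_int i / of_int j \<ge> (1::real)" unfolding ratio .
  have "real_of_int (i * j) \<le> 4" using cartan_product_le(1)[OF root_nz[OF \<alpha>] root_nz[OF \<beta>]] by (simp add: i j)
  then have ij: "i * j \<le> 4" by linarith
  have "\<bar>j\<bar> \<le> \<bar>i\<bar> \<and> i * j > 0"
    using ge eq(2) by (cases "j > 0") (auto simp: le_divide_eq mult_pos_pos mult_neg_neg split: if_splits)
  then have *: "\<bar>j\<bar> \<le> \<bar>i\<bar>" "i * j > 0" by auto
  have "\<bar>j\<bar> * \<bar>j\<bar> \<le> \<bar>j\<bar> * \<bar>i\<bar>" using *(1) by (intro mult_left_mono) auto
  also have "\<dots> = i * j" using *(2) by (simp add: abs_mult[symmetric] mult.commute)
  finally have jj: "\<bar>j\<bar> * \<bar>j\<bar> \<le> 4" using ij by simp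
  have "\<bar>j\<bar> \<le> 2"
  proof (rule ccontr)
    assume "\<not> \<bar>j\<bar> \<le> 2"
    then have "3 * 3 \<le> \<bar>j\<bar> * \<bar>j\<bar>" by (intro mult_mono) auto
    then show False using jj by simp
  qed
  moreover have "\<bar>i\<bar> \<le> 2" if "\<bar>j\<bar> = 2"
    using \<open>\<bar>j\<bar> * \<bar>i\<bar> = i * j\<close> ij that by simp
  moreover have "\<bar>j\<bar> \<noteq> 0" using eq(2) by simp
  ultimately have "\<bar>j\<bar> = 1 \<or> \<bar>i\<bar> = \<bar>j\<bar>" using *(1) by linarith
  then have "j = 1 \<or> j = -1 \<or> i = j \<or> i = - j" by linarith
  then have "j dvd i" by auto
  then show ?thesis unfolding ratio by (auto elim: dvdE)
qed

lemma q_exponent_int: "2 / (norm \<theta>)\<^sup>2 \<in> \<int>"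
proof -
  have fin: "finite ((\<lambda>\<alpha>. (norm \<alpha>)\<^sup>2) ` \<Phi>)" using root_system by (simp add: reduced_root_system_def)
  have "Max ((\<lambda>\<alpha>. (norm \<alpha>)\<^sup>2) ` \<Phi>) \<in> (\<lambda>\<alpha>. (norm \<alpha>)\<^sup>2) ` \<Phi>" using fin theta_root by (intro Max_in) auto
  then obtain \<alpha> where \<alpha>: "\<alpha> \<in> \<Phi>" "(norm \<alpha>)\<^sup>2 = 2 / (real M)\<^sup>2" using long_roots by auto
  have max: "norm \<beta> \<le> norm \<alpha>" if "\<beta> \<in> \<Phi>" for \<beta>
  proof -
    have "(norm \<beta>)\<^sup>2 \<le> (norm \<alpha>)\<^sup>2" using Max_ge[OF fin] that \<alpha> long_roots by auto
    then show ?thesis by (rule power2_le_imp_le) simp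
  qed
  \<comment> \<open>by irreducibility some long root is not orthogonal to \<open>\<theta>\<close>\<close>
  let ?A = "{\<beta> \<in> \<Phi>. \<exists>\<gamma>\<in>\<Phi>. norm \<gamma> = norm \<alpha> \<and> riesz \<beta> \<bullet> riesz \<gamma> \<noteq> 0}"
  have orth: "riesz \<beta> \<bullet> riesz \<delta> = 0" if \<beta>: "\<beta> \<in> ?A" and \<delta>: "\<delta> \<in> \<Phi> - ?A" for \<beta> \<delta>
  proof -
    obtain \<gamma> where \<gamma>: "\<gamma> \<in> \<Phi>" "norm \<gamma> = norm \<alpha>" "riesz \<beta> \<bullet> riesz \<gamma> \<noteq> 0" using \<beta> by blast
    let ?c = "\<gamma> \<cdot> (coroot \<beta>)"
    have b: "\<beta> \<in> \<Phi>" using \<beta> by blast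
    have s: "\<gamma> - ?c *\<^sub>R \<beta> \<in> \<Phi>" "norm (\<gamma> - ?c *\<^sub>R \<beta>) = norm \<alpha>"
      using root_reflect[OF b \<gamma>(1)] norm_reflect[OF root_nz[OF b]] \<gamma>(2) by auto
    have "?c \<noteq> 0" using \<gamma>(3) root_nz[OF b] by (simp add: apply_coroot)
    moreover have "riesz \<delta> \<bullet> riesz \<gamma> = 0" "riesz \<delta> \<bullet> riesz (\<gamma> - ?c *\<^sub>R \<beta>) = 0" using \<delta> \<gamma> s by auto
    ultimately have "riesz \<delta> \<bullet> riesz \<beta> = 0" by (simp add: riesz_diff riesz_scaleR inner_diff_right)
    then show ?thesis by (simp add: inner_commute)
  qed
  have "riesz \<alpha> \<bullet> riesz \<alpha> \<noteq> 0" using root_nz[OF \<alpha>(1)] norm_riesz[of \<alpha>] by (simp add: dot_square_norm)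
  then have "?A \<noteq> {}" using \<alpha>(1) by blast
  then have "\<Phi> - ?A = {}"
    using irreducible orth unfolding irreducible_root_system_def
    by (metis (no_types, lifting) Diff_disjoint Diff_partition mem_Collect_eq subsetI)
  then obtain \<gamma> where \<gamma>: "\<gamma> \<in> \<Phi>" "norm \<gamma> = norm \<alpha>" "riesz \<theta> \<bullet> riesz \<gamma> \<noteq> 0" using theta_root by blast
  have "(norm \<gamma>)\<^sup>2 / (norm \<theta>)\<^sup>2 \<in> \<int>"
    using norm_ratio_int[OF \<gamma>(1) theta_root] max[OF theta_root] \<gamma> by (simp add: inner_commute)
  then have "of_nat (M\<^sup>2) * ((norm \<alpha>)\<^sup>2 / (norm \<theta>)\<^sup>2) \<in> \<int>" unfolding \<gamma>(2) by (intro Ints_mult) auto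
  moreover have "of_nat (M\<^sup>2) * ((norm \<alpha>)\<^sup>2 / (norm \<theta>)\<^sup>2) = 2 / (norm \<theta>)\<^sup>2"
    unfolding \<alpha>(2) using M_pos by simp
  ultimately show ?thesis by (simp only:)
qed

subsection \<open>The operators of the generators\<close>

text \<open>The space of the representation.\<close>

definition V :: "('e \<Rightarrow>\<^sub>0 'f) set" where "V = group_algebra \<Lambda>"

lemma V_add: "p \<in> V \<Longrightarrow> p' \<in> V \<Longrightarrow> p + p' \<in> V"
  unfolding V_def group_algebra_def using keys_add[of p p'] by blast

lemma V_0: "0 \<in> V"
  by (simp add: V_def group_algebra_def)

lemma V_single: "\<omega> \<in> \<Lambda> \<Longrightarrow> single \<omega> c \<in> V"
  by (simp add: V_def group_algebra_def)

lemma V_mult: "keys u \<subseteq> \<Lambda> \<Longrightarrow> p \<in> V \<Longrightarrow> u * p \<in> V"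
  unfolding V_def group_algebra_def using keys_mult[of u p] by (fastforce intro: Lambda_add)

lemma V_cst: "p \<in> V \<Longrightarrow> cst c * p \<in> V"
  by (rule V_mult) (auto simp: Lambda_0)

lemma V_induct [consumes 1, case_names zero single add]:
  assumes "p \<in> V" "P 0" "\<And>\<omega> c. \<omega> \<in> \<Lambda> \<Longrightarrow> P (single \<omega> c)" "\<And>u v. P u \<Longrightarrow> P v \<Longrightarrow> P (u + v)"
  shows "P p"
  using poly_mapping_monomial_induct[of P p] assms by (auto simp: V_def group_algebra_def)

lemma linear_on_V_eq:
  assumes f: "linear_on V f" and S: "linop S" and eq: "\<And>\<omega>. \<omega> \<in> \<Lambda> \<Longrightarrow> f (xpow \<omega>) = S (xpow \<omega>)"
    and p: "p \<in> V"
  shows "f p = S p"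
proof -
  have "p \<in> V \<and> f p = S p" using p
  proof (induction rule: V_induct)
    case zero
    have "f (scale 0 0) = scale 0 (f 0)" using f V_0 unfolding linear_on_def by blast
    then show ?case by (simp add: V_0 linop_0[OF S] scale_eq_cst_mult)
  next
    case (single \<omega> c)
    have "f (scale c (xpow \<omega>)) = scale c (f (xpow \<omega>))" using f V_single[OF single] unfolding linear_on_def by blast
    also have "\<dots> = S (cst c * xpow \<omega>)" unfolding eq[OF single] scale_eq_cst_mult linop_cst[OF S] ..
    finally show ?case by (simp add: V_single[OF single] mult_single)
  next
    case (add u v)
    then have "f (u + v) = f u + f v" using f by (auto simp: linear_on_def)
    with add show ?case by (simp add: V_add linop_add[OF S])
  qed
  then show ?thesis ..
qed

text \<open>The monomial \<open>s\<^sub>j x\<^sup>\<mu>\<close>, the quotient in the cross relation and the Hecke parameters.\<close>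

abbreviation sx :: "nat \<Rightarrow> 'e \<Rightarrow> ('e \<Rightarrow>\<^sub>0 'f)" where
  "sx j \<mu> \<equiv> affine_act_mono q (affine_gen n Q a \<theta> j) \<mu>"
abbreviation sq :: "nat \<Rightarrow> 'e \<Rightarrow> ('e \<Rightarrow>\<^sub>0 'f)" where
  "sq j \<mu> \<equiv> exact_quotient (xpow \<mu> - sx j \<mu>) (1 - affine_coroot_mono q n Q a \<theta> j)"
abbreviation kk :: "nat \<Rightarrow> 'f" where "kk j \<equiv> k (mroot n Q (\<gamma> j))"

context
  fixes j assumes j: "j \<le> r"
begin

interpretation O: metaplectic_operator "\<gamma> j" "m (\<gamma> j)" "cc j" "kk j" "hecke_coeff (\<gamma> j)"
  by (rule operator_j[OF j])

lemma linop_T: "linop (T j)"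
  unfolding T_def by (rule O.linop_T)

lemma T_xpow:
  assumes \<omega>: "\<omega> \<in> \<Lambda>" and i: "i = \<lfloor>(\<gamma> j) \<cdot> \<omega>\<rfloor>"
  shows "T j (xpow \<omega>) = cst (hecke_coeff (\<gamma> j) i * cc j powi (- i)) * xpow (reflection (\<gamma> j) \<omega>)
    + cst (kk j - inverse (kk j))
      * (exact_quotient (1 - mono_power (cc j) (coroot (\<gamma> j)) (i mod m (\<gamma> j) - i))
          (1 - mono_power (cc j) (coroot (\<gamma> j)) (m (\<gamma> j))) * xpow \<omega>)"
proof -
  have "i mod m (\<gamma> j) - i = m (\<gamma> j) * (- (i div m (\<gamma> j)))"
    unfolding mult_minus_right using mult_div_mod_eq[of "m (\<gamma> j)" i] by linarith
  then have G: "exact_quotient (1 - mono_power (cc j) (coroot (\<gamma> j)) (i mod m (\<gamma> j) - i))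
          (1 - mono_power (cc j) (coroot (\<gamma> j)) (m (\<gamma> j))) = O.G (- (i div m (\<gamma> j)))"
    using exact_quotient_geom[OF O.coroot_nz O.c_nz, of "m (\<gamma> j)" 1 "- (i div m (\<gamma> j))"] O.m_pos by (simp add: O.G_def)
  have "reflection (\<gamma> j) \<omega> = \<omega> + of_int (- i) *\<^sub>R coroot (\<gamma> j)"
    using reflection_Lambda_eq[OF gamma_root[OF j] \<omega>] by (simp add: i)
  then have Z: "O.Z (- i) * xpow \<omega> = cst (cc j powi (- i)) * xpow (reflection (\<gamma> j) \<omega>)"
    by (simp add: O.Z_eq_single mult_single add.commute)
  have "T j (xpow \<omega>) = cst (hecke_coeff (\<gamma> j) i) * (O.Z (- i) * xpow \<omega>) + cst O.\<kappa> * (O.G (- (i div m (\<gamma> j))) * xpow \<omega>)"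
    unfolding T_def O.T_single i[symmetric] O.tau_def by (simp add: distrib_right mult.assoc)
  then show ?thesis unfolding Z G O.\<kappa>_def by (simp add: cst_mult mult.assoc)
qed

lemma T_V: "p \<in> V \<Longrightarrow> T j p \<in> V"
proof (induction rule: V_induct)
  case zero show ?case by (simp add: linop_0[OF linop_T] V_0)
next
  case (single \<omega> c)
  have "keys (O.tau i) \<subseteq> \<Lambda>" for i
    using O.keys_tau[of i] Lambda_scale[OF coroot_Lambda[OF gamma_root[OF j]]] by blast
  then show ?case unfolding T_def O.T_single by (intro V_mult V_single single)
next
  case (add u v) then show ?case by (simp add: linop_add[OF linop_T] V_add)
qed

lemma T_quadratic:
  "T j (T j p) = cst (kk j - inverse (kk j)) * T j p + p"
  unfolding T_def using O.quadratic[of p] by (simp add: O.\<kappa>_def)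

lemma kk_nz: "kk j \<noteq> 0"
  by (rule O.k_nz)

lemma affine_coroot_mono_eq:
  "affine_coroot_mono q n Q a \<theta> j = mono_power (cc j) (coroot (\<gamma> j)) (m (\<gamma> j))"
  by (auto simp: affine_coroot_mono_def \<gamma>_def cc_def m_minus[OF theta_root] coroot_minus coroot_mroot mono_power_def)

lemma affine_act_mono_eq:
  assumes \<mu>: "\<mu> \<in> L" and N: "(\<gamma> j) \<cdot> \<mu> = of_int (m (\<gamma> j) * N)"
  shows "sx j \<mu> = O.Z (- (m (\<gamma> j) * N)) * xpow \<mu>"
proof -
  have refl: "reflection (\<gamma> j) \<mu> = \<mu> + of_int (- (m (\<gamma> j) * N)) *\<^sub>R coroot (\<gamma> j)"
    by (simp add: reflection_def N)
  have "q powi (- \<lfloor>snd (affine_gen n Q a \<theta> j) \<bullet> reflection (\<gamma> j) \<mu>\<rfloor>) = cc j powi (- (m (\<gamma> j) * N))"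
  proof (cases "j = 0")
    case False then show ?thesis by (simp add: affine_gen_eq cc_def)
  next
    case True
    obtain D :: int where D: "2 / (norm \<theta>)\<^sup>2 = of_int D" using q_exponent_int by (auto elim: Ints_cases)
    have g: "\<gamma> j = - \<theta>" "m (\<gamma> j) = m \<theta>" using True m_minus[OF theta_root] by (auto simp: \<gamma>_def)
    have \<theta>\<mu>: "\<theta> \<cdot> \<mu> = - of_int (m \<theta> * N)"
      using N unfolding g(2) unfolding g(1) blinfun.minus_left by linarith
    have "\<theta> \<cdot> (reflection (\<gamma> j) \<mu>) = of_int (m \<theta> * N)"
      using root_nz[OF theta_root] by (simp add: g reflection_minus reflection_def blinfun_right apply_coroot_self \<theta>\<mu>)
    then have "reflection (\<gamma> j) \<mu> \<bullet> coroot \<theta> = of_int (m \<theta> * N) * of_int D"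
      by (simp add: inner_coroot flip: D)
    then have "snd (affine_gen n Q a \<theta> j) \<bullet> reflection (\<gamma> j) \<mu> = of_int (D * m \<theta> * (m \<theta> * N))"
      using True by (simp add: affine_gen_eq coroot_mroot inner_commute)
    then have "q powi (- \<lfloor>snd (affine_gen n Q a \<theta> j) \<bullet> reflection (\<gamma> j) \<mu>\<rfloor>) = q powi (D * m \<theta> * (- (m \<theta> * N)))"
      by (simp only: floor_of_int mult_minus_right)
    also have "\<dots> = ((q powi D) powi m \<theta>) powi (- (m \<theta> * N))" by (simp only: power_int_mult)
    also have "\<dots> = cc j powi (- (m (\<gamma> j) * N))" using True unfolding cc_def q_root_def D g(2) by simp
    finally show ?thesis .
  qed
  then show ?thesis unfolding affine_act_mono_def
    by (simp add: affine_gen_eq refl O.Z_eq_single mult_single add.commute del: of_int_minus of_int_mult)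
qed

lemma cross_relation:
  assumes \<mu>: "\<mu> \<in> L"
  shows "T j (xpow \<mu> * p) = sx j \<mu> * T j p
    + cst (kk j - inverse (kk j))
      * (sq j \<mu> * p)"
    "keys (sx j \<mu>) \<subseteq> L"
    "keys (sq j \<mu>) \<subseteq> L"
proof -
  obtain N where N: "(\<gamma> j) \<cdot> \<mu> = of_int (m (\<gamma> j) * N)" using apply_L[OF \<mu> gamma_root[OF j]] by blast
  note act = affine_act_mono_eq[OF \<mu> N]
  have "xpow \<mu> - O.Z (- (m (\<gamma> j) * N)) * xpow \<mu> = xpow \<mu> * (1 - mono_power (cc j) (coroot (\<gamma> j)) (m (\<gamma> j) * - N))"
    by (simp add: O.Z_def right_diff_distrib mult.commute)
  then have quot: "sq j \<mu>
      = xpow \<mu> * O.G (- N)"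
    unfolding act affine_coroot_mono_eq O.G_def
    using exact_quotient_geom[OF O.coroot_nz O.c_nz, of "m (\<gamma> j)" "xpow \<mu>" "- N"] O.m_pos by simp
  show "T j (xpow \<mu> * p) = sx j \<mu> * T j p
    + cst (kk j - inverse (kk j))
      * (sq j \<mu> * p)"
    unfolding quot unfolding act T_def O.cross[OF N] O.\<kappa>_def by (simp add: mult.assoc mult.left_commute)
  show "keys (sx j \<mu>) \<subseteq> L"
    using reflection_L[OF gamma_root[OF j] \<mu>] by (simp add: affine_act_mono_def affine_gen_eq)
  have "keys (O.G (- N)) \<subseteq> L"
  proof
    fix w assume "w \<in> keys (O.G (- N))"
    then obtain i :: int where "w = of_int (m (\<gamma> j) * i) *\<^sub>R coroot (\<gamma> j)"
      unfolding O.G_def using keys_geom[of "cc j" "coroot (\<gamma> j)" "m (\<gamma> j)" "- N"] by blast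
    then show "w \<in> L" using L_scale[OF L_coroot[OF gamma_root[OF j]], of i] by (simp add: mult.commute)
  qed
  then show "keys (sq j \<mu>) \<subseteq> L"
    unfolding quot using keys_mult[of "xpow \<mu>" "O.G (- N)"] \<mu> by (fastforce intro: L_add)
qed

end

subsection \<open>The relations of the double affine Hecke algebra\<close>

text \<open>The operators of the generators; the letters \<open>HT j\<close> with \<open>j > r\<close> are not generators.\<close>

definition act :: "'e daha_letter \<Rightarrow> ('e \<Rightarrow>\<^sub>0 'f) \<Rightarrow> ('e \<Rightarrow>\<^sub>0 'f)" where
  "act g = (case g of HT j \<Rightarrow> if j \<le> r then T j else id | HX \<mu> \<Rightarrow> (\<lambda>p. xpow \<mu> * p))"

abbreviation "letters \<equiv> daha_letters \<Phi> r n Q"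
abbreviation "rels \<equiv> daha_relations \<Phi> r a \<theta> n Q q k"

lemma act_HT: "j \<le> r \<Longrightarrow> act (HT j) = T j" and act_HX: "act (HX \<mu>) = (\<lambda>p. xpow \<mu> * p)"
  by (simp_all add: act_def)

lemma daha_param_eq: "daha_param n Q k a \<theta> j = kk j"
  using k_minus[OF theta_root] by (simp add: daha_param_def \<gamma>_def)

lemma HT_letter: "j \<le> r \<Longrightarrow> HT j \<in> letters" and HX_letter: "\<mu> \<in> L \<Longrightarrow> HX \<mu> \<in> letters"
  by (auto simp: daha_letters_def)

lemma free_X_closed:
  fixes p :: "'e \<Rightarrow>\<^sub>0 'f"
  shows "keys p \<subseteq> L \<Longrightarrow> free_X p \<in> carrier (free_algebra letters)"
proof -
  assume p: "keys p \<subseteq> L"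
  have "(\<Sum>\<nu>\<in>S. single [HX \<nu>] (f \<nu>)) \<in> carrier (free_algebra letters)" if "finite S" "S \<subseteq> L" for S and f :: "'e \<Rightarrow> 'f"
    using that
  proof (induction rule: finite_induct)
    case (insert \<nu> S)
    have "single [HX \<nu>] (f \<nu>) \<in> carrier (free_algebra letters)"
      using insert.prems HX_letter by (intro free_algebra_single) auto
    then show ?case using insert by (simp add: free_algebra_add_closed del: free_algebra_simps)
  qed simp
  from this[OF finite_keys p] show ?thesis unfolding free_X_def .
qed

lemma braid_word_closed: "i \<le> r \<Longrightarrow> j \<le> r \<Longrightarrow> braid_word l i j \<in> carrier (free_algebra letters)"
  unfolding braid_word_def by (rule free_algebra_single) (auto simp: HT_letter)

lemma relations_closed: "rels \<subseteq> carrier (free_algebra letters)"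
proof -
  have T: "free_T j \<in> carrier (free_algebra letters)" if "j \<le> r" for j
    using that HT_letter by (intro free_algebra_single) auto
  have s: "free_scalar c \<in> carrier (free_algebra letters)" for c
    by (rule free_algebra_single) simp
  show ?thesis
    unfolding daha_relations_def Let_def
    by (intro Un_least subsetI; elim CollectE exE conjE singletonE; hypsubst?)
      (auto simp del: free_algebra_simps simp: L_add L_0 dest: subsetD[OF cross_relation(2)] subsetD[OF cross_relation(3)]
        intro!: free_algebra_diff_closed free_algebra_add_closed free_algebra_mult_closed T s free_X_closed braid_word_closed
          free_algebra_one_closed)
qed

sublocale generator_action act V letters rels
proof
  fix g p
  show "linop (act g)"
  proof (cases g)
    case (HT j) then show ?thesis by (cases "j \<le> r") (simp_all add: act_def linop_T, simp add: linop_def)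
  next
    case (HX \<mu>) then show ?thesis by (simp add: act_def linop_mult_left)
  qed
  assume g: "g \<in> letters" and p: "p \<in> V"
  show "act g p \<in> V"
  proof (cases g)
    case (HT j)
    then have "j \<le> r" using g by (auto simp: daha_letters_def)
    then show ?thesis using T_V[of j p] p HT by (simp add: act_HT)
  next
    case (HX \<mu>)
    then have "\<mu> \<in> \<Lambda>" using g L_subset_Lambda by (auto simp: daha_letters_def)
    then show ?thesis using p HX by (simp add: act_HX V_mult)
  qed
qed (auto simp: V_0 V_add V_cst simp del: free_algebra_simps intro: relations_closed[THEN subsetD])

lemma ev_free_X: "ev (free_X P) p = P * p"
proof -
  have "ev (\<Sum>\<nu>\<in>S. single [HX \<nu>] (f \<nu>)) p = (\<Sum>\<nu>\<in>S. single \<nu> (f \<nu>)) * p"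
    if "finite S" for S :: "'e set" and f :: "'e \<Rightarrow> 'f"
    using that
    by (induction rule: finite_induct)
      (simp_all add: ev_add ev_single word_act_def act_HX distrib_right mult.assoc[symmetric] mult_single)
  from this[of "keys P"] show ?thesis by (simp add: free_X_def sum_single_lookup)
qed

lemma ev_free_T: "j \<le> r \<Longrightarrow> ev (free_T j) p = T j p"
  by (simp add: ev_single word_act_def act_HT)

lemma ev_free_scalar: "ev (free_scalar c) p = cst c * p"
  by (simp add: ev_single word_act_def)

lemma word_act_alternating:
  "i \<le> r \<Longrightarrow> j \<le> r \<Longrightarrow> word_act (map (\<lambda>t. HT (if even t then i else j)) [0..<l]) p = altw l (T i) (T j) p"
proof (induction l arbitrary: i j)
  case 0 show ?case by (simp add: word_act_def)
next
  case (Suc l)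
  have "map (\<lambda>t. HT (if even t then i else j) :: 'e daha_letter) [0..<Suc l] = HT i # map (\<lambda>t. HT (if even t then j else i)) [0..<l]"
    by (subst upt_conv_Cons) (auto simp: map_Suc_upt[symmetric] simp del: upt_Suc)
  then show ?case unfolding altw.simps Suc.IH[OF Suc.prems(2,1), symmetric] by (simp only: word_act_def foldr.simps o_apply act_HT[OF Suc.prems(1)])
qed

lemma relations_vanish:
  assumes "\<rho> \<in> rels" shows "ev \<rho> p = 0"
proof -
  let ?\<kappa> = "\<lambda>j. kk j"
  consider (braid) i j l where "\<rho> = braid_word l i j - braid_word l j i" "i \<le> r" "j \<le> r" "i \<noteq> j"
      "l = group.ord W (affine_gen n Q a \<theta> i \<otimes>\<^bsub>W\<^esub> affine_gen n Q a \<theta> j)" "l > 0"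
    | (quadratic) j where "\<rho> = (free_T j - free_scalar (?\<kappa> j)) * (free_T j + free_scalar (inverse (?\<kappa> j)))" "j \<le> r"
    | (add) \<mu> \<nu> where "\<rho> = free_X (xpow \<mu>) * free_X (xpow \<nu>) - free_X (xpow (\<mu> + \<nu>))"
    | (zero) "\<rho> = free_X (xpow 0) - 1"
    | (cross) j \<mu> where "\<rho> = free_T j * free_X (xpow \<mu>) - free_X (sx j \<mu>) * free_T j
           - free_scalar (?\<kappa> j - inverse (?\<kappa> j)) *
             free_X (sq j \<mu>)" "j \<le> r" "\<mu> \<in> L"
    using assms unfolding daha_relations_def Let_def daha_param_eq by blast
  then show ?thesis
  proof cases
    case braid
    then show ?thesis
      using braid_relation[OF braid(2-6)] by (simp add: ev_diff braid_word_def ev_single word_act_alternating)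
  next
    case quadratic
    have "cst (inverse (?\<kappa> j)) * (cst (?\<kappa> j) * p) = p"
      using kk_nz[OF quadratic(2)] by (simp add: mult.assoc[symmetric] mult_single)
    then have "cst (?\<kappa> j) * (cst (inverse (?\<kappa> j)) * p) = p" by (simp only: mult.left_commute)
    then show ?thesis
      using T_quadratic[OF quadratic(2), of p] linopD[OF linop_T[OF quadratic(2)]]
      by (simp add: quadratic ev_mult ev_add ev_diff ev_free_T ev_free_scalar distrib_left single_diff left_diff_distrib)
  next
    case add
    then show ?thesis by (simp add: ev_diff ev_mult ev_free_X mult.assoc[symmetric] mult_single)
  next
    case zero
    then show ?thesis by (simp add: ev_diff ev_free_X ev_1)
  next
    case cross
    then show ?thesis
      using cross_relation(1)[OF cross(2,3), of p] by (simp add: ev_diff ev_mult ev_free_X ev_free_T ev_free_scalar)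
  qed
qed

subsection \<open>The metaplectic representation\<close>

lemma T_0_xpow:
  assumes \<omega>: "\<omega> \<in> \<Lambda>"
  shows "T 0 (xpow \<omega>) = scale (- k (mroot n Q \<theta>) * h \<lfloor>polar_form Q \<omega> (coroot \<theta>)\<rfloor> \<theta> * (q_root q \<theta> powi m \<theta>) powi \<lfloor>\<theta> \<cdot> \<omega>\<rfloor>)
       (xpow (reflection \<theta> \<omega>))
    + scale (k (mroot n Q \<theta>) - inverse (k (mroot n Q \<theta>)))
        (exact_quotient (1 - mono_power (q_root q \<theta> powi m \<theta>) (- coroot \<theta>) ((- \<lfloor>\<theta> \<cdot> \<omega>\<rfloor>) mod m \<theta> + \<lfloor>\<theta> \<cdot> \<omega>\<rfloor>))
            (1 - mono_power (q_root q \<theta> powi m \<theta>) (- coroot \<theta>) (m \<theta>)) * xpow \<omega>)"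
proof -
  have g: "\<gamma> 0 = - \<theta>" "cc 0 = q_root q \<theta> powi m \<theta>" by (auto simp: \<gamma>_def cc_def)
  obtain z :: int where z: "\<theta> \<cdot> \<omega> = of_int z" using integral theta_root \<omega> by (meson Ints_cases)
  have f: "- \<lfloor>\<theta> \<cdot> \<omega>\<rfloor> = \<lfloor>(\<gamma> 0) \<cdot> \<omega>\<rfloor>" unfolding g blinfun.minus_left z by simp
  show ?thesis
    unfolding T_xpow[OF le0 \<omega> f] g scale_eq_cst_mult reflection_minus coroot_minus m_minus[OF theta_root]
      k_minus[OF theta_root] hecke_coeff_minus[OF theta_root] floor_polar_coroot[OF theta_root \<omega>]
    by (simp add: hecke_coeff_def)
qed

lemma T_i_xpow:
  assumes i: "i \<in> {1..r}" and \<omega>: "\<omega> \<in> \<Lambda>"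
  shows "T i (xpow \<omega>) = scale (- k (mroot n Q (a i)) * h (- \<lfloor>polar_form Q \<omega> (coroot (a i))\<rfloor>) (a i)) (xpow (reflection (a i) \<omega>))
    + scale (k (mroot n Q (a i)) - inverse (k (mroot n Q (a i))))
        (exact_quotient (1 - xpow (of_int (\<lfloor>(a i) \<cdot> \<omega>\<rfloor> mod m (a i) - \<lfloor>(a i) \<cdot> \<omega>\<rfloor>) *\<^sub>R coroot (a i)))
            (1 - xpow (of_int (m (a i)) *\<^sub>R coroot (a i))) * xpow \<omega>)"
proof -
  have g: "\<gamma> i = a i" "cc i = 1" "i \<le> r" using i by (auto simp: \<gamma>_def cc_def)
  have "a i \<in> \<Phi>" using gamma_root[OF g(3)] g by simp
  then show ?thesis
    unfolding T_xpow[OF g(3) \<omega> refl] g scale_eq_cst_mult floor_polar_coroot[OF _ \<omega>]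
    by (simp add: hecke_coeff_def mono_power_def floor_polar_coroot[OF _ \<omega>])
qed

text \<open>The representation, characterised by the images of the generators on monomials.\<close>

theorem ex1_metaplectic_representation:
  defines "gen \<equiv> presented_gen letters rels"
  shows "\<exists>!\<pi>. \<pi> \<in> extensional (carrier H) \<and> \<pi> \<in> algebra_hom H (End_algebra (group_algebra \<Lambda>)) \<and>
      (\<forall>\<omega>\<in>\<Lambda>. \<pi> (gen (HT 0)) (xpow \<omega>) = T 0 (xpow \<omega>)) \<and>
      (\<forall>i\<in>{1..r}. \<forall>\<omega>\<in>\<Lambda>. \<pi> (gen (HT i)) (xpow \<omega>) = T i (xpow \<omega>)) \<and>
      (\<forall>\<mu>\<in>L. \<forall>\<omega>\<in>\<Lambda>. \<pi> (gen (HX \<mu>)) (xpow \<omega>) = xpow (\<omega> + \<mu>))"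
proof -
  have iff: "((\<forall>\<omega>\<in>\<Lambda>. \<pi> (gen (HT 0)) (xpow \<omega>) = T 0 (xpow \<omega>)) \<and>
      (\<forall>i\<in>{1..r}. \<forall>\<omega>\<in>\<Lambda>. \<pi> (gen (HT i)) (xpow \<omega>) = T i (xpow \<omega>)) \<and>
      (\<forall>\<mu>\<in>L. \<forall>\<omega>\<in>\<Lambda>. \<pi> (gen (HX \<mu>)) (xpow \<omega>) = xpow (\<omega> + \<mu>)))
    \<longleftrightarrow> (\<forall>g\<in>letters. \<forall>p\<in>V. \<pi> (gen g) p = act g p)" (is "?F \<longleftrightarrow> ?G")
    if \<pi>: "\<pi> \<in> algebra_hom H (End_algebra V)" for \<pi>
  proof
    assume G: ?G
    show ?F using G[rule_format, OF HT_letter V_single] G[rule_format, OF HX_letter V_single]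
      by (auto simp: act_HT act_HX mult_single add.commute)
  next
    assume F: ?F
    have mon: "\<pi> (gen g) (xpow \<omega>) = act g (xpow \<omega>)" if g: "g \<in> letters" and \<omega>: "\<omega> \<in> \<Lambda>" for g \<omega>
    proof (cases g)
      case (HT j)
      then have "j = 0 \<or> j \<in> {1..r}" "j \<le> r" using g by (auto simp: daha_letters_def)
      then show ?thesis using F \<omega> HT by (auto simp: act_HT)
    next
      case (HX \<mu>)
      then have "\<mu> \<in> L" using g by (auto simp: daha_letters_def)
      then show ?thesis using F \<omega> HX by (simp add: act_HX mult_single add.commute)
    qed
    show ?G
    proof (intro ballI)
      fix g p assume g: "g \<in> letters" and p: "p \<in> V"
      have "gen g \<in> carrier H" unfolding gen_def presented_gen_eq by (intro coset_closed free_algebra_single) (use g in simp)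
      then have "\<pi> (gen g) \<in> carrier (End_algebra V)" using \<pi> by (auto simp: algebra_hom_def dest: ring_hom_closed)
      then have "linear_on V (\<pi> (gen g))" by (simp add: End_algebra_def)
      from linear_on_V_eq[OF this linop_act mon[OF g] p] show "\<pi> (gen g) p = act g p" .
    qed
  qed
  have eq: "(\<pi> \<in> extensional (carrier H) \<and> \<pi> \<in> algebra_hom H (End_algebra V) \<and>
      (\<forall>\<omega>\<in>\<Lambda>. \<pi> (gen (HT 0)) (xpow \<omega>) = T 0 (xpow \<omega>)) \<and>
      (\<forall>i\<in>{1..r}. \<forall>\<omega>\<in>\<Lambda>. \<pi> (gen (HT i)) (xpow \<omega>) = T i (xpow \<omega>)) \<and>
      (\<forall>\<mu>\<in>L. \<forall>\<omega>\<in>\<Lambda>. \<pi> (gen (HX \<mu>)) (xpow \<omega>) = xpow (\<omega> + \<mu>)))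
    \<longleftrightarrow> (\<pi> \<in> extensional (carrier H) \<and> \<pi> \<in> algebra_hom H (End_algebra V) \<and>
      (\<forall>g\<in>letters. \<forall>p\<in>V. \<pi> (gen g) p = act g p))" for \<pi>
    using iff[of \<pi>] by blast
  show ?thesis
    unfolding V_def[symmetric] eq unfolding gen_def by (rule ex1_representation) (rule relations_vanish)
qed

end

theorem theorem1p6:
  fixes \<Phi> :: "'e::euclidean_space dual set"
    and r :: nat and a :: "nat \<Rightarrow> 'e dual" and \<theta> :: "'e dual"
    and M :: nat and \<Lambda> :: "'e set"
    and q :: "'f::field_char_0"
    and n :: nat and Q :: "'e \<Rightarrow> rat"
    and k :: "'e dual \<Rightarrow> 'f" and h :: "int \<Rightarrow> 'e dual \<Rightarrow> 'f"
  assumes "reduced_root_system \<Phi>" and "irreducible_root_system \<Phi>"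
    and "M > 0" and "Max ((\<lambda>\<alpha>. (norm \<alpha>)\<^sup>2) ` \<Phi>) = 2 / (real M)\<^sup>2"
    and "simple_roots \<Phi> r a"
    and "q \<noteq> 0" and "\<forall>N::nat. N > 0 \<longrightarrow> q ^ N \<noteq> 1"
    and "\<exists>S. finite S \<and> \<Lambda> = int_span S"
    and "coroot_lattice \<Phi> \<subseteq> \<Lambda>"
    and "\<forall>\<alpha>\<in>\<Phi>. \<forall>\<omega>\<in>\<Lambda>. blinfun_apply \<alpha> \<omega> \<in> \<int>"
    and "metaplectic_datum \<Phi> \<Lambda> n Q"
    and "\<theta> \<in> positive_roots \<Phi> r a"
    and "highest_root (metaplectic_roots \<Phi> n Q) r (\<lambda>i. mroot n Q (a i)) (mroot n Q \<theta>)"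
    and "\<forall>\<beta>\<in>metaplectic_roots \<Phi> n Q. k \<beta> \<noteq> 0"
    and "\<forall>\<beta>\<in>metaplectic_roots \<Phi> n Q. \<forall>\<gamma>\<in>metaplectic_roots \<Phi> n Q. norm \<beta> = norm \<gamma> \<longrightarrow> k \<beta> = k \<gamma>"
    and "h \<in> metaplectic_parameters \<Phi> n Q k"
  shows
    "let m = m_root n Q;
         B = (\<lambda>\<omega> \<alpha>. \<lfloor>polar_form Q \<omega> (coroot \<alpha>)\<rfloor>);
         ev = (\<lambda>\<alpha> \<omega>. \<lfloor>blinfun_apply \<alpha> \<omega>\<rfloor>);
         q\<theta> = q_root q \<theta> powi m \<theta>;
         k0 = k (mroot n Q \<theta>);
         ki = (\<lambda>i. k (mroot n Q (a i)));
         G = daha_letters \<Phi> r n Q;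
         R = daha_relations \<Phi> r a \<theta> n Q q k;
         H = presented_algebra G R;
         T = (\<lambda>j. presented_gen G R (HT j));
         X = (\<lambda>\<mu>. presented_gen G R (HX \<mu>))
     in \<exists>!\<pi>. \<pi> \<in> extensional (carrier H) \<and>
          \<pi> \<in> algebra_hom H (End_algebra (group_algebra \<Lambda>)) \<and>
          (\<forall>\<omega>\<in>\<Lambda>. \<pi> (T 0) (xpow \<omega>) =
             scale (- k0 * h (B \<omega> \<theta>) \<theta> * q\<theta> powi ev \<theta> \<omega>) (xpow (reflection \<theta> \<omega>))
             + scale (k0 - inverse k0)
                 (exact_quotient (1 - mono_power q\<theta> (- coroot \<theta>) ((- ev \<theta> \<omega>) mod m \<theta> + ev \<theta> \<omega>))
                                 (1 - mono_power q\<theta> (- coroot \<theta>) (m \<theta>)) * xpow \<omega>)) \<and>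
          (\<forall>i\<in>{1..r}. \<forall>\<omega>\<in>\<Lambda>. \<pi> (T i) (xpow \<omega>) =
             scale (- ki i * h (- B \<omega> (a i)) (a i)) (xpow (reflection (a i) \<omega>))
             + scale (ki i - inverse (ki i))
                 (exact_quotient
                    (1 - xpow (of_int (ev (a i) \<omega> mod m (a i) - ev (a i) \<omega>) *\<^sub>R coroot (a i)))
                    (1 - xpow (of_int (m (a i)) *\<^sub>R coroot (a i))) * xpow \<omega>)) \<and>
          (\<forall>\<mu>\<in>coroot_lattice (metaplectic_roots \<Phi> n Q). \<forall>\<omega>\<in>\<Lambda>.
             \<pi> (X \<mu>) (xpow \<omega>) = xpow (\<omega> + \<mu>))"
proof -
  interpret metaplectic_daha \<Phi> r a \<theta> M \<Lambda> q n Q k h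
  proof
    show "\<exists>S. \<Lambda> = int_span S" using assms(8) by blast
    show "\<theta> \<in> \<Phi>" using assms(12) by (simp add: positive_roots_def)
  qed (use assms in \<open>blast+\<close>)
  show ?thesis
    using ex1_metaplectic_representation unfolding Let_def
    by (simp only: T_0_xpow T_i_xpow cong: ball_cong)
qed

end
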